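(* With the notation of the context, let $\hat a_n,\hat b_n,\hat c_n,\hat d_n,\hat e_n$ be the sums of the labels of the vertices of type $A,B,C,D,E$ on level $n$ (all zero for $n=0,1$), and let $\hat s_n$ be the sum of all labels on level $n$, so $\hat s_0=1$ and $\hat s_n=\hat a_n+\hat b_n+\hat c_n+\hat d_n+\hat e_n+3$ for $n\ge1$. Then each of the sequences $(\hat a_n),(\hat b_n),(\hat c_n),(\hat d_n),(\hat e_n),(\hat s_n)$ satisfies \[\hat{x}_n = 18 \hat{x}_{n-1}-99\hat{x}_{n-2}+226\hat{x}_{n-3}-224\hat{x}_{n-4}+92\hat{x}_{n-5}-12\hat{x}_{n-6} \qquad (n\ge7),\] and $(\hat a_n),(\hat b_n)$ also satisfy $\hat{x}_n = 5 \hat{x}_{n-1}-6\hat{x}_{n-2}+2\hat{x}_{n-3}$ for $n\ge4$. Moreover, for $n\ge1$, \[ \hat{a}_n =\left(\tfrac92\sqrt {2}-6 \right) \left( 2+\sqrt {2} \right) ^{n}+ \left(-\tfrac92\sqrt {2}-6 \right) \left( 2-\sqrt {2} \right) ^{n}+6,\qquad \hat{b}_n= \left(\tfrac92 -3\sqrt {2} \right) \left( 2+\sqrt {2} \right)^{n} + \left( \tfrac92+3\sqrt {2} \right) \left( 2-\sqrt {2} \right) ^{n} -6, \] and \[\hat{s}_n=3+ \tfrac32\left(\sqrt {2}-1 \right) \left( 2+\sqrt {2} \right) ^{n}- \tfrac32\left(\sqrt {2}+1 \right) \left( 2-\sqrt {2} \right)^{n} +\delta_4\alpha_4^n+\delta_5\alpha_5^n+\delta_6\alpha_6^n,\]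 where, with $\varphi=\tfrac13\arctan(9\sqrt{101}/128)$, $\alpha_4=(-\sqrt{85}\cos\varphi-\sqrt{3}\sqrt{85}\sin\varphi+13)/3 \approx 0.240683$, $\alpha_5=(-\sqrt{85}\cos\varphi+\sqrt{3}\sqrt{85}\sin\varphi+13)/3 \approx 2.408387$, $\alpha_6=(2\sqrt{85}\cos\varphi+13)/3 \approx 10.350930$ are the roots of $x^{3}-13x^{2}+28x-6=0$, and $\delta_4,\delta_5,\delta_6$ are real constants with $\delta_4\approx 1.137480$, $\delta_5\approx -0.144699$, $\delta_6\approx 0.007219$.
   Context: Consider the regular cubic honeycomb $\{4,3,5\}$ of hyperbolic 3-space (congruent cubes, five around each edge, icosahedral vertex figure). Fix a cube $Q_0$ and a vertex $V_0$ of it; $\mathcal P$ is the union of the cubes of the honeycomb lying in the closed region bounded by the three pairwise perpendicular honeycomb planes through $V_0$ containing the faces of $Q_0$ at $V_0$ (the side containing $Q_0$). $G_{\mathcal P}$ is the graph of vertices and edges of the honeycomb in $\mathcal P$. Each vertex $V$ is labelled by the number of distinct shortest paths in $G_{\mathcal P}$ from $V_0$ to $V$. Level $n$ is the set of vertices at graph distance $n$ from $V_0$; ascendants of a vertex on level $n\ge1$ are its neighbours on level $n-1$. On level $n\ge1$: vertices on an intersection line of two bounding planes (exactly 3 per level, each with label 1) have type "1"; other vertices on a bounding plane have type $A$ (2 ascendants) or $B$ (1 ascendant); vertices off the bounding planes have type $C$, $D$, $E$ (3, 2, 1 ascendants).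
   Formalization: Face planes of a cube meet at 72°, so no pairwise perpendicular honeycomb planes contain the faces of Q_0 at V_0; each such plane is read as the {4,5} surface of faces through that face, bounding the layer of cubes bisected by the parallel midplane of Q_0. *)

theory Defs
  imports "HOL-Analysis.Analysis"
begin

text \<open>
  We use the hyperboloid model: a point \<open>(x, t)\<close> with \<open>x \<bullet> x - t\<^sup>2 = -1\<close> and \<open>t > 0\<close>.
  A hyperbolic plane is \<open>{p \<in> hyp3. mink p n = 0}\<close> for a normal \<open>n\<close> with \<open>mink n n > 0\<close>.
\<close>

type_synonym point = "(real^3) \<times> real"

definition mink :: "point \<Rightarrow> point \<Rightarrow> real" where
  "mink p q = fst p \<bullet> fst q - snd p * snd q"

definition hyp3 :: "point set" where
  "hyp3 = {p. mink p p = -1 \<and> snd p > 0}"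

definition reflection :: "point \<Rightarrow> point \<Rightarrow> point" where
  "reflection n p = p - (2 * mink p n / mink n n) *\<^sub>R n"

text \<open>
  In the projective coordinates \<open>y = x / t\<close> the base cube is \<open>{y. \<forall>i. \<bar>y $ i\<bar> \<le> cube_radius}\<close>.
  Its dihedral angle \<open>\<theta>\<close> satisfies \<open>cos \<theta> = r\<^sup>2 / (1 - r\<^sup>2)\<close> for \<open>r = cube_radius\<close>, and the value
  of \<open>r\<close> is the one with \<open>\<theta> = 2\<pi>/5\<close> (see \<open>dihedral_angle\<close> below), so that five cubes
  close up around each edge.
\<close>

definition cube_radius :: real where
  "cube_radius = sqrt (sqrt 5 - 2)"

text \<open>For \<open>s = 1\<close> or \<open>s = -1\<close>: the outward normal of the face \<open>y $ i = s * cube_radius\<close>.\<close>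

definition face_normal :: "3 \<Rightarrow> real \<Rightarrow> point" where
  "face_normal i s = (axis i s, cube_radius)"

text \<open>
  All cells (edges, square faces, cubes) are represented by their sets of vertices; the actual cell
  is the hyperbolic convex hull, and incidence of cells is inclusion of vertex sets.
\<close>

definition base_cube :: "point set" where
  "base_cube = {p \<in> hyp3. \<forall>i. \<bar>fst p $ i\<bar> = cube_radius * snd p}"

definition base_faces :: "point set set" where
  "base_faces = {{p \<in> base_cube. mink p (face_normal i s) = 0} | i s. s \<in> {-1, 1}}"

definition base_edges :: "point set set" where
  "base_edges = {F \<inter> F' | F F'. F \<in> base_faces \<and> F' \<in> base_faces \<and> F \<noteq> F' \<and> F \<inter> F' \<noteq> {}}"

text \<open>
  The group generated by the reflections in the six face planes of the base cube.  If \<open>g\<close> belongs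
  to it and \<open>r\<close> is one of the six reflections, then \<open>(g \<circ> r) ` base_cube\<close> is the mirror image of
  the cube \<open>g ` base_cube\<close> in one of its own faces; so the images of the base cube are the cubes
  obtained from it by repeatedly passing to the neighbour across a face, i.e. all the cubes of the
  honeycomb.  (The generators are involutions, so that closure under inverses is automatic.)
\<close>

inductive_set honeycomb_group :: "(point \<Rightarrow> point) set" where
  id: "id \<in> honeycomb_group"
| step: "g \<in> honeycomb_group \<Longrightarrow> s \<in> {-1, 1} \<Longrightarrow> g \<circ> reflection (face_normal i s) \<in> honeycomb_group"

definition cubes :: "point set set" where
  "cubes = {g ` base_cube | g. g \<in> honeycomb_group}"

definition faces :: "point set set" where
  "faces = {g ` F | g F. g \<in> honeycomb_group \<and> F \<in> base_faces}"

definition edges :: "point set set" where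
  "edges = {g ` e | g e. g \<in> honeycomb_group \<and> e \<in> base_edges}"

lemma cos_two_pi_fifths: "cos (2 * pi / 5) = (sqrt 5 - 1) / 4"
proof -
  define c where "c = cos (2 * pi / 5)"
  have "cos (3 * (2 * pi / 5)) = cos (2 * pi - 2 * (2 * pi / 5))"
    by (rule arg_cong[of _ _ cos]) (simp add: field_simps)
  also have "\<dots> = cos (2 * (2 * pi / 5))"
    by (simp only: cos_diff cos_two_pi sin_two_pi)
  finally have "4 * c ^ 3 - 3 * c = 2 * c\<^sup>2 - 1"
    unfolding c_def cos_treble_cos cos_double_cos .
  hence eq: "(c - 1) * (4 * c\<^sup>2 + 2 * c - 1) = 0"
    by (simp add: algebra_simps power2_eq_square power3_eq_cube)
  have "c < cos 0"
    unfolding c_def by (rule cos_monotone_0_pi) auto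
  hence "4 * c\<^sup>2 + 2 * c - 1 = 0"
    using eq by simp
  hence "(4 * c + 1)\<^sup>2 = 5"
    by (simp add: algebra_simps power2_eq_square)
  moreover have "c > 0"
    unfolding c_def by (rule cos_gt_zero) auto
  ultimately have "4 * c + 1 = sqrt 5"
    by (intro real_sqrt_unique[symmetric]) auto
  thus ?thesis
    by (simp add: c_def)
qed

lemma dihedral_angle:
  assumes "i \<noteq> j" and s: "s \<in> {-1, 1}" "s' \<in> {-1, 1}"
  shows "- mink (face_normal i s) (face_normal j s') /
           (sqrt (mink (face_normal i s) (face_normal i s)) *
            sqrt (mink (face_normal j s') (face_normal j s'))) = cos (2 * pi / 5)"
proof -
  have five: "2 \<le> sqrt 5" "sqrt 5 < 3"
    by (simp_all add: real_le_rsqrt real_less_lsqrt)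
  have r: "cube_radius * cube_radius = sqrt 5 - 2"
    using five by (simp add: cube_radius_def)
  have n: "mink (face_normal k u) (face_normal k u) = 3 - sqrt 5" if "u \<in> {-1, 1}" for k u
    using that by (auto simp: mink_def face_normal_def inner_axis_axis r)
  have "- mink (face_normal i s) (face_normal j s') = sqrt 5 - 2"
    using assms by (auto simp: mink_def face_normal_def inner_axis_axis r)
  moreover have "(sqrt 5 - 2) / (3 - sqrt 5) = (sqrt 5 - 1) / 4"
    using five by (simp add: field_simps)
  ultimately show ?thesis
    using five by (simp add: n[OF s(1)] n[OF s(2)] cos_two_pi_fifths)
qed

text \<open>
  Let \<open>F\<close> be a face of the cube \<open>Q\<close>.  The plane midway between \<open>F\<close> and the opposite face of \<open>Q\<close>
  has normal \<open>\<Sum>(Q - F) - \<Sum>F\<close>, pointing away from \<open>F\<close>.  For the three faces at a corner of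
  \<open>Q\<close> these midplanes are pairwise perpendicular.  The cubes of the honeycomb which meet a midplane
  are bisected by it and form a layer, whose two boundary surfaces are mosaics \<open>{4,5}\<close> made of
  faces of the honeycomb.  The boundary surface containing \<open>F\<close> (\<open>wall Q F\<close>) plays the role of
  the honeycomb plane through \<open>F\<close>: the geometric plane spanned by \<open>F\<close> itself cuts through the
  interior of cubes, because the number of cubes around an edge is odd, and the planes spanned by
  two adjacent faces of \<open>Q\<close> meet at the angle \<open>2\<pi>/5\<close>.

  The side of this surface containing \<open>Q\<close> (\<open>inner_side Q F\<close>) consists of the layer and of everything
  beyond it, i.e. of the cubes meeting the open half-space beyond the midplane; a cube meets an open
  half-space iff one of its vertices belongs to it.
\<close>

definition inner_side :: "point set \<Rightarrow> point set \<Rightarrow> point set set" where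
  "inner_side Q F = {K \<in> cubes. \<exists>p\<in>K. mink p (\<Sum>(Q - F) - \<Sum>F) > 0}"

definition wall :: "point set \<Rightarrow> point set \<Rightarrow> point set set" where
  "wall Q F = {G \<in> faces. (\<exists>K \<in> inner_side Q F. G \<subseteq> K) \<and> (\<exists>K \<in> cubes - inner_side Q F. G \<subseteq> K)}"

definition corner_faces :: "point set \<Rightarrow> point \<Rightarrow> point set set" where
  "corner_faces Q V = {F \<in> faces. F \<subseteq> Q \<and> V \<in> F}"

definition pyramid :: "point set \<Rightarrow> point \<Rightarrow> point set set" where
  "pyramid Q V = {K \<in> cubes. \<forall>F \<in> corner_faces Q V. K \<in> inner_side Q F}"

definition verts :: "point set \<Rightarrow> point \<Rightarrow> point set" where
  "verts Q V = \<Union>(pyramid Q V)"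

definition adj :: "point set \<Rightarrow> point \<Rightarrow> point \<Rightarrow> point \<Rightarrow> bool" where
  "adj Q V u v \<longleftrightarrow> u \<noteq> v \<and> {u, v} \<in> edges \<and> (\<exists>K \<in> pyramid Q V. {u, v} \<subseteq> K)"

text \<open>Walks with \<open>n\<close> edges from the apex \<open>V\<close> to \<open>v\<close>, as lists of \<open>n + 1\<close> vertices.\<close>

definition walks :: "point set \<Rightarrow> point \<Rightarrow> nat \<Rightarrow> point \<Rightarrow> point list set" where
  "walks Q V n v = {xs. length xs = Suc n \<and> hd xs = V \<and> last xs = v \<and>
                        set xs \<subseteq> verts Q V \<and> successively (adj Q V) xs}"

definition level :: "point set \<Rightarrow> point \<Rightarrow> nat \<Rightarrow> point set" where
  "level Q V n = {v \<in> verts Q V. walks Q V n v \<noteq> {} \<and> (\<forall>m<n. walks Q V m v = {})}"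

definition label :: "point set \<Rightarrow> point \<Rightarrow> point \<Rightarrow> nat" where
  "label Q V v = card (walks Q V (LEAST n. walks Q V n v \<noteq> {}) v)"

definition ascendants :: "point set \<Rightarrow> point \<Rightarrow> nat \<Rightarrow> point \<Rightarrow> point set" where
  "ascendants Q V n v = {u \<in> level Q V (n - 1). adj Q V u v}"

text \<open>The bounding surfaces (indexed by the faces at the apex) on which a vertex lies.\<close>

definition walls_at :: "point set \<Rightarrow> point \<Rightarrow> point \<Rightarrow> point set set" where
  "walls_at Q V v = {F \<in> corner_faces Q V. v \<in> \<Union>(wall Q F)}"

definition type_One :: "point set \<Rightarrow> point \<Rightarrow> nat \<Rightarrow> point set" where
  "type_One Q V n = {v \<in> level Q V n. n \<ge> 1 \<and>
     (\<exists>F \<in> walls_at Q V v. \<exists>F' \<in> walls_at Q V v. F \<noteq> F')}"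

definition type_A :: "point set \<Rightarrow> point \<Rightarrow> nat \<Rightarrow> point set" where
  "type_A Q V n = {v \<in> level Q V n. n \<ge> 1 \<and> v \<notin> type_One Q V n \<and>
     walls_at Q V v \<noteq> {} \<and> card (ascendants Q V n v) = 2}"

definition type_B :: "point set \<Rightarrow> point \<Rightarrow> nat \<Rightarrow> point set" where
  "type_B Q V n = {v \<in> level Q V n. n \<ge> 1 \<and> v \<notin> type_One Q V n \<and>
     walls_at Q V v \<noteq> {} \<and> card (ascendants Q V n v) = 1}"

definition type_C :: "point set \<Rightarrow> point \<Rightarrow> nat \<Rightarrow> point set" where
  "type_C Q V n = {v \<in> level Q V n. n \<ge> 1 \<and>
     walls_at Q V v = {} \<and> card (ascendants Q V n v) = 3}"

definition type_D :: "point set \<Rightarrow> point \<Rightarrow> nat \<Rightarrow> point set" where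
  "type_D Q V n = {v \<in> level Q V n. n \<ge> 1 \<and>
     walls_at Q V v = {} \<and> card (ascendants Q V n v) = 2}"

definition type_E :: "point set \<Rightarrow> point \<Rightarrow> nat \<Rightarrow> point set" where
  "type_E Q V n = {v \<in> level Q V n. n \<ge> 1 \<and>
     walls_at Q V v = {} \<and> card (ascendants Q V n v) = 1}"

text \<open>Sum of the labels over a finite set of vertices (real-valued because of the recurrences).\<close>

definition label_sum :: "point set \<Rightarrow> point \<Rightarrow> point set \<Rightarrow> real" where
  "label_sum Q V S = (\<Sum>v\<in>S. real (label Q V v))"

end

theory Submission
  imports Defs
begin

text \<open>
  The vertices and edges of \<open>{4,3,5}\<close> form the Cayley graph of a right-angled Coxeter group: the
  midplanes of the cubes at a vertex bound a right-angled dodecahedron, the cell of the dual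
  honeycomb, and the reflections in its twelve faces (the \<^emph>\<open>letters\<close>) generate a group which is
  simply transitive on the vertices.  Two letters commute iff the corresponding vertices of the
  icosahedral vertex figure are adjacent.  If \<open>D\<close> is the set of possible last letters of the
  reduced words for a vertex, then \<open>D\<close> is a clique, it corresponds to the ascendants, and appending
  a letter \<open>a \<notin> D\<close> turns \<open>D\<close> into \<open>a\<close> together with the elements of \<open>D\<close> commuting with \<open>a\<close>.
  A shortest path stays in the pyramid iff, for each of the three letters \<open>i\<close> of the base cube,
  the letters before the first occurrence of \<open>i\<close> (all letters, if \<open>i\<close> does not occur) commute
  with \<open>i\<close>.  Hence shortest paths are the words accepted by a
  finite automaton, whose states are \<open>D\<close> and the set of those midplanes at the apex which
  have not been crossed.  By the symmetry of the icosahedron the transitions between the types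
  only depend on the cardinalities of these two sets.  This gives a linear system with
  characteristic polynomial \<open>(x - 1) (x\<^sup>2 - 4 x + 2) (x\<^sup>3 - 13 x\<^sup>2 + 28 x - 6)\<close>.
\<close>

section \<open>The dodecahedron around the apex\<close>

text \<open>That words with the same end vertex represent the same group element is not taken from
  the theory of Coxeter groups but from a sign computation: for a reduced word, the Minkowski
  products of the apex with the twelve walls at the end vertex are positive exactly for the
  descents. The induction closes because letters that do not commute have ultraparallel planes, with
  product of unit normals below -1. The definitions speak of another group, generated by the
  reflections in the faces of the base cube. The bridge is that the three face reflections at the
  apex fix the apex and permute the letters; so cubes, faces and edges are the images under words of
  the cells spanned by cliques of 3, 2 and 1 letters. The pyramid enters through one number: with
  each of its three midplane normals a vertex of it has a product that is positive or equal to
  \<open>- apex_depth\<close>, whereas a forbidden letter makes some product smaller than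
  \<open>- apex_depth\<close>. In the characteristic polynomial, x - 1 belongs to type 1, the
  quadratic to A and B, the cubic to C, D and E.\<close>

lemma mink_commute: "mink p q = mink q p"
  by (simp add: mink_def inner_commute)

lemma mink_add_left: "mink (p + q) x = mink p x + mink q x"
  and mink_diff_left: "mink (p - q) x = mink p x - mink q x"
  and mink_scaleR_left: "mink (c *\<^sub>R p) x = c * mink p x"
  and mink_add_right: "mink x (p + q) = mink x p + mink x q"
  and mink_diff_right: "mink x (p - q) = mink x p - mink x q"
  and mink_scaleR_right: "mink x (c *\<^sub>R p) = c * mink x p"
  by (simp_all add: mink_def inner_simps algebra_simps)

lemmas mink_simps = mink_add_left mink_diff_left mink_scaleR_left
  mink_add_right mink_diff_right mink_scaleR_right

definition isometry :: "(point \<Rightarrow> point) \<Rightarrow> bool" where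
  "isometry h \<longleftrightarrow> linear h \<and> (\<forall>p q. mink (h p) (h q) = mink p q)"

lemma isometry_mink: "isometry h \<Longrightarrow> mink (h p) (h q) = mink p q"
  unfolding isometry_def by blast

lemma isometry_linear: "isometry h \<Longrightarrow> linear h"
  by (simp add: isometry_def)

lemma isometry_id: "isometry id"
  by (simp add: isometry_def linear_id)

lemma isometry_compose: "isometry g \<Longrightarrow> isometry h \<Longrightarrow> isometry (g \<circ> h)"
  unfolding isometry_def by (auto intro: linear_compose simp del: split_paired_All)

lemma isometry_inj:
  assumes "isometry h"
  shows "inj h"
proof (rule injI)
  fix p q
  assume eq: "h p = h q"
  define d where "d = p - q"
  have "mink d x = 0" for x
    using isometry_mink[OF assms, of p x] isometry_mink[OF assms, of q x] eq
    by (simp add: d_def mink_simps)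
  \<comment> \<open>The form is nondegenerate: with the sign of the last coordinate changed in one
    argument, \<open>mink\<close> becomes the Euclidean inner product.\<close>
  from this[of "(fst d, - snd d)"] have "fst d \<bullet> fst d + snd d * snd d = 0"
    by (simp add: mink_def)
  hence "fst d = 0 \<and> snd d = 0"
    by (metis add_nonneg_eq_0_iff inner_eq_zero_iff inner_ge_zero mult_eq_0_iff zero_le_square)
  thus "p = q"
    by (simp add: d_def prod_eq_iff)
qed

lemma isometry_reflection:
  assumes "mink n n \<noteq> 0"
  shows "isometry (reflection n)"
proof -
  have "linear (reflection n)"
    by (rule linearI)
      (simp_all add: reflection_def mink_simps add_divide_distrib algebra_simps)
  moreover have "mink (reflection n p) (reflection n q) = mink p q" for p q
    using assms
    by (simp add: reflection_def mink_simps mink_commute[of n q] field_simps)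
  ultimately show ?thesis
    by (simp add: isometry_def)
qed

lemma isometry_reflection_conj:
  assumes "isometry h"
  shows "h (reflection n p) = reflection (h n) (h p)"
  using assms by (simp add: reflection_def isometry_mink linear_diff[OF isometry_linear]
      linear_scale[OF isometry_linear])

lemma reflection_invol:
  assumes "mink n n \<noteq> 0"
  shows "reflection n (reflection n p) = p"
  using assms by (simp add: reflection_def mink_simps)

section \<open>The golden ratio and the size of the base cube\<close>

definition golden :: real where "golden = (1 + sqrt 5) / 2"

lemma golden_sq: "golden * golden = golden + 1"
  by (simp add: golden_def field_simps)

lemma golden_gt: "golden > 8 / 5"
proof -
  have "11 / 5 < sqrt 5"
    by (rule real_less_rsqrt) (simp add: power2_eq_square)
  thus ?thesis
    by (simp add: golden_def)
qed

text \<open>With r = \<open>cube_radius\<close>, 1 - 3 * r^2 equals 10 - 6 * \<open>golden\<close>;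
  so 5/3 is exactly the bound that puts the vertices of the cube inside the unit ball
  (\<open>radius_bound\<close>).\<close>

lemma golden_lt: "golden < 5 / 3"
proof -
  have "sqrt 5 < 7 / 3"
    by (rule real_less_lsqrt) (auto simp: power2_eq_square)
  thus ?thesis
    by (simp add: golden_def)
qed

lemma radius_sq: "cube_radius * cube_radius = 2 * golden - 3"
proof -
  have "2 \<le> sqrt 5"
    by (simp add: real_le_rsqrt)
  thus ?thesis
    by (simp add: cube_radius_def golden_def)
qed

lemma radius_pos: "cube_radius > 0"
proof -
  have "2 < sqrt 5"
    by (simp add: real_less_rsqrt)
  thus ?thesis
    by (simp add: cube_radius_def)
qed

section \<open>The twelve letters and their normals\<close>

datatype dir = DX | DY | DZ

fun axis_of :: "dir \<Rightarrow> 3" where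
  "axis_of DX = 1" | "axis_of DY = 2" | "axis_of DZ = 3"

lemma axis_of_inj [simp]: "axis_of i = axis_of j \<longleftrightarrow> i = j"
  by (cases i; cases j) auto

lemma axis_of_surj: "\<exists>i. k = axis_of i"
  using exhaust_3[of k] by (metis axis_of.simps)

fun third :: "dir \<Rightarrow> dir \<Rightarrow> dir" where
  "third DX DY = DZ" | "third DY DX = DZ" | "third DX DZ = DY" | "third DZ DX = DY"
| "third DY DZ = DX" | "third DZ DY = DX" | "third i _ = i"

text \<open>The letters \<open>L0 i\<close> stand for the midplanes of the base cube.  The others arise from these by
  the reflections in the three faces of the base cube at the apex (\<open>face_perm\<close> below), and
  \<open>L0 i\<close> is opposite to \<open>L3 i\<close>, \<open>L1 i\<close> to \<open>L2 i\<close>.\<close>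

datatype letter = L0 dir | L1 dir | L2 dir | L3 dir

text \<open>Letters commute iff their midplanes are perpendicular, as \<open>mink_normal\<close>
  confirms. Each letter has five partners, as each vertex of the icosahedron has five
  neighbours.\<close>

fun commutes :: "letter \<Rightarrow> letter \<Rightarrow> bool" where
  "commutes (L0 i) (L0 j) \<longleftrightarrow> i \<noteq> j"
| "commutes (L0 i) (L1 j) \<longleftrightarrow> i \<noteq> j"
| "commutes (L1 i) (L0 j) \<longleftrightarrow> i \<noteq> j"
| "commutes (L0 i) (L2 j) \<longleftrightarrow> i = j"
| "commutes (L2 i) (L0 j) \<longleftrightarrow> i = j"
| "commutes (L1 i) (L2 j) \<longleftrightarrow> i \<noteq> j"
| "commutes (L2 i) (L1 j) \<longleftrightarrow> i \<noteq> j"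
| "commutes (L1 i) (L3 j) \<longleftrightarrow> i = j"
| "commutes (L3 i) (L1 j) \<longleftrightarrow> i = j"
| "commutes (L2 i) (L3 j) \<longleftrightarrow> i \<noteq> j"
| "commutes (L3 i) (L2 j) \<longleftrightarrow> i \<noteq> j"
| "commutes (L3 i) (L3 j) \<longleftrightarrow> i \<noteq> j"
| "commutes _ _ \<longleftrightarrow> False"

lemma commutes_sym: "commutes a b \<longleftrightarrow> commutes b a"
  by (cases a; cases b) auto

lemma commutes_irrefl [simp]: "\<not> commutes a a"
  by (cases a) auto

text \<open>Unit normals with the apex on their negative side. Those of \<open>L1\<close>,
  \<open>L2\<close> and \<open>L3\<close> are the images of the coordinate vectors under the face
  reflections at the apex.\<close>

fun normal :: "letter \<Rightarrow> point" where
  "normal (L0 i) = (axis (axis_of i) 1, 0)"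
| "normal (L1 i) = (- golden *\<^sub>R axis (axis_of i) 1, (golden + 1) * cube_radius)"
| "normal (L2 i) = (golden *\<^sub>R axis (axis_of i) 1 - golden *\<^sub>R 1, (2 * golden + 1) * cube_radius)"
| "normal (L3 i) = (- axis (axis_of i) 1 - golden *\<^sub>R 1, (3 * golden + 2) * cube_radius)"

lemma inner_one: "axis i 1 \<bullet> (1::real^3) = 1" "(1::real^3) \<bullet> axis i 1 = 1" "(1::real^3) \<bullet> 1 = 3"
  by (simp_all add: inner_axis inner_axis') (simp add: inner_vec_def)

text \<open>The values 0, \<open>- golden\<close> and \<open>- golden - 1\<close> belong to letters
  that are adjacent, at distance two and opposite in the icosahedron.\<close>

lemma mink_normal:
  "mink (normal a) (normal b) =
    (if a = b then 1 else if commutes a b then 0 else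
      case (a, b) of (L0 i, L3 j) \<Rightarrow> if i = j then - golden - 1 else - golden
        | (L3 i, L0 j) \<Rightarrow> if i = j then - golden - 1 else - golden
        | (L1 i, L2 j) \<Rightarrow> - golden - 1 | (L2 i, L1 j) \<Rightarrow> - golden - 1 | _ \<Rightarrow> - golden)"
proof -
  have r: "cube_radius * (cube_radius * x) = (2 * golden - 3) * x" for x
    by (simp add: radius_sq[symmetric])
  have r': "golden * (golden * x) = (golden + 1) * x" for x
    by (simp add: golden_sq[symmetric])
  show ?thesis
    by (cases a; cases b)
      (auto simp: mink_def r inner_simps inner_one inner_axis_axis algebra_simps golden_sq r' radius_sq)
qed

lemma mink_normal_self [simp]: "mink (normal a) (normal a) = 1"
  by (simp add: mink_normal)

lemma mink_normal_commutes: "commutes a b \<Longrightarrow> mink (normal a) (normal b) = 0"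
  by (auto simp: mink_normal)

text \<open>A product below -1 means that the two planes are ultraparallel: they neither meet nor
  touch at infinity.\<close>

lemma mink_normal_far: "a \<noteq> b \<Longrightarrow> \<not> commutes a b \<Longrightarrow> mink (normal a) (normal b) < -1"
  using golden_gt by (auto simp: mink_normal split: letter.splits)

section \<open>Reflections in the letters and in the faces of the base cube\<close>

abbreviation letter_refl :: "letter \<Rightarrow> point \<Rightarrow> point" where
  "letter_refl a \<equiv> reflection (normal a)"

lemma letter_refl_eq: "letter_refl a p = p - (2 * mink p (normal a)) *\<^sub>R normal a"
  by (simp add: reflection_def)

text \<open>The hyperbolic sine of the distance from the apex to each of the twelve midplanes (see
  \<open>mink_apex_normal\<close>).\<close>

definition apex_depth :: real where "apex_depth = cube_radius / sqrt (1 - 3 * (cube_radius * cube_radius))"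

definition apex :: point where
  "apex = (1 / sqrt (1 - 3 * (cube_radius * cube_radius))) *\<^sub>R (- cube_radius *\<^sub>R 1, 1)"

lemma radius_bound: "1 - 3 * (cube_radius * cube_radius) > 0"
  using golden_lt by (simp add: radius_sq)

lemma apex_depth_pos: "apex_depth > 0"
  using radius_bound radius_pos by (simp add: apex_depth_def)

text \<open>The apex is the centre of the dodecahedron, equally far from all its face
  planes.\<close>

lemma mink_apex_normal: "mink apex (normal a) = - apex_depth"
proof -
  have "mink (- cube_radius *\<^sub>R 1, 1) (normal a) = - cube_radius"
    by (cases a) (auto simp: mink_def inner_simps inner_one algebra_simps)
  thus ?thesis
    unfolding apex_def apex_depth_def by (simp only: mink_simps) simp
qed

text \<open>The permutation of the letters induced by the reflection in the face of direction
  \<open>i\<close> at the apex; \<open>face_refl_normal\<close> justifies the table.\<close>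

fun face_perm :: "dir \<Rightarrow> letter \<Rightarrow> letter" where
  "face_perm i (L0 j) = (if i = j then L1 i else L0 j)"
| "face_perm i (L1 j) = (if i = j then L0 i else L2 (third i j))"
| "face_perm i (L2 j) = (if i = j then L3 i else L1 (third i j))"
| "face_perm i (L3 j) = (if i = j then L2 i else L3 j)"

abbreviation face_refl :: "dir \<Rightarrow> real \<Rightarrow> point \<Rightarrow> point" where
  "face_refl i s \<equiv> reflection (face_normal (axis_of i) s)"

lemma mink_face_normal:
  assumes "s \<in> {-1, 1}"
  shows "mink (face_normal i s) (face_normal i s) = 2 * (2 - golden)"
  using assms by (auto simp: mink_def face_normal_def inner_axis_axis radius_sq)

text \<open>Because 1 / (2 - \<open>golden\<close>) = \<open>golden\<close> + 1, the reflection is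
  free of division, and the coordinate computation in \<open>face_refl_normal\<close> only has to
  reduce powers of \<open>golden\<close>.\<close>

lemma face_refl_eq:
  assumes "s \<in> {-1, 1}"
  shows "face_refl i s p = p - ((golden + 1) * mink p (face_normal (axis_of i) s)) *\<^sub>R face_normal (axis_of i) s"
proof -
  have "1 / (2 - golden) = golden + 1"
    using golden_lt by (simp add: field_simps golden_sq)
  hence "2 * x / (2 * (2 - golden)) = (golden + 1) * x" for x
    by (metis mult.commute mult_divide_mult_cancel_left_if times_divide_eq_right
        mult.right_neutral zero_neq_numeral)
  thus ?thesis
    using mink_face_normal[OF assms, of "axis_of i"] by (simp only: reflection_def)
qed

lemma isometry_face_refl: "s \<in> {-1, 1} \<Longrightarrow> isometry (face_refl i s)"
  using golden_lt by (intro isometry_reflection) (simp add: mink_face_normal)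

lemma face_refl_invol: "s \<in> {-1, 1} \<Longrightarrow> face_refl i s (face_refl i s p) = p"
  using golden_lt by (intro reflection_invol) (simp add: mink_face_normal)

lemma isometry_letter_refl: "isometry (letter_refl a)"
  by (rule isometry_reflection) simp

lemma letter_refl_invol [simp]: "letter_refl a (letter_refl a p) = p"
  by (rule reflection_invol) simp

lemma face_refl_apex: "face_refl i (-1) apex = apex"
proof -
  have "mink apex (face_normal (axis_of i) (-1)) = 0"
    by (simp add: mink_def apex_def face_normal_def inner_simps)
       (simp add: inner_axis)
  thus ?thesis
    by (simp add: reflection_def)
qed

lemma face_normal_eq: "face_normal (axis_of i) (-1) = (- axis (axis_of i) 1, cube_radius)"
  and face_normal_eq': "face_normal (axis_of i) 1 = (axis (axis_of i) 1, cube_radius)"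
  by (simp_all add: face_normal_def vec_eq_iff axis_def)

lemma face_refl_normal: "face_refl i (-1) (normal a) = normal (face_perm i a)"
proof -
  have r: "cube_radius * (cube_radius * x) = (2 * golden - 3) * x" for x
    by (simp add: radius_sq[symmetric])
  have r': "golden * (golden * x) = (golden + 1) * x" for x
    by (simp add: golden_sq[symmetric])
  have m: "mink (normal a) (- axis (axis_of i) 1, cube_radius) =
    (case a of L0 j \<Rightarrow> if i = j then -1 else 0
      | L1 j \<Rightarrow> if i = j then 1 else 1 - golden
      | L2 j \<Rightarrow> if i = j then - 1 else golden - 1
      | L3 j \<Rightarrow> if i = j then 1 else 0)"
    by (cases a) (auto simp: mink_def inner_simps inner_one inner_axis_axis algebra_simps
        golden_sq r r' radius_sq)
  show ?thesis
    unfolding face_refl_eq[of "-1", simplified face_normal_eq, simplified] face_normal_eq m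
    by (cases a; rule dir.exhaust[of i];
        rule dir.exhaust[of "case a of L0 j \<Rightarrow> j | L1 j \<Rightarrow> j | L2 j \<Rightarrow> j | L3 j \<Rightarrow> j"])
      (auto simp: vec_eq_iff forall_3 axis_def algebra_simps golden_sq r r')
qed

text \<open>The face opposite to the one at the apex is its mirror image in the midplane
  \<open>L0 i\<close>. So the six generators are the three face reflections at the apex and their
  conjugates by letters.\<close>

lemma face_refl_one: "face_refl i 1 p = letter_refl (L0 i) (face_refl i (-1) (letter_refl (L0 i) p))"
proof -
  have "letter_refl (L0 i) (face_normal (axis_of i) (-1)) = face_normal (axis_of i) 1"
    unfolding letter_refl_eq face_normal_eq face_normal_eq'
    by (simp add: mink_def inner_axis_axis scaleR_2)
  thus ?thesis
    using isometry_reflection_conj[OF isometry_letter_refl, of "L0 i" "face_normal (axis_of i) (-1)" "letter_refl (L0 i) p"]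
    by (simp del: normal.simps)
qed

declare normal.simps [simp del]

section \<open>Words in the reflections\<close>

declare split_paired_All [simp del] split_paired_Ex [simp del]

text \<open>Words are reversed lists: the head of the list is the letter which was appended last.\<close>

primrec act :: "letter list \<Rightarrow> point \<Rightarrow> point" where
  "act [] p = p"
| "act (a # us) p = act us (letter_refl a p)"

text \<open>Appending a letter moves to a neighbour: \<open>point_of (a # us)\<close> is the image
  under \<open>act us\<close> of the neighbour \<open>letter_refl a apex\<close> of the
  apex.\<close>

definition point_of :: "letter list \<Rightarrow> point" where
  "point_of us = act us apex"

text \<open>For a reduced word these are the possible last letters of the reduced words for the same
  group element.\<close>

primrec descents :: "letter list \<Rightarrow> letter set" where
  "descents [] = {}"
| "descents (a # us) = insert a (descents us \<inter> {b. commutes a b})"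

text \<open>\<open>Z\<close> is a set of walls at the apex.  As long as all letters commute with \<open>i \<in> Z\<close>, the vertex lies
  next to the wall \<open>i\<close>, and the letter \<open>i\<close> crosses this wall.\<close>

primrec uncrossed :: "letter set \<Rightarrow> letter list \<Rightarrow> letter set" where
  "uncrossed Z [] = Z"
| "uncrossed Z (a # us) = uncrossed Z us - {a}"

text \<open>A new letter must not shorten the word, and it must cross or run parallel to each wall
  not yet crossed. For \<open>Z = {}\<close> only the first condition remains, so one recursion
  covers reduced words and paths in the pyramid.\<close>

primrec admissible :: "letter set \<Rightarrow> letter list \<Rightarrow> bool" where
  "admissible Z [] \<longleftrightarrow> True"
| "admissible Z (a # us) \<longleftrightarrow> admissible Z us \<and> a \<notin> descents us \<and> (\<forall>i\<in>uncrossed Z us. a = i \<or> commutes a i)"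

abbreviation reduced :: "letter list \<Rightarrow> bool" where
  "reduced \<equiv> admissible {}"

lemma uncrossed_empty [simp]: "uncrossed {} us = {}"
  by (induction us) auto

lemma uncrossed_subset: "uncrossed Z us \<subseteq> Z"
  by (induction us) auto

lemma admissible_reduced: "admissible Z us \<Longrightarrow> reduced us"
  by (induction us) auto

lemma act_append: "act (us @ vs) p = act vs (act us p)"
  by (induction us arbitrary: p) simp_all

lemma isometry_act: "isometry (act us)"
proof (induction us)
  case Nil
  have "act [] = id"
    by (rule ext) simp
  thus ?case
    by (simp only: isometry_id)
next
  case (Cons a us)
  have "act (a # us) = act us \<circ> letter_refl a"
    by (rule ext) simp
  thus ?case
    by (simp only: isometry_compose[OF Cons isometry_letter_refl])
qed

lemma act_rev [simp]: "act us (act (rev us) p) = p" "act (rev us) (act us p) = p"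
  by (induction us arbitrary: p) (simp_all add: act_append)

section \<open>Words as group elements\<close>

definition same_action :: "letter list \<Rightarrow> letter list \<Rightarrow> bool" where
  "same_action us vs \<longleftrightarrow> act us = act vs"

lemma sameI: "(\<And>p. act us p = act vs p) \<Longrightarrow> same_action us vs"
  by (auto simp: same_action_def)

lemma sameD: "same_action us vs \<Longrightarrow> act us p = act vs p"
  by (auto simp: same_action_def)

lemma same_action_refl [simp]: "same_action us us"
  by (simp add: same_action_def)

lemma same_action_sym: "same_action us vs \<Longrightarrow> same_action vs us"
  by (simp add: same_action_def)

lemma same_action_trans [trans]: "same_action us vs \<Longrightarrow> same_action vs ws \<Longrightarrow> same_action us ws"
  by (simp add: same_action_def)

lemma same_action_Cons: "same_action us vs \<Longrightarrow> same_action (a # us) (a # vs)"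
  by (rule sameI) (simp add: sameD)

lemma same_action_double: "same_action (a # a # us) us"
  by (rule sameI) simp

lemma same_action_cancel: "same_action us (a # vs) \<Longrightarrow> same_action (a # us) vs"
  by (rule sameI) (simp add: sameD)

text \<open>Letters act as involutions, so reversal is inversion.\<close>

lemma same_action_rev:
  assumes "same_action us vs"
  shows "same_action (rev us) (rev vs)"
proof (rule sameI)
  fix p
  have "act (rev us) p = act (rev vs) (act vs (act (rev us) p))"
    by simp
  also have "act vs (act (rev us) p) = p"
    by (simp flip: sameD[OF assms])
  finally show "act (rev us) p = act (rev vs) p" .
qed

lemma letter_refl_commute:
  assumes "commutes a b"
  shows "letter_refl a (letter_refl b p) = letter_refl b (letter_refl a p)"
  using mink_normal_commutes[OF assms] mink_normal_commutes[of b a] assms commutes_sym[of a b]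
  by (simp add: letter_refl_eq mink_simps algebra_simps)

lemma letter_refl_fixes: "commutes a b \<Longrightarrow> letter_refl a (normal b) = normal b"
  using mink_normal_commutes[of b a] commutes_sym[of a b] by (simp add: letter_refl_eq)

text \<open>Equivalently the product of the apex with \<open>act us (normal j)\<close>, the normal
  of wall \<open>j\<close> at the vertex \<open>point_of us\<close>. It is positive iff this wall
  separates the vertex from the apex.\<close>

definition side :: "letter list \<Rightarrow> letter \<Rightarrow> real" where
  "side us j = mink (act (rev us) apex) (normal j)"

lemma side_Nil [simp]: "side [] j = - apex_depth"
  by (simp add: side_def mink_apex_normal)

lemma side_Cons: "side (a # us) j = side us j - 2 * side us a * mink (normal a) (normal j)"
  by (simp add: side_def act_append letter_refl_eq mink_simps)

text \<open>Inversion exchanges the roles of apex and vertex: walls at the apex seen from a vertex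
  become walls at a vertex seen from the apex.\<close>

lemma side_act: "mink (point_of us) (normal j) = side (rev us) j"
  by (simp add: side_def point_of_def)

lemma side_cong:
  assumes "same_action us vs"
  shows "side us = side vs"
  using sameD[OF same_action_rev[OF assms]] by (simp add: side_def fun_eq_iff)

text \<open>The strict bound for non-commuting letters is what makes the induction go through: it
  forces the sign of \<^term>\<open>side\<close> to become negative for every letter which does not commute
  with the one just appended.\<close>

lemma side_sign:
  assumes "reduced us"
  shows "(\<forall>j. if j \<in> descents us then side us j > 0 else side us j < 0) \<and>
         (\<forall>j k. j \<noteq> k \<longrightarrow> \<not> commutes j k \<longrightarrow> side us j + side us k < 0)"
  using assms
proof (induction us)
  case Nil
  thus ?case using apex_depth_pos by simp
next
  case (Cons a us)
  define f where "f = side us"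
  define g where "g = side (a # us)"
  have IH: "j \<in> descents us \<Longrightarrow> f j > 0" "j \<notin> descents us \<Longrightarrow> f j < 0"
    "j \<noteq> k \<Longrightarrow> \<not> commutes j k \<Longrightarrow> f j + f k < 0" for j k
    using Cons unfolding f_def by (auto split: if_splits)
  have neg: "f a < 0"
    using Cons.prems IH by auto
  have ga: "g a = - f a"
    by (simp add: g_def f_def side_Cons)
  have gc: "g j = f j" if "commutes a j" for j
    using that by (simp add: g_def f_def side_Cons mink_normal_commutes)
  have gn: "g j < f j + 2 * f a" if "j \<noteq> a" "\<not> commutes a j" for j
  proof -
    have "f a * mink (normal a) (normal j) > f a * (-1)"
      using that neg mink_normal_far[of a j] mult_strict_left_mono_neg[of "mink (normal a) (normal j)" "-1" "f a"]
      by auto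
    thus ?thesis
      by (simp add: g_def side_Cons f_def)
  qed
  have le: "g j \<le> f j" if "j \<noteq> a" for j
    using gc[of j] gn[of j] neg that by (cases "commutes a j") auto
  have 1: "if j \<in> descents (a # us) then g j > 0 else g j < 0" for j
  proof (cases "j = a \<or> commutes a j")
    case True
    thus ?thesis
      using ga gc[of j] neg IH(1,2)[of j] by auto
  next
    case False
    thus ?thesis
      using gn[of j] IH(3)[of j a] neg commutes_sym[of a j] by auto
  qed
  \<comment> \<open>If \<open>a\<close> is one of the two letters, then
    \<open>g a + g k < f a + f k\<close>; otherwise neither value has increased.\<close>
  have 2: "g j + g k < 0" if jk: "j \<noteq> k" "\<not> commutes j k" for j k
  proof -
    consider "j = a" | "k = a" | "j \<noteq> a" "k \<noteq> a" by blast
    thus ?thesis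
    proof cases
      case 1
      thus ?thesis
        using ga gn[of k] IH(3)[of a k] jk neg by auto
    next
      case 2
      thus ?thesis
        using ga gn[of j] IH(3)[of a j] jk neg commutes_sym[of a j] by auto
    next
      case 3
      thus ?thesis
        using le[of j] le[of k] IH(3)[of j k] jk by auto
    qed
  qed
  show ?case
    using 1 2 unfolding g_def by blast
qed

lemma side_pos_iff: "reduced us \<Longrightarrow> side us j > 0 \<longleftrightarrow> j \<in> descents us"
  using side_sign[of us] by (auto split: if_splits simp: not_less dest: less_asym spec[of _ j])

text \<open>The signs of \<open>side\<close> determine the descents, and \<open>side\<close> depends
  on the group element only.\<close>

lemma descents_cong: "reduced us \<Longrightarrow> reduced vs \<Longrightarrow> same_action us vs \<Longrightarrow> descents us = descents vs"
  using side_cong[of us vs] side_pos_iff[of us] side_pos_iff[of vs] by auto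

text \<open>The letters appended after the relevant occurrence of \<open>k\<close> commute with it,
  so \<open>k\<close> can be moved past them to the end. This is the exchange property for
  right-angled groups.\<close>

lemma admissible_pop:
  assumes "admissible Z us" "k \<in> descents us"
  shows "\<exists>us'. admissible Z (k # us') \<and> length us = length (k # us') \<and>
           uncrossed Z us = uncrossed Z (k # us') \<and> same_action us (k # us')"
  using assms
proof (induction us)
  case (Cons j us)
  show ?case
  proof (cases "k = j")
    case True
    thus ?thesis using Cons.prems by auto
  next
    case False
    hence k: "k \<in> descents us" "commutes j k"
      using Cons.prems by auto
    then obtain us' where us': "admissible Z (k # us')" "length us = length (k # us')"
      "uncrossed Z us = uncrossed Z (k # us')" "same_action us (k # us')"
      using Cons by auto
    \<comment> \<open>As \<open>j\<close> commutes with \<open>k\<close>, it would otherwise be a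
      descent of \<open>k # us'\<close>, hence of \<open>us\<close>, and \<open>j # us\<close> would
      not be reduced.\<close>
    have j: "j \<notin> descents us'"
    proof
      assume "j \<in> descents us'"
      hence "j \<in> descents (k # us')"
        using k commutes_sym by auto
      also have "\<dots> = descents us"
        using us' Cons.prems by (intro descents_cong) (auto intro: admissible_reduced same_action_sym)
      finally show False
        using Cons.prems by auto
    qed
    have "same_action (j # us) (j # k # us')"
      using us'(4) by (rule same_action_Cons)
    also have "same_action (j # k # us') (k # j # us')"
      using letter_refl_commute[OF k(2)] by (intro sameI) simp
    finally have "same_action (j # us) (k # j # us')" .
    moreover
    have "admissible Z (k # j # us')"
      using us' j k False Cons.prems commutes_sym[of j k] by auto
    ultimately show ?thesis
      using us' by (intro exI[of _ "j # us'"]) auto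
  qed
qed simp

text \<open>A letter that is already a descent cancels after \<open>admissible_pop\<close>. The last
  disjunction says that words which are not reduced become strictly shorter;
  \<open>reduced_iff_minimal\<close> needs it.\<close>

lemma reduce:
  "\<exists>us'. reduced us' \<and> same_action us' us \<and> length us' \<le> length us \<and>
    (reduced us \<or> length us' < length us)"
proof (induction us)
  case (Cons a us)
  then obtain us' where us': "reduced us'" "same_action us' us" "length us' \<le> length us"
    "reduced us \<or> length us' < length us"
    by blast
  have eq: "same_action (a # us') (a # us)"
    using us'(2) by (rule same_action_Cons)
  show ?case
  proof (cases "a \<in> descents us'")
    case True
    then obtain vs where vs: "reduced (a # vs)" "length us' = length (a # vs)"
      "same_action us' (a # vs)"
      using admissible_pop[OF us'(1)] by blast
    have "same_action vs (a # us)"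
      using same_action_trans[OF same_action_sym[OF same_action_cancel[OF vs(3)]] eq] .
    thus ?thesis
      using vs us' by (intro exI[of _ vs]) auto
  next
    case False
    have "reduced (a # us')"
      using us' False by simp
    moreover have "reduced us \<Longrightarrow> reduced (a # us)"
      using us' False descents_cong[of us us'] same_action_sym by auto
    ultimately show ?thesis
      using us' eq by (intro exI[of _ "a # us'"]) auto
  qed
qed auto

text \<open>If the apex is fixed, all values of \<open>side\<close> are those of the empty word, so
  there is no descent; but the last letter of a nonempty word always is one.\<close>

lemma reduced_eq_Nil:
  assumes "reduced us" "point_of us = apex"
  shows "us = []"
proof -
  have "act (rev us) apex = apex"
    using assms(2) act_rev(2)[of us apex] by (simp add: point_of_def)
  hence "side us j = - apex_depth" for j
    by (simp add: side_def mink_apex_normal)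
  hence "descents us = {}"
    using side_pos_iff[OF assms(1)] apex_depth_pos by auto
  thus ?thesis
    by (cases us) auto
qed

text \<open>The action on vertices is free: reducing the product of \<open>us\<close> and the
  inverse of \<open>vs\<close>, which fixes the apex, gives the empty word.\<close>

lemma point_of_faithful:
  assumes "point_of us = point_of vs"
  shows "same_action us vs"
proof -
  obtain ws where ws: "reduced ws" "same_action ws (us @ rev vs)"
    using reduce by blast
  have "point_of ws = apex"
    using assms sameD[OF ws(2)] by (simp add: point_of_def act_append)
  hence "ws = []"
    by (rule reduced_eq_Nil[OF ws(1)])
  hence "act (rev vs) (act us p) = p" for p
    using sameD[OF ws(2), of p] by (simp add: act_append)
  from this[THEN arg_cong[of _ _ "act vs"]] show ?thesis
    by (intro sameI) simp
qed

lemma point_of_cong: "same_action us vs \<Longrightarrow> point_of us = point_of vs"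
  by (simp add: point_of_def sameD)

lemma reduced_length_cong:
  assumes "reduced us" "reduced vs" "same_action us vs"
  shows "length us = length vs"
  using assms
proof (induction us arbitrary: vs)
  case Nil
  hence "point_of vs = apex"
    using point_of_cong[of "[]" vs] by (simp add: point_of_def)
  hence "vs = []"
    by (rule reduced_eq_Nil[OF Nil(2)])
  thus ?case by simp
next
  case (Cons a us)
  have "a \<in> descents vs"
    using descents_cong[OF Cons.prems] by auto
  then obtain vs' where vs': "reduced (a # vs')" "length vs = length (a # vs')"
    "same_action vs (a # vs')"
    using admissible_pop[OF Cons.prems(2)] by blast
  have "same_action us (a # a # us)"
    by (rule same_action_sym[OF same_action_double])
  also have "same_action (a # a # us) vs'"
    using same_action_trans[OF Cons.prems(3) vs'(3)] by (rule same_action_cancel)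
  finally show ?case
    using Cons.IH[of vs'] Cons.prems vs' by auto
qed

lemma reduced_iff_minimal:
  assumes "reduced us" "same_action us vs" "length us = length vs"
  shows "reduced vs"
proof (rule ccontr)
  assume "\<not> reduced vs"
  then obtain ws where ws: "reduced ws" "same_action ws vs" "length ws < length vs"
    using reduce[of vs] by blast
  have "length us = length ws"
    using assms(1) ws(1) same_action_trans[OF assms(2) same_action_sym[OF ws(2)]] by (rule reduced_length_cong)
  thus False
    using ws(3) assms(3) by simp
qed

text \<open>Reduced words are those of minimal length, and inversion preserves length: shortening
  \<open>rev us\<close> would shorten \<open>us\<close>.\<close>

lemma reduced_rev:
  assumes "reduced us"
  shows "reduced (rev us)"
proof -
  obtain vs where vs: "reduced vs" "same_action vs (rev us)" "length vs \<le> length (rev us)"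
    using reduce[of "rev us"] by blast
  obtain ws where ws: "reduced ws" "same_action ws (rev vs)" "length ws \<le> length (rev vs)"
    using reduce[of "rev vs"] by blast
  have "same_action ws us"
    using same_action_trans[OF ws(2) same_action_rev[OF vs(2)]] by simp
  hence "length us = length ws"
    using reduced_length_cong[OF ws(1) assms] by simp
  hence "length vs = length (rev us)"
    using vs(3) ws(3) by simp
  thus ?thesis
    using reduced_iff_minimal[OF vs(1,2)] by simp
qed

lemma descents_append_mono: "descents xs \<subseteq> descents (xs @ [a])"
  by (induction xs) auto

text \<open>The added letter \<open>a\<close> stands at the far end, as the first letter of the
  word. A new descent can only be this letter, after commuting with all of
  \<open>xs\<close>.\<close>

lemma descents_append_new:
  "i \<in> descents (xs @ [a]) \<Longrightarrow> i \<notin> descents xs \<Longrightarrow> same_action (xs @ [a]) (i # xs)"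
proof (induction xs)
  case (Cons j xs)
  hence i: "i \<noteq> j" "commutes j i" "i \<in> descents (xs @ [a])" "i \<notin> descents xs"
    by auto
  hence "same_action (xs @ [a]) (i # xs)"
    using Cons.IH by blast
  hence "same_action (j # xs @ [a]) (j # i # xs)"
    by (rule same_action_Cons)
  also have "same_action (j # i # xs) (i # j # xs)"
    using letter_refl_commute[OF i(2)] by (intro sameI) simp
  finally show ?case by simp
qed auto

text \<open>A midplane at the apex that separates two neighbouring vertices bisects their edge.
  After reversal, the change of sign makes \<open>i\<close> a new descent of a word extended at its
  far end, and \<open>descents_append_new\<close> applies.\<close>

lemma crossing:
  assumes "mink (point_of us) (normal i) \<le> 0" "mink (point_of (a # us)) (normal i) > 0"
  shows "act us (letter_refl a p) = letter_refl i (act us p)"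
proof -
  obtain vs where vs: "reduced vs" "same_action vs us"
    using reduce by blast
  have le: "side (rev vs) i \<le> 0" and gt: "side (rev (a # vs)) i > 0"
    using assms point_of_cong[OF vs(2)] point_of_cong[OF same_action_Cons[OF vs(2)], of a]
      side_act[of vs i] side_act[of "a # vs" i] by (auto simp del: rev.simps)
  have nin: "i \<notin> descents (rev vs)"
    using le side_pos_iff[OF reduced_rev[OF vs(1)], of i] by auto
  \<comment> \<open>The step leads away from the apex: otherwise the shorter word would already end
    beyond the wall, and hence so would the longer one.\<close>
  have "a \<notin> descents vs"
  proof
    assume "a \<in> descents vs"
    then obtain ws where ws: "reduced (a # ws)" "same_action vs (a # ws)"
      using admissible_pop[OF vs(1)] by blast
    have "reduced ws" and eq: "same_action (a # vs) ws"
      using ws same_action_cancel by auto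
    hence "side (rev ws) i > 0"
      using gt side_cong[OF same_action_rev[OF eq]] by metis
    hence "i \<in> descents (rev ws)"
      using side_pos_iff reduced_rev \<open>reduced ws\<close> by blast
    hence "i \<in> descents (rev (a # ws))"
      using descents_append_mono[of "rev ws" a] by auto
    hence "side (rev (a # ws)) i > 0"
      using side_pos_iff reduced_rev ws(1) by blast
    thus False
      using le side_cong[OF same_action_rev[OF ws(2)]] by (metis not_le)
  qed
  hence "reduced (a # vs)"
    using vs by simp
  hence "i \<in> descents (rev vs @ [a])"
    using gt side_pos_iff reduced_rev by fastforce
  hence "same_action (rev vs @ [a]) (i # rev vs)"
    using nin by (rule descents_append_new)
  from same_action_rev[OF this] have "same_action (a # vs) (vs @ [i])"
    by simp
  from sameD[OF this, of p] show ?thesis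
    using sameD[OF vs(2)] by (simp add: act_append)
qed

section \<open>The cells of the honeycomb\<close>

text \<open>For a clique of 1, 2 or 3 letters these are the vertices of an edge, a square or a cube
  at the apex.\<close>

definition cell :: "letter set \<Rightarrow> point set" where
  "cell T = point_of ` lists T"

lemma act_point_of: "act us (point_of vs) = point_of (vs @ us)"
  by (simp add: point_of_def act_append)

lemma point_of_in_cell: "set zs \<subseteq> T \<Longrightarrow> point_of zs \<in> cell T"
  by (auto simp: cell_def)

lemma in_cellE:
  assumes "p \<in> cell T"
  obtains zs where "set zs \<subseteq> T" "p = point_of zs"
  using assms by (auto simp: cell_def in_lists_conv_set)

lemma apex_in_cell: "apex \<in> cell T"
  using point_of_in_cell[of "[]" T] by (simp add: point_of_def)

lemma cell_mono: "S \<subseteq> T \<Longrightarrow> cell S \<subseteq> cell T"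
  unfolding cell_def by (intro image_mono lists_mono)

lemma act_image_append: "act (us @ vs) ` X = act vs ` act us ` X"
  by (auto simp: act_append image_iff)

lemma act_cell:
  assumes "set zs \<subseteq> T"
  shows "act zs ` cell T = cell T"
proof -
  have sub: "act ys ` cell T \<subseteq> cell T" if "set ys \<subseteq> T" for ys
    using that by (auto simp: cell_def act_point_of simp del: split_paired_All
        intro!: image_eqI[of _ point_of "_ @ ys"])
  have "p \<in> act zs ` cell T" if "p \<in> cell T" for p
  proof -
    have "act (rev zs) p \<in> cell T"
      using sub[of "rev zs"] that assms by auto
    hence "act zs (act (rev zs) p) \<in> act zs ` cell T"
      by (rule imageI)
    thus ?thesis by simp
  qed
  thus ?thesis
    using sub[OF assms] by blast
qed

lemma same_action_image: "same_action us vs \<Longrightarrow> act us ` X = act vs ` X"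
  by (simp add: same_action_def)

text \<open>Since an element of the group is determined by the image of the apex, a cell can be written
  with any of its vertices in the role of the apex.\<close>

lemma rebase:
  assumes "point_of us \<in> act vs ` cell T"
  shows "act vs ` cell T = act us ` cell T"
proof -
  obtain ys where ys: "set ys \<subseteq> T" "point_of us = point_of (ys @ vs)"
    using assms by (auto elim!: in_cellE simp: act_point_of)
  have "act us ` cell T = act (ys @ vs) ` cell T"
    by (rule same_action_image[OF point_of_faithful[OF ys(2)]])
  thus ?thesis
    by (simp add: act_image_append act_cell[OF ys(1)])
qed

lemma face_refl_letter_refl: "face_refl i (-1) (letter_refl a p) = letter_refl (face_perm i a) (face_refl i (-1) p)"
  using isometry_reflection_conj[OF isometry_face_refl[of "-1" i], of "normal a" p] by (simp add: face_refl_normal)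

lemma face_refl_act: "face_refl i (-1) (act us p) = act (map (face_perm i) us) (face_refl i (-1) p)"
  by (induction us arbitrary: p) (simp_all add: face_refl_letter_refl)

lemma face_refl_point_of: "face_refl i (-1) (point_of us) = point_of (map (face_perm i) us)"
  by (simp add: point_of_def face_refl_act face_refl_apex)

lemma face_refl_cell: "face_refl i (-1) ` cell T = cell (face_perm i ` T)"
  by (simp add: cell_def image_image face_refl_point_of lists_image)

lemma third_eq: "i \<noteq> j \<Longrightarrow> third i j \<noteq> i \<and> third i j \<noteq> j \<and> third i (third i j) = j"
  by (cases i; cases j) auto

lemma face_perm_invol [simp]: "face_perm i (face_perm i a) = a"
  by (cases a) (metis face_perm.simps third_eq)+

lemma face_perm_image_invol [simp]: "face_perm i ` face_perm i ` T = T"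
  by (simp add: image_image)

lemma face_perm_inj: "inj (face_perm i)"
  by (metis injI face_perm_invol)

text \<open>Commutation is orthogonality of normals, which isometries preserve.\<close>

lemma face_perm_commutes: "commutes (face_perm i a) (face_perm i b) = commutes a b"
proof -
  have "mink (normal (face_perm i a)) (normal (face_perm i b)) = mink (normal a) (normal b)"
    by (simp add: isometry_mink[OF isometry_face_refl] flip: face_refl_normal)
  moreover have "commutes a b \<longleftrightarrow> mink (normal a) (normal b) = 0" for a b
    using mink_normal_commutes[of a b] mink_normal_far[of a b] by (cases "commutes a b"; cases "a = b") auto
  ultimately show ?thesis by simp
qed

section \<open>The cells of the base cube in terms of words\<close>

definition base_triple :: "letter set" where "base_triple = range L0"

lemma base_triple_eq: "base_triple = {L0 DX, L0 DY, L0 DZ}"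
  unfolding base_triple_def by (auto intro: dir.exhaust)

lemma all_axes: "(\<forall>k. P (k::3)) \<longleftrightarrow> (\<forall>i. P (axis_of i))"
  by (metis axis_of_surj)

lemma refl_L0: "letter_refl (L0 i) (x, t) = (x - (2 * x $ axis_of i) *\<^sub>R axis (axis_of i) 1, t)"
  unfolding letter_refl_eq by (simp add: normal.simps mink_def inner_axis)

lemma base_cube_iff: "p \<in> base_cube \<longleftrightarrow> p \<in> hyp3 \<and> (\<forall>i. \<bar>fst p $ axis_of i\<bar> = cube_radius * snd p)"
  unfolding base_cube_def all_axes by simp

lemma refl_L0_base_cube:
  assumes "p \<in> base_cube"
  shows "letter_refl (L0 i) p \<in> base_cube"
proof -
  obtain x t where p: "p = (x, t)" by (cases p)
  have "mink (letter_refl (L0 i) p) (letter_refl (L0 i) p) = mink p p"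
    by (rule isometry_mink[OF isometry_letter_refl])
  thus ?thesis
    using assms unfolding base_cube_iff hyp3_def p refl_L0
    by (auto simp: axis_def)
qed

text \<open>On the base cube the hyperboloid equation reads t^2 * (1 - 3 * r^2) = 1 with r =
  \<open>cube_radius\<close>, so all eight vertices have the same last coordinate t.\<close>

lemma base_cube_apex: "apex \<in> base_cube"
  and base_cube_snd: "p \<in> base_cube \<Longrightarrow> snd p = snd apex"
proof -
  define t where "t = 1 / sqrt (1 - 3 * (cube_radius * cube_radius))"
  have t: "t > 0" "t * t * (1 - 3 * (cube_radius * cube_radius)) = 1"
    using radius_bound by (simp_all add: t_def)
  have a: "apex = (- (t * cube_radius) *\<^sub>R 1, t)"
    by (simp add: apex_def t_def)
  show "apex \<in> base_cube"
    using t radius_pos unfolding a base_cube_iff hyp3_def mink_def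
    by (simp add: inner_one algebra_simps)
  assume p: "p \<in> base_cube"
  have c: "fst p $ axis_of i * fst p $ axis_of i = cube_radius * cube_radius * (snd p * snd p)" for i
  proof -
    have "\<bar>fst p $ axis_of i\<bar> * \<bar>fst p $ axis_of i\<bar> = (cube_radius * snd p) * (cube_radius * snd p)"
      using p by (simp add: base_cube_iff)
    thus ?thesis by (simp add: algebra_simps)
  qed
  have "fst p \<bullet> fst p = 3 * (cube_radius * cube_radius) * (snd p * snd p)"
    using c[of DX] c[of DY] c[of DZ] by (simp add: inner_vec_def sum_3)
  hence "snd p * snd p * (1 - 3 * (cube_radius * cube_radius)) = 1"
    using p unfolding base_cube_iff hyp3_def mink_def by (auto simp: algebra_simps)
  with t(2) have "(snd p * snd p - t * t) * (1 - 3 * (cube_radius * cube_radius)) = 0"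
    by (simp only: left_diff_distrib)
  hence "snd p ^ 2 = t ^ 2"
    using radius_bound by (simp add: power2_eq_square)
  thus "snd p = snd apex"
    using p t(1) unfolding base_cube_iff hyp3_def a by (auto simp: power2_eq_iff)
qed

lemma mink_L0: "mink p (normal (L0 i)) = fst p $ axis_of i"
  by (simp add: normal.simps mink_def inner_axis)

text \<open>A vertex of the cube is reached from the apex by flipping its positive
  coordinates.\<close>

lemma base_cube_word:
  assumes "p \<in> base_cube"
  shows "\<exists>zs. set zs \<subseteq> {L0 i | i. mink p (normal (L0 i)) > 0} \<and> p = point_of zs"
proof -
  obtain x t where p: "p = (x, t)" by (cases p)
  have t: "t = snd apex"
    using base_cube_snd[OF assms] p by simp
  have t0: "t > 0"
    using assms p by (simp add: base_cube_def hyp3_def)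
  have a: "apex = (- (cube_radius * t) *\<^sub>R 1, t)"
    by (simp add: t apex_def)
  have x: "x $ axis_of i = (if mink p (normal (L0 i)) > 0 then cube_radius * t else - (cube_radius * t))" for i
  proof -
    have "\<bar>x $ axis_of i\<bar> = cube_radius * t"
      using assms unfolding base_cube_iff p by simp
    thus ?thesis
      by (auto simp: mink_L0 p)
  qed
  define w where "w i = (if mink p (normal (L0 i)) > 0 then [L0 i] else [])" for i
  have 1: "set (w DX @ w DY @ w DZ) \<subseteq> {L0 i | i. mink p (normal (L0 i)) > 0}"
    by (auto simp: w_def)
  have "p = point_of (w DX @ w DY @ w DZ)"
    using x[of DX] x[of DY] x[of DZ]
    by (auto simp: point_of_def w_def p a refl_L0 vec_eq_iff forall_3 axis_def split: if_splits)
  with 1 show ?thesis by blast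
qed

lemma mink_refl_L0: "mink (letter_refl (L0 i) p) (normal (L0 j)) = (if i = j then - 1 else 1) * mink p (normal (L0 j))"
  by (cases p) (simp add: refl_L0 mink_L0 axis_def)

text \<open>The letters of \<open>T\<close> flip only their own coordinates; the others keep the
  negative sign they have at the apex.\<close>

lemma cell_base:
  assumes "T \<subseteq> base_triple"
  shows "cell T = {p \<in> base_cube. \<forall>i. L0 i \<notin> T \<longrightarrow> mink p (normal (L0 i)) < 0}"
proof (intro equalityI subsetI)
  fix p
  assume "p \<in> cell T"
  then obtain zs where zs: "set zs \<subseteq> T" "p = point_of zs"
    by (rule in_cellE)
  have "act zs q \<in> base_cube \<and> (\<forall>i. L0 i \<notin> T \<longrightarrow> mink (act zs q) (normal (L0 i)) < 0)"
    if "q \<in> base_cube" "\<forall>i. L0 i \<notin> T \<longrightarrow> mink q (normal (L0 i)) < 0" for q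
    using zs(1) that
  proof (induction zs arbitrary: q)
    case (Cons a zs)
    then obtain j where j: "a = L0 j"
      using assms by (auto simp: base_triple_def)
    have "act zs (letter_refl a q) \<in> base_cube \<and>
      (\<forall>i. L0 i \<notin> T \<longrightarrow> mink (act zs (letter_refl a q)) (normal (L0 i)) < 0)"
      using Cons.prems by (intro Cons.IH) (auto simp: j mink_refl_L0 intro: refl_L0_base_cube)
    thus ?case by simp
  qed auto
  from this[OF base_cube_apex] show "p \<in> {p \<in> base_cube. \<forall>i. L0 i \<notin> T \<longrightarrow> mink p (normal (L0 i)) < 0}"
    using apex_depth_pos zs(2) by (simp add: point_of_def mink_apex_normal)
next
  fix p
  assume p: "p \<in> {p \<in> base_cube. \<forall>i. L0 i \<notin> T \<longrightarrow> mink p (normal (L0 i)) < 0}"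
  then obtain zs where "set zs \<subseteq> {L0 i | i. mink p (normal (L0 i)) > 0}" "p = point_of zs"
    using base_cube_word by blast
  thus "p \<in> cell T"
    using p by (force intro!: point_of_in_cell)
qed

lemma base_cube_eq: "base_cube = cell base_triple"
  by (subst cell_base) (auto simp: base_triple_def)

text \<open>A uniform description of the base cube (\<open>m = 3\<close>), its faces
  (\<open>m = 2\<close>) and its edges (\<open>m = 1\<close>).\<close>

definition base_cells :: "nat \<Rightarrow> point set set" where
  "base_cells m = {act zs ` cell T | zs T. set zs \<subseteq> base_triple \<and> T \<subseteq> base_triple \<and> card T = m}"

lemma card_base_triple: "card base_triple = 3" and finite_base_triple: "finite base_triple"
  by (simp_all add: base_triple_eq)

lemma base_cells_3: "base_cells 3 = {base_cube}"
proof -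
  have "T = base_triple" if "T \<subseteq> base_triple" "card T = 3" for T
    using that card_subset_eq[OF finite_base_triple] by (simp add: card_base_triple)
  hence "base_cells 3 = {act zs ` cell base_triple | zs. set zs \<subseteq> base_triple}"
    unfolding base_cells_def using card_base_triple by (auto simp: base_triple_def)
  also have "\<dots> = {cell base_triple}"
  proof -
    have "set [] \<subseteq> base_triple \<and> cell base_triple = act [] ` cell base_triple"
      using act_cell[of "[]" base_triple] by simp
    thus ?thesis
      using act_cell[of _ base_triple] by blast
  qed
  finally show ?thesis
    by (simp add: base_cube_eq)
qed

lemma card_2_base_triple:
  assumes "T \<subseteq> base_triple" "card T = 2"
  shows "\<exists>i. T = base_triple - {L0 i}"
proof -
  have "card (base_triple - T) = 1"
    using assms card_Diff_subset[of T base_triple] finite_subset[OF assms(1) finite_base_triple] by (simp add: card_base_triple)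
  then obtain a where a: "base_triple - T = {a}"
    by (auto simp: card_1_singleton_iff)
  then obtain i where "a = L0 i"
    by (auto simp: base_triple_def)
  thus ?thesis
    using a assms(1) by blast
qed

lemma card_base_triple_minus: "card (base_triple - {L0 i}) = 2"
  using card_base_triple finite_base_triple by (simp add: base_triple_def)

lemma mink_face_normal_1: "mink p (face_normal (axis_of i) 1) = mink p (normal (L0 i)) - cube_radius * snd p"
  and mink_face_normal_m1: "mink p (face_normal (axis_of i) (-1)) = - mink p (normal (L0 i)) - cube_radius * snd p"
  by (simp_all add: face_normal_eq face_normal_eq' normal.simps mink_def)

lemma base_cube_normal:
  assumes "p \<in> base_cube"
  shows "mink p (normal (L0 i)) = cube_radius * snd p \<or> mink p (normal (L0 i)) = - (cube_radius * snd p)"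
    and "cube_radius * snd p > 0"
proof -
  have "\<bar>mink p (normal (L0 i))\<bar> = cube_radius * snd p"
    using assms by (simp add: base_cube_iff mink_L0)
  thus "mink p (normal (L0 i)) = cube_radius * snd p \<or> mink p (normal (L0 i)) = - (cube_radius * snd p)"
    by linarith
  show "cube_radius * snd p > 0"
    using assms radius_pos by (simp add: base_cube_def hyp3_def)
qed

lemma base_face_m1: "{p \<in> base_cube. mink p (face_normal (axis_of i) (-1)) = 0} = cell (base_triple - {L0 i})"
proof -
  have "mink p (face_normal (axis_of i) (-1)) = 0 \<longleftrightarrow> mink p (normal (L0 i)) < 0" if "p \<in> base_cube" for p
    using base_cube_normal(1)[OF that, of i] base_cube_normal(2)[OF that] by (auto simp: mink_face_normal_m1)
  thus ?thesis
    by (subst cell_base) (auto simp: base_triple_def)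
qed

lemma base_face_1: "{p \<in> base_cube. mink p (face_normal (axis_of i) 1) = 0} = letter_refl (L0 i) ` cell (base_triple - {L0 i})"
proof -
  have 1: "mink p (face_normal (axis_of i) 1) = 0 \<longleftrightarrow> mink (letter_refl (L0 i) p) (face_normal (axis_of i) (-1)) = 0"
    if "p \<in> base_cube" for p
    using base_cube_snd[OF that] base_cube_snd[OF refl_L0_base_cube[OF that]]
    by (simp add: mink_face_normal_m1 mink_face_normal_1 mink_refl_L0)
  show ?thesis
    unfolding base_face_m1[symmetric]
  proof (intro equalityI subsetI)
    fix p
    assume "p \<in> {p \<in> base_cube. mink p (face_normal (axis_of i) 1) = 0}"
    thus "p \<in> letter_refl (L0 i) ` {p \<in> base_cube. mink p (face_normal (axis_of i) (-1)) = 0}"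
      using 1[of p] refl_L0_base_cube[of p i] by (intro image_eqI[of _ _ "letter_refl (L0 i) p"]) auto
  next
    fix p
    assume "p \<in> letter_refl (L0 i) ` {p \<in> base_cube. mink p (face_normal (axis_of i) (-1)) = 0}"
    then obtain q where q: "p = letter_refl (L0 i) q" "q \<in> base_cube" "mink q (face_normal (axis_of i) (-1)) = 0"
      by blast
    thus "p \<in> {p \<in> base_cube. mink p (face_normal (axis_of i) 1) = 0}"
      using 1[of p] refl_L0_base_cube[of q i] by simp
  qed
qed

lemma base_facesI:
  assumes "zs = [] \<or> zs = [L0 i]"
  shows "act zs ` cell (base_triple - {L0 i}) \<in> base_faces"
proof -
  have in_base: "{p \<in> base_cube. mink p (face_normal (axis_of i) s) = 0} \<in> base_faces"
    if "s \<in> {-1, 1}" for s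
    unfolding base_faces_def using that by blast
  from assms show ?thesis
  proof
    assume "zs = []"
    thus ?thesis
      using in_base[of "-1"] base_face_m1[of i] by simp
  next
    assume "zs = [L0 i]"
    thus ?thesis
      using in_base[of 1] base_face_1[of i] by simp
  qed
qed

lemma base_facesE:
  assumes "X \<in> base_faces"
  obtains zs i where "zs = [] \<or> zs = [L0 i]" "X = act zs ` cell (base_triple - {L0 i})"
proof -
  obtain k s where X: "X = {p \<in> base_cube. mink p (face_normal k s) = 0}" and s: "s = -1 \<or> s = 1"
    using assms unfolding base_faces_def by blast
  obtain i where i: "k = axis_of i"
    using axis_of_surj by blast
  show thesis
  proof (cases "s = -1")
    case True
    hence "X = act [] ` cell (base_triple - {L0 i})"
      unfolding X i using base_face_m1[of i] by simp
    thus thesis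
      using that[of "[]" i] by simp
  next
    case False
    hence "X = act [L0 i] ` cell (base_triple - {L0 i})"
      unfolding X i using s base_face_1[of i] by simp
    thus thesis
      using that[of "[L0 i]" i] by simp
  qed
qed

lemma base_faces_step:
  assumes "X \<in> base_faces" "a \<in> base_triple"
  shows "letter_refl a ` X \<in> base_faces"
proof -
  obtain zs i where zs: "zs = [] \<or> zs = [L0 i]" and X: "X = act zs ` cell (base_triple - {L0 i})"
    using assms(1) by (rule base_facesE)
  have eq: "letter_refl a ` X = act (zs @ [a]) ` cell (base_triple - {L0 i})"
    unfolding X act_image_append by simp
  consider "a = L0 i" "zs = []" | "a = L0 i" "zs = [L0 i]" | "a \<noteq> L0 i"
    using zs by blast
  thus ?thesis
  proof cases
    case 1
    thus ?thesis
      unfolding eq using base_facesI[of "[L0 i]" i] by simp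
  next
    case 2
    hence "letter_refl a ` X = act [] ` cell (base_triple - {L0 i})"
      unfolding eq by (intro same_action_image sameI) simp
    thus ?thesis
      using base_facesI[of "[]" i] by simp
  next
    case 3
    hence "commutes a (L0 i)"
      using assms(2) by (auto simp: base_triple_def)
    hence "same_action (zs @ [a]) ([a] @ zs)"
      using zs letter_refl_commute by (intro sameI) auto
    hence "letter_refl a ` X = act ([a] @ zs) ` cell (base_triple - {L0 i})"
      unfolding eq by (rule same_action_image)
    also have "\<dots> = act zs ` cell (base_triple - {L0 i})"
      unfolding act_image_append using assms(2) 3 by (subst act_cell) auto
    finally show ?thesis
      using base_facesI[OF zs] by simp
  qed
qed

lemma base_cells_2: "base_cells 2 = base_faces"
proof (intro equalityI subsetI)
  fix X
  assume "X \<in> base_cells 2"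
  then obtain zs T where "X = act zs ` cell T" and zs: "set zs \<subseteq> base_triple" and "T \<subseteq> base_triple" "card T = 2"
    unfolding base_cells_def by blast
  then obtain i where X: "X = act zs ` cell (base_triple - {L0 i})"
    using card_2_base_triple by blast
  show "X \<in> base_faces"
    unfolding X using zs
  proof (induction zs rule: rev_induct)
    case Nil
    show ?case
      using base_facesI[of "[]" i] by simp
  next
    case (snoc a zs)
    thus ?case
      using base_faces_step[of "act zs ` cell (base_triple - {L0 i})" a]
      by (simp add: act_image_append)
  qed
next
  fix X
  assume "X \<in> base_faces"
  then obtain zs i where "zs = [] \<or> zs = [L0 i]" and X: "X = act zs ` cell (base_triple - {L0 i})"
    by (rule base_facesE)
  hence "set zs \<subseteq> base_triple" "base_triple - {L0 i} \<subseteq> base_triple" "card (base_triple - {L0 i}) = 2"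
    using card_base_triple_minus by (auto simp: base_triple_def)
  thus "X \<in> base_cells 2"
    unfolding base_cells_def using X by blast
qed

text \<open>An edge of direction \<open>k\<close> is the intersection of the two faces at one of its
  vertices that omit the other directions. Conversely, \<open>rebase\<close> describes two faces
  that meet from a common vertex.\<close>

lemma base_cells_1: "base_cells 1 = base_edges"
proof (intro equalityI subsetI)
  fix X
  assume "X \<in> base_cells 1"
  then obtain zs k where X: "X = act zs ` cell {L0 k}" "set zs \<subseteq> base_triple"
    unfolding base_cells_def by (force simp: card_1_singleton_iff base_triple_def)
  obtain i j where ij: "i \<noteq> j" "i \<noteq> k" "j \<noteq> k" "\<forall>l. l = i \<or> l = j \<or> l = k"
    by (metis dir.exhaust dir.distinct)
  define F where "F i = act zs ` cell (base_triple - {L0 i})" for i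
  have F: "F i \<in> base_faces" for i
    unfolding base_cells_2[symmetric] base_cells_def F_def using X(2) card_base_triple_minus by blast
  have int: "cell {L0 k} = cell (base_triple - {L0 i}) \<inter> cell (base_triple - {L0 j})"
    using ij by (subst (1 2 3) cell_base) (auto simp: base_triple_def)
  have "X = F i \<inter> F j"
    unfolding X F_def int using isometry_inj[OF isometry_act] by (simp add: image_Int)
  moreover have "F i \<noteq> F j"
  proof
    assume "F i = F j"
    hence "cell (base_triple - {L0 i}) = cell (base_triple - {L0 j})"
      unfolding F_def using isometry_inj[OF isometry_act] by (simp add: inj_image_eq_iff)
    hence "letter_refl (L0 i) apex \<in> cell (base_triple - {L0 i})"
      using point_of_in_cell[of "[L0 i]" "base_triple - {L0 j}"] ij(1) by (simp add: point_of_def base_triple_def)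
    hence "mink (letter_refl (L0 i) apex) (normal (L0 i)) < 0"
      by (subst (asm) cell_base) (auto simp: base_triple_def)
    thus False
      using apex_depth_pos by (simp add: mink_refl_L0 mink_apex_normal)
  qed
  moreover have "X \<noteq> {}"
    using X apex_in_cell by auto
  ultimately show "X \<in> base_edges"
    unfolding base_edges_def using F by blast
next
  fix X
  assume "X \<in> base_edges"
  then obtain F F' where F: "F \<in> base_cells 2" "F' \<in> base_cells 2" "F \<noteq> F'" "X = F \<inter> F'" "X \<noteq> {}"
    unfolding base_edges_def base_cells_2 by blast
  obtain zs i where zs: "F = act zs ` cell (base_triple - {L0 i})" "set zs \<subseteq> base_triple"
    using F(1) unfolding base_cells_def using card_2_base_triple by blast
  obtain zs' j where zs': "F' = act zs' ` cell (base_triple - {L0 j})" "set zs' \<subseteq> base_triple"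
    using F(2) unfolding base_cells_def using card_2_base_triple by blast
  obtain v where v: "v \<in> F" "v \<in> F'"
    using F by blast
  obtain ys where ys: "v = point_of (ys @ zs)" "set ys \<subseteq> base_triple"
    using v(1) unfolding zs(1) by (force simp: act_point_of elim: in_cellE)
  define us where "us = ys @ zs"
  have F1: "F = act us ` cell (base_triple - {L0 i})"
    unfolding zs(1) us_def using v(1) zs ys by (intro rebase) auto
  have F2: "F' = act us ` cell (base_triple - {L0 j})"
    unfolding zs'(1) us_def using v(2) zs' ys by (intro rebase) auto
  have "i \<noteq> j"
    using F(3) F1 F2 by auto
  then obtain k where k: "k \<noteq> i" "k \<noteq> j" "\<forall>l. l = i \<or> l = j \<or> l = k"
    by (metis dir.exhaust dir.distinct)
  have int: "cell {L0 k} = cell (base_triple - {L0 i}) \<inter> cell (base_triple - {L0 j})"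
    using k by (subst (1 2 3) cell_base) (auto simp: base_triple_def)
  have "X = act us ` cell {L0 k}"
    unfolding F(4) F1 F2 int using isometry_inj[OF isometry_act] by (simp add: image_Int)
  moreover have "set us \<subseteq> base_triple"
    using ys zs by (simp add: us_def)
  ultimately show "X \<in> base_cells 1"
    unfolding base_cells_def by (force simp: base_triple_def)
qed

section \<open>The cells of the honeycomb as images of cliques\<close>

definition orbit :: "nat \<Rightarrow> point set set" where
  "orbit m = {g ` X | g X. g \<in> honeycomb_group \<and> X \<in> base_cells m}"

lemma cubes_orbit: "cubes = orbit 3"
  and faces_orbit: "faces = orbit 2"
  and edges_orbit: "edges = orbit 1"
  unfolding cubes_def faces_def edges_def orbit_def base_cells_3 base_cells_2 base_cells_1
  by auto

definition letters :: "letter list" where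
  "letters = [L0 DX, L0 DY, L0 DZ, L1 DX, L1 DY, L1 DZ, L2 DX, L2 DY, L2 DZ, L3 DX, L3 DY, L3 DZ]"

lemma set_letters: "set letters = UNIV"
proof -
  have "a \<in> set letters" for a
  proof (cases a)
    case (L0 i) thus ?thesis by (cases i) (simp_all add: letters_def)
  next
    case (L1 i) thus ?thesis by (cases i) (simp_all add: letters_def)
  next
    case (L2 i) thus ?thesis by (cases i) (simp_all add: letters_def)
  next
    case (L3 i) thus ?thesis by (cases i) (simp_all add: letters_def)
  qed
  thus ?thesis by auto
qed

lemma finite_letter [simp]: "finite (A :: letter set)"
  using finite_set[of letters] finite_subset[OF subset_UNIV] unfolding set_letters by blast

definition clique :: "letter set \<Rightarrow> bool" where
  "clique T \<longleftrightarrow> (\<forall>a\<in>T. \<forall>b\<in>T. a \<noteq> b \<longrightarrow> commutes a b)"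

lemma clique_subset: "clique T \<Longrightarrow> S \<subseteq> T \<Longrightarrow> clique S"
  by (auto simp: clique_def)

lemma clique_base_triple: "clique base_triple"
  by (auto simp: clique_def base_triple_def)

lemma clique_image:
  assumes "\<And>a b. commutes (f a) (f b) = commutes a b" "clique T"
  shows "clique (f ` T)"
  using assms by (auto simp: clique_def)

text \<open>A measure for the descent in \<open>cell_orbit\<close>; it vanishes exactly on the
  letters of the base cube.\<close>

fun weight :: "letter \<Rightarrow> nat" where
  "weight (L0 _) = 0" | "weight (L1 _) = 1" | "weight (L2 _) = 2" | "weight (L3 _) = 3"

lemma weight_eq_0_iff: "a \<in> base_triple \<longleftrightarrow> weight a = 0"
  by (cases a) (auto simp: base_triple_def)

text \<open>A clique outside the three letters of the base cube is moved closer to it by one of the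
  reflections in the faces at the apex.\<close>

lemma descent_checks:
  "list_all (\<lambda>a. weight a = 0 \<or> list_ex (\<lambda>i. weight (face_perm i a) < weight a) [DX, DY, DZ]) letters"
  "list_all (\<lambda>a. list_all (\<lambda>b. weight a + weight b = 0 \<or>
      list_ex (\<lambda>i. weight (face_perm i a) + weight (face_perm i b) < weight a + weight b) [DX, DY, DZ])
      (filter (commutes a) letters)) letters"
  "list_all (\<lambda>a. list_all (\<lambda>b. list_all (\<lambda>c. weight a + weight b + weight c = 0 \<or>
      list_ex (\<lambda>i. weight (face_perm i a) + weight (face_perm i b) + weight (face_perm i c) < weight a + weight b + weight c) [DX, DY, DZ])
      (filter (commutes b) (filter (commutes a) letters))) (filter (commutes a) letters)) letters"
  by code_simp+

lemma sum_weight_face_perm: "sum weight (face_perm i ` T) = (\<Sum>a\<in>T. weight (face_perm i a))"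
  using face_perm_inj by (subst sum.reindex) (auto intro: inj_on_subset)

lemma clique_descent:
  assumes "clique T" "card T \<in> {1, 2, 3}" "\<not> T \<subseteq> base_triple"
  shows "\<exists>i. sum weight (face_perm i ` T) < sum weight T"
proof -
  have nz: "sum weight T \<noteq> 0"
    using assms(3) weight_eq_0_iff by auto
  consider "card T = 1" | "card T = 2" | "card T = 3"
    using assms(2) by blast
  thus ?thesis
  proof cases
    case 1
    then obtain a where T: "T = {a}"
      by (auto simp: card_1_singleton_iff)
    have "\<exists>i. weight (face_perm i a) < weight a"
    proof -
      have "weight a = 0 \<or> list_ex (\<lambda>i. weight (face_perm i a) < weight a) [DX, DY, DZ]"
        using descent_checks(1) unfolding list_all_iff by (simp add: set_letters)
      thus ?thesis
        using nz unfolding T by auto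
    qed
    thus ?thesis
      unfolding sum_weight_face_perm by (simp add: T)
  next
    case 2
    then obtain a b where T: "T = {a, b}" and ab: "a \<noteq> b"
      by (auto simp: card_2_iff)
    have "commutes a b"
      using assms(1) T ab by (auto simp: clique_def)
    have "\<exists>i. weight (face_perm i a) + weight (face_perm i b) < weight a + weight b"
    proof -
      have "weight a + weight b = 0 \<or>
        list_ex (\<lambda>i. weight (face_perm i a) + weight (face_perm i b) < weight a + weight b) [DX, DY, DZ]"
        using descent_checks(2) \<open>commutes a b\<close> unfolding list_all_iff by (simp add: set_letters)
      thus ?thesis
        using nz ab unfolding T by auto
    qed
    thus ?thesis
      unfolding sum_weight_face_perm using ab by (simp add: T)
  next
    case 3
    then obtain a b c where T: "T = {a, b, c}" and abc: "a \<noteq> b" "b \<noteq> c" "a \<noteq> c"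
      by (auto simp: card_3_iff)
    have "commutes a b" "commutes a c" "commutes b c"
      using assms(1) T abc by (auto simp: clique_def)
    have "\<exists>i. weight (face_perm i a) + weight (face_perm i b) + weight (face_perm i c) < weight a + weight b + weight c"
    proof -
      have "weight a + weight b + weight c = 0 \<or>
        list_ex (\<lambda>i. weight (face_perm i a) + weight (face_perm i b) + weight (face_perm i c) < weight a + weight b + weight c) [DX, DY, DZ]"
        using descent_checks(3) \<open>commutes a b\<close> \<open>commutes a c\<close> \<open>commutes b c\<close>
        unfolding list_all_iff by (simp add: set_letters)
      thus ?thesis
        using nz abc unfolding T by auto
    qed
    thus ?thesis
      unfolding sum_weight_face_perm using abc by (simp add: T add_ac)
  qed
qed

text \<open>A reflection in a face at the apex fixes the apex and renames letters; one in an
  opposite face is a conjugate of it by a letter. Compositions of these rename letters and multiply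
  by a fixed word.\<close>

lemma group_word:
  assumes "g \<in> honeycomb_group"
  shows "\<exists>us \<pi>. inj \<pi> \<and> (\<forall>a b. commutes (\<pi> a) (\<pi> b) = commutes a b) \<and>
           (\<forall>vs. g (point_of vs) = point_of (map \<pi> vs @ us))"
  using assms
proof induction
  case id
  show ?case
    by (intro exI[of _ "[]"] exI[of _ id]) simp
next
  case (step g s k)
  obtain us \<pi> where IH: "inj \<pi>" "\<And>a b. commutes (\<pi> a) (\<pi> b) = commutes a b"
    "\<And>vs. g (point_of vs) = point_of (map \<pi> vs @ us)"
    using step.IH by blast
  obtain i where i: "k = axis_of i"
    using axis_of_surj by blast
  have \<pi>: "inj (\<pi> \<circ> face_perm i)" "\<And>a b. commutes ((\<pi> \<circ> face_perm i) a) ((\<pi> \<circ> face_perm i) b) = commutes a b"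
    using IH(1,2) face_perm_inj face_perm_commutes by (auto intro: inj_compose)
  show ?case
  proof (cases "s = 1")
    case False
    hence "(g \<circ> reflection (face_normal k s)) (point_of vs) = point_of (map (\<pi> \<circ> face_perm i) vs @ us)" for vs
      using step.hyps by (simp add: i face_refl_point_of IH(3))
    thus ?thesis
      using \<pi> by blast
  next
    case True
    have "letter_refl a (point_of ws) = point_of (ws @ [a])" for a ws
      using act_point_of[of "[a]" ws] by simp
    \<comment> \<open>The conjugating letter \<open>L0 i\<close> enters twice, the first time
      renamed by \<open>face_perm i\<close>.\<close>
    hence "(g \<circ> reflection (face_normal k s)) (point_of vs) =
        point_of (map (\<pi> \<circ> face_perm i) vs @ [\<pi> (face_perm i (L0 i)), \<pi> (L0 i)] @ us)" for vs
      by (simp add: True i face_refl_one face_refl_point_of IH(3) del: face_perm.simps)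
    thus ?thesis
      using \<pi> by blast
  qed
qed

lemma orbit_subset:
  assumes "X \<in> orbit m"
  shows "\<exists>us T. clique T \<and> card T = m \<and> X = act us ` cell T"
proof -
  obtain g zs T where g: "g \<in> honeycomb_group" and X: "X = g ` act zs ` cell T"
    and T: "T \<subseteq> base_triple" "card T = m"
    using assms unfolding orbit_def base_cells_def by blast
  obtain us \<pi> where pi: "inj \<pi>" "\<And>a b. commutes (\<pi> a) (\<pi> b) = commutes a b"
    "\<And>vs. g (point_of vs) = point_of (map \<pi> vs @ us)"
    using group_word[OF g] by blast
  have "X = act (map \<pi> zs @ us) ` cell (\<pi> ` T)"
    unfolding X cell_def image_image act_point_of pi(3) lists_image by simp
  moreover have "clique (\<pi> ` T)"
    using pi(2) clique_subset[OF clique_base_triple T(1)] by (rule clique_image)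
  moreover have "card (\<pi> ` T) = m"
    using T(2) card_image[OF inj_on_subset[OF pi(1)]] by auto
  ultimately show ?thesis by blast
qed

text \<open>The inductive definition only multiplies by generators on the right.\<close>

lemma honeycomb_left:
  assumes "g \<in> honeycomb_group" "s \<in> {-1, 1}"
  shows "reflection (face_normal k s) \<circ> g \<in> honeycomb_group"
  using assms
proof induction
  case id
  thus ?case
    using honeycomb_group.step[OF honeycomb_group.id, of s k] by simp
next
  case (step g s' k')
  thus ?case
    using honeycomb_group.step[of "reflection (face_normal k s) \<circ> g" s' k']
    unfolding comp_assoc by blast
qed

lemma refl_L0_face_normal:
  assumes "s \<in> {-1, 1}"
  shows "letter_refl (L0 i) (face_normal (axis_of j) s) = face_normal (axis_of j) (if i = j then - s else s)"
  using assms unfolding letter_refl_eq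
  by (auto simp: face_normal_eq face_normal_eq' normal.simps mink_def inner_axis_axis scaleR_2 zero_prod_def)

text \<open>The reflection in a midplane of the base cube permutes the six face planes and therefore
  normalises the group they generate.\<close>

lemma honeycomb_conj:
  assumes "g \<in> honeycomb_group"
  shows "\<exists>g'\<in>honeycomb_group. letter_refl (L0 i) \<circ> g = g' \<circ> letter_refl (L0 i)"
  using assms
proof induction
  case id
  show ?case
    by (intro bexI[OF _ honeycomb_group.id]) simp
next
  case (step g s k)
  obtain g' where g': "g' \<in> honeycomb_group" "letter_refl (L0 i) \<circ> g = g' \<circ> letter_refl (L0 i)"
    using step.IH by blast
  obtain j where j: "k = axis_of j"
    using axis_of_surj by blast
  define s' where "s' = (if i = j then - s else s)"
  have "letter_refl (L0 i) ((g \<circ> reflection (face_normal k s)) p) =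
      (g' \<circ> reflection (face_normal k s')) (letter_refl (L0 i) p)" for p
    using fun_cong[OF g'(2), of "face_refl j s p"]
      isometry_reflection_conj[OF isometry_letter_refl, of "L0 i" "face_normal (axis_of j) s" p]
    by (simp add: j s'_def refl_L0_face_normal[OF step.hyps(2)])
  hence "letter_refl (L0 i) \<circ> (g \<circ> reflection (face_normal k s)) =
      (g' \<circ> reflection (face_normal k s')) \<circ> letter_refl (L0 i)"
    by (intro ext) simp
  moreover have "g' \<circ> reflection (face_normal k s') \<in> honeycomb_group"
    using g'(1) step.hyps(2) by (intro honeycomb_group.step) (auto simp: s'_def)
  ultimately show ?case by blast
qed

lemma orbit_face_refl:
  assumes "X \<in> orbit m" "s \<in> {-1, 1}"
  shows "face_refl i s ` X \<in> orbit m"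
proof -
  obtain g B where g: "g \<in> honeycomb_group" "B \<in> base_cells m" "X = g ` B"
    using assms(1) unfolding orbit_def by blast
  have "face_refl i s ` X = (face_refl i s \<circ> g) ` B"
    by (simp add: g(3) image_comp)
  thus ?thesis
    unfolding orbit_def using honeycomb_left[OF g(1) assms(2)] g(2) by blast
qed

lemma orbit_refl_L0:
  assumes "X \<in> orbit m"
  shows "letter_refl (L0 i) ` X \<in> orbit m"
proof -
  obtain g zs T where g: "g \<in> honeycomb_group" and X: "X = g ` act zs ` cell T"
    and T: "set zs \<subseteq> base_triple" "T \<subseteq> base_triple" "card T = m"
    using assms unfolding orbit_def base_cells_def by blast
  obtain g' where g': "g' \<in> honeycomb_group" "letter_refl (L0 i) \<circ> g = g' \<circ> letter_refl (L0 i)"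
    using honeycomb_conj[OF g] by blast
  have "letter_refl (L0 i) (g p) = g' (letter_refl (L0 i) p)" for p
    using fun_cong[OF g'(2), of p] by simp
  hence "letter_refl (L0 i) ` X = g' ` act (zs @ [L0 i]) ` cell T"
    by (simp add: X image_image act_append)
  moreover have "set (zs @ [L0 i]) \<subseteq> base_triple"
    using T(1) by (auto simp: base_triple_def)
  hence "act (zs @ [L0 i]) ` cell T \<in> base_cells m"
    unfolding base_cells_def using T by blast
  ultimately show ?thesis
    unfolding orbit_def using g'(1) by blast
qed

text \<open>Conjugation by a face reflection at the apex carries letters to letters, so the
  invariance spreads from \<open>L0\<close> to \<open>L1\<close>, \<open>L2\<close> and
  \<open>L3\<close> in turn.\<close>

lemma orbit_letter_refl:
  assumes "X \<in> orbit m"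
  shows "letter_refl a ` X \<in> orbit m"
proof -
  have conj: "letter_refl (face_perm i a) ` X \<in> orbit m"
    if "\<And>X. X \<in> orbit m \<Longrightarrow> letter_refl a ` X \<in> orbit m" "X \<in> orbit m" for i a X
  proof -
    have "letter_refl (face_perm i a) p = face_refl i (-1) (letter_refl a (face_refl i (-1) p))" for p
      using face_refl_letter_refl[of i a "face_refl i (-1) p"] by (simp add: face_refl_invol)
    hence "letter_refl (face_perm i a) ` X = face_refl i (-1) ` letter_refl a ` face_refl i (-1) ` X"
      by (simp add: image_image)
    thus ?thesis
      using that by (simp add: orbit_face_refl)
  qed
  have 0: "letter_refl (L0 i) ` X \<in> orbit m" if "X \<in> orbit m" for X i
    using that by (rule orbit_refl_L0)
  have 1: "letter_refl (L1 i) ` X \<in> orbit m" if "X \<in> orbit m" for X i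
    using conj[of "L0 i" X i, OF 0 that] by simp
  have 2: "letter_refl (L2 i) ` X \<in> orbit m" if "X \<in> orbit m" for X i
  proof -
    \<comment> \<open>For any such \<open>j\<close>, \<open>face_perm j\<close> maps
      \<open>L1 (third j i)\<close> to \<open>L2 i\<close>.\<close>
    obtain j where "j \<noteq> i"
      by (metis dir.distinct(1))
    thus ?thesis
      using conj[of "L1 (third j i)" X j, OF 1 that] third_eq[of j i]
      by (auto split: if_splits)
  qed
  have 3: "letter_refl (L3 i) ` X \<in> orbit m" if "X \<in> orbit m" for X i
    using conj[of "L2 i" X i, OF 2 that] by simp
  show ?thesis
    using assms 0 1 2 3 by (cases a) auto
qed

lemma orbit_act: "X \<in> orbit m \<Longrightarrow> act us ` X \<in> orbit m"
proof (induction us arbitrary: X)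
  case Nil
  thus ?case by simp
next
  case (Cons a us)
  have "act (a # us) ` X = act us ` letter_refl a ` X"
    by (simp add: image_image)
  thus ?case
    using Cons orbit_letter_refl by simp
qed

text \<open>Face reflections at the apex lower the weight until the clique lies in the base cube;
  each of them preserves the orbit and can be undone.\<close>

lemma cell_orbit:
  assumes "clique T" "card T \<in> {1, 2, 3}"
  shows "cell T \<in> orbit (card T)"
  using assms
proof (induction "sum weight T" arbitrary: T rule: less_induct)
  case less
  show ?case
  proof (cases "T \<subseteq> base_triple")
    case True
    have "act [] ` cell T \<in> base_cells (card T)"
      unfolding base_cells_def using True by (intro CollectI exI[of _ "[]"]) auto
    hence "id ` act [] ` cell T \<in> orbit (card T)"
      unfolding orbit_def using honeycomb_group.id by blast
    thus ?thesis by simp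
  next
    case False
    then obtain i where i: "sum weight (face_perm i ` T) < sum weight T"
      using clique_descent less.prems by blast
    have card: "card (face_perm i ` T) = card T"
      using card_image[OF inj_on_subset[OF face_perm_inj]] by blast
    have "cell (face_perm i ` T) \<in> orbit (card T)"
      using less.hyps[OF i] less.prems clique_image[OF face_perm_commutes] card by simp
    from orbit_face_refl[OF this, of "-1" i] show ?thesis
      by (simp add: face_refl_cell)
  qed
qed

lemma orbit_eq:
  assumes "m \<in> {1, 2, 3}"
  shows "orbit m = {act us ` cell T | us T. clique T \<and> card T = m}"
proof -
  have "act us ` cell T \<in> orbit m" if "clique T" "card T = m" for us T
    using cell_orbit[of T] that assms orbit_act by auto
  thus ?thesis
    using orbit_subset by blast
qed

lemmas cubes_eq = orbit_eq[of 3, simplified, folded cubes_orbit]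
lemmas faces_eq = orbit_eq[of 2, simplified, folded faces_orbit]
lemmas edges_eq = orbit_eq[of 1, simplified, folded edges_orbit[simplified]]

text \<open>A symmetry of the honeycomb. All notions of the theorem are built from
  \<open>mink\<close>, vector sums and the three kinds of cells, so a frame transports them from the
  base cube to any cube.\<close>

definition frame :: "(point \<Rightarrow> point) \<Rightarrow> bool" where
  "frame h \<longleftrightarrow> isometry h \<and> surj h \<and> (\<forall>m X. h ` X \<in> orbit m \<longleftrightarrow> X \<in> orbit m)"

lemma frame_involution:
  assumes "isometry h" "\<And>p. h (h p) = p" "\<And>m X. X \<in> orbit m \<Longrightarrow> h ` X \<in> orbit m"
  shows "frame h"
proof -
  have "h ` h ` X = X" for X
    using assms(2) by (simp add: image_image)
  hence "h ` X \<in> orbit m \<longleftrightarrow> X \<in> orbit m" for m X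
    using assms(3)[of X m] assms(3)[of "h ` X" m] by auto
  thus ?thesis
    using assms(1,2) unfolding frame_def by (metis surj_def)
qed

lemma frame_comp:
  assumes "frame g" "frame h"
  shows "frame (g \<circ> h)"
proof -
  have "(g \<circ> h) ` X \<in> orbit m \<longleftrightarrow> X \<in> orbit m" for m X
    using assms unfolding frame_def image_comp[symmetric] by blast
  moreover have "surj (g \<circ> h)"
    using assms comp_surj unfolding frame_def by blast
  ultimately show ?thesis
    using assms isometry_compose unfolding frame_def by blast
qed

lemma frame_id: "frame id"
  by (simp add: frame_def isometry_id)

lemma frame_letter_refl: "frame (letter_refl a)"
  by (rule frame_involution) (simp_all add: isometry_letter_refl orbit_letter_refl)

lemma frame_group:
  assumes "g \<in> honeycomb_group"
  shows "frame g"
  using assms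
proof induction
  case id
  show ?case by (rule frame_id)
next
  case (step g s k)
  obtain i where i: "k = axis_of i"
    using axis_of_surj by blast
  have "frame (face_refl i s)"
    using step.hyps(2)
    by (intro frame_involution isometry_face_refl face_refl_invol orbit_face_refl)
  thus ?case
    unfolding i using step.IH frame_comp by blast
qed

lemma frame_act: "frame (act us)"
proof (induction us)
  case Nil
  have "act [] = id"
    by (rule ext) simp
  thus ?case
    by (simp only: frame_id)
next
  case (Cons a us)
  have "act (a # us) = act us \<circ> letter_refl a"
    by (rule ext) simp
  thus ?case
    by (simp only: frame_comp[OF Cons frame_letter_refl])
qed

text \<open>The group provides the cube; the letters of \<open>base_triple\<close> preserve the base
  cube and take the apex to any of its vertices.\<close>

lemma frame_exists:
  assumes "Q \<in> cubes" "V \<in> Q"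
  obtains h where "frame h" "Q = h ` cell base_triple" "V = h apex"
proof -
  obtain g where g: "g \<in> honeycomb_group" "Q = g ` cell base_triple"
    using assms(1) unfolding cubes_def base_cube_eq by blast
  obtain zs where zs: "set zs \<subseteq> base_triple" "V = g (point_of zs)"
    using assms(2) unfolding g(2) by (blast elim: in_cellE)
  have "frame (g \<circ> act zs)"
    by (rule frame_comp[OF frame_group[OF g(1)] frame_act])
  moreover have "Q = (g \<circ> act zs) ` cell base_triple"
    unfolding image_comp[symmetric] act_cell[OF zs(1)] by (rule g(2))
  moreover have "V = (g \<circ> act zs) apex"
    by (simp add: zs(2) point_of_def)
  ultimately show thesis
    by (rule that)
qed

section \<open>Position of vertices relative to the midplanes at the apex\<close>

lemma letter_refl_inj:
  assumes "\<And>p. letter_refl a p = letter_refl b p"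
  shows "a = b"
proof (rule ccontr)
  assume "a \<noteq> b"
  have "(2 * apex_depth) *\<^sub>R normal a = (2 * apex_depth) *\<^sub>R normal b"
    using assms[of apex] by (simp add: letter_refl_eq mink_apex_normal)
  hence "normal a = normal b"
    using apex_depth_pos by simp
  hence "mink (normal a) (normal b) = 1"
    by simp
  thus False
    using mink_normal_commutes[of a b] mink_normal_far[of a b] \<open>a \<noteq> b\<close> by (cases "commutes a b") auto
qed

lemma clique_act_commute:
  assumes "clique T" "a \<in> T" "set ys \<subseteq> T"
  shows "act ys (letter_refl a p) = letter_refl a (act ys p)"
  using assms(3)
proof (induction ys arbitrary: p)
  case (Cons b ys)
  have "letter_refl b (letter_refl a p) = letter_refl a (letter_refl b p)"
  proof (cases "a = b")
    case False
    thus ?thesis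
      using assms(1,2) Cons.prems by (intro letter_refl_commute) (auto simp: clique_def)
  qed simp
  thus ?case
    using Cons by simp
qed simp

text \<open>A wall separating two vertices of a cell is the midplane of an edge of this cell, and by
  parallelism it also bisects an edge at the first vertex.\<close>

lemma clique_crossing:
  assumes "clique T" "set ys \<subseteq> T"
    and "mink (point_of us) (normal i) \<le> 0" "mink (point_of (ys @ us)) (normal i) > 0"
  shows "\<exists>a\<in>T. \<forall>p. act us (letter_refl a p) = letter_refl i (act us p)"
  using assms(2,4)
proof (induction ys)
  case Nil
  thus ?case using assms(3) by simp
next
  case (Cons a ys)
  show ?case
  proof (cases "mink (point_of (ys @ us)) (normal i) > 0")
    case True
    thus ?thesis using Cons by simp
  next
    case False
    have a: "a \<in> T" "set ys \<subseteq> T"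
      using Cons.prems by auto
    have cross: "act (ys @ us) (letter_refl a p) = letter_refl i (act (ys @ us) p)" for p
      using False Cons.prems by (intro crossing) auto
    have "act us (letter_refl a p) = letter_refl i (act us p)" for p
      using cross[of "act (rev ys) p"] a
      by (simp add: act_append clique_act_commute[OF assms(1)])
    thus ?thesis
      using a by blast
  qed
qed

text \<open>Both reflections take \<open>point_of us\<close> to the same neighbour. The two
  displacements have equal length, which fixes the distance from the wall.\<close>

lemma mink_crossed_wall:
  assumes "mink (point_of us) (normal i) \<le> 0" "\<And>p. act us (letter_refl a p) = letter_refl i (act us p)"
  shows "mink (point_of us) (normal i) = - apex_depth"
proof -
  define m where "m = mink (point_of us) (normal i)"
  have lin: "linear (act us)"
    by (rule isometry_linear[OF isometry_act])
  have "act us (letter_refl a apex) = point_of us + (2 * apex_depth) *\<^sub>R act us (normal a)"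
    by (simp add: letter_refl_eq mink_apex_normal linear_add[OF lin] linear_scale[OF lin] point_of_def)
  moreover have "letter_refl i (point_of us) = point_of us - (2 * m) *\<^sub>R normal i"
    by (simp add: letter_refl_eq m_def)
  ultimately have "(2 * apex_depth) *\<^sub>R act us (normal a) = - ((2 * m) *\<^sub>R normal i)"
    using assms(2)[of apex] by (simp add: point_of_def)
  hence eq: "(2 * apex_depth) *\<^sub>R act us (normal a) = (- 2 * m) *\<^sub>R normal i"
    by simp
  have "mink ((2 * apex_depth) *\<^sub>R act us (normal a)) ((2 * apex_depth) *\<^sub>R act us (normal a)) = (2 * apex_depth) * (2 * apex_depth)"
    by (simp add: mink_simps isometry_mink[OF isometry_act])
  moreover have "mink ((- 2 * m) *\<^sub>R normal i) ((- 2 * m) *\<^sub>R normal i) = (2 * m) * (2 * m)"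
    by (simp only: mink_simps) simp
  ultimately have "(2 * apex_depth) * (2 * apex_depth) = (2 * m) * (2 * m)"
    unfolding eq by simp
  hence "apex_depth ^ 2 = m ^ 2"
    by (simp add: power2_eq_square)
  thus ?thesis
    using assms(1) apex_depth_pos unfolding m_def[symmetric] by (auto simp: power2_eq_iff)
qed

text \<open>While \<open>i\<close> is uncrossed, every letter of the word commutes with it and fixes
  its normal.\<close>

lemma act_normal_uncrossed:
  assumes "admissible Z us" "i \<in> uncrossed Z us"
  shows "act us (normal i) = normal i"
  using assms
proof (induction us)
  case (Cons a us)
  thus ?case
    by (auto simp: letter_refl_fixes)
qed simp

lemma mink_uncrossed:
  assumes "admissible Z us" "i \<in> uncrossed Z us"
  shows "mink (act us p) (normal i) = mink p (normal i)"
  using isometry_mink[OF isometry_act, of us p "normal i"] by (simp add: act_normal_uncrossed[OF assms])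

text \<open>At the crossing the product is \<open>apex_depth\<close>. Afterwards \<open>i\<close>
  remains a descent of the reversed word, since descents survive additions at the far end; so the
  wall is never crossed back.\<close>

lemma mink_point_of_beyond:
  assumes "admissible Z us" "i \<in> Z - uncrossed Z us"
  shows "mink (point_of us) (normal i) > 0"
  using assms
proof (induction us)
  case (Cons a us)
  show ?case
  proof (cases "i \<in> uncrossed Z us")
    case True
    hence "a = i"
      using Cons.prems by auto
    hence "point_of (a # us) = act us (letter_refl i apex)"
      by (simp add: point_of_def)
    moreover have "mink (letter_refl i apex) (normal i) = apex_depth"
      by (simp add: letter_refl_eq mink_simps mink_apex_normal)
    ultimately show ?thesis
      using mink_uncrossed[OF _ True] Cons.prems apex_depth_pos by auto
  next
    case False
    hence "mink (point_of us) (normal i) > 0"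
      using Cons by simp
    hence "i \<in> descents (rev us)"
      using side_pos_iff[OF reduced_rev[OF admissible_reduced]] Cons.prems side_act[of us i] by auto
    hence "i \<in> descents (rev (a # us))"
      using descents_append_mono[of "rev us" a] by auto
    thus ?thesis
      using side_pos_iff[OF reduced_rev[OF admissible_reduced[OF Cons.prems(1)]]] side_act[of "a # us" i] by simp
  qed
qed simp

text \<open>The plane of the forbidden letter is ultraparallel to that of an uncrossed wall
  \<open>i\<close>, so the step leads farther away from the midplane \<open>i\<close> than the apex
  is.\<close>

lemma mink_exit:
  assumes "admissible Z us" "a \<notin> descents us" "\<not> admissible Z (a # us)"
  shows "\<exists>i\<in>Z. mink (point_of (a # us)) (normal i) < - apex_depth"
proof -
  obtain i where i: "i \<in> uncrossed Z us" "a \<noteq> i" "\<not> commutes a i"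
    using assms by auto
  have "apex_depth * mink (normal a) (normal i) < 0"
    using mink_normal_far[OF i(2,3)] apex_depth_pos by (simp add: mult_less_0_iff)
  hence "mink (letter_refl a apex) (normal i) < - apex_depth"
    by (simp add: letter_refl_eq mink_simps mink_apex_normal)
  thus ?thesis
    using mink_uncrossed[OF assms(1) i(1), of "letter_refl a apex"] i(1) uncrossed_subset[of Z us]
    by (intro bexI[of _ i]) (auto simp: point_of_def)
qed

section \<open>The pyramid at the apex\<close>

text \<open>These are the notions of the theorem at the base cube and the apex, with the midplane
  normals already identified as \<open>normal (L0 i)\<close>; the locale \<open>apex_frame\<close>
  relates them to the general ones.\<close>

definition base_pyramid :: "point set set" where
  "base_pyramid = {K \<in> cubes. \<forall>i. \<exists>p\<in>K. mink p (normal (L0 i)) > 0}"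

definition base_adj :: "point \<Rightarrow> point \<Rightarrow> bool" where
  "base_adj u v \<longleftrightarrow> u \<noteq> v \<and> {u, v} \<in> edges \<and> (\<exists>K\<in>base_pyramid. {u, v} \<subseteq> K)"

definition wall_face :: "dir \<Rightarrow> point set \<Rightarrow> bool" where
  "wall_face i G \<longleftrightarrow> G \<in> faces \<and>
    (\<exists>K\<in>cubes. (\<exists>p\<in>K. mink p (normal (L0 i)) > 0) \<and> G \<subseteq> K) \<and>
    (\<exists>K\<in>cubes. \<not> (\<exists>p\<in>K. mink p (normal (L0 i)) > 0) \<and> G \<subseteq> K)"

definition on_wall :: "dir \<Rightarrow> point \<Rightarrow> bool" where
  "on_wall i u \<longleftrightarrow> (\<exists>G. wall_face i G \<and> u \<in> G)"

text \<open>The cube has a vertex beyond the midplane. If \<open>p\<close> is not beyond it, then by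
  \<open>clique_crossing\<close> the midplane bisects an edge of the cube at \<open>p\<close>, which
  determines its distance from \<open>p\<close>.\<close>

lemma base_pyramid_mink:
  assumes "K \<in> base_pyramid" "p \<in> K"
  shows "mink p (normal (L0 i)) = - apex_depth \<or> mink p (normal (L0 i)) > 0"
proof -
  obtain us T where K: "K = act us ` cell T" "clique T"
    using assms(1) unfolding base_pyramid_def cubes_eq by blast
  obtain zs where zs: "set zs \<subseteq> T" "p = point_of (zs @ us)"
    using assms(2) unfolding K by (force simp: act_point_of elim: in_cellE)
  define ws where "ws = zs @ us"
  have K': "K = act ws ` cell T"
    unfolding K ws_def act_image_append act_cell[OF zs(1)] ..
  obtain q where q: "q \<in> K" "mink q (normal (L0 i)) > 0"
    using assms(1) unfolding base_pyramid_def by blast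
  obtain ys where ys: "set ys \<subseteq> T" "q = point_of (ys @ ws)"
    using q(1) unfolding K' by (force simp: act_point_of elim: in_cellE)
  show ?thesis
  proof (cases "mink p (normal (L0 i)) > 0")
    case False
    then obtain a where "\<forall>p. act ws (letter_refl a p) = letter_refl (L0 i) (act ws p)"
      using clique_crossing[OF K(2) ys(1), of ws "L0 i"] q(2) ys(2) zs(2) ws_def by auto
    thus ?thesis
      using mink_crossed_wall[of ws "L0 i" a] False zs(2) ws_def by auto
  qed simp
qed

text \<open>A cube at the apex which contains the edge \<open>a\<close> and all letters of the base cube commuting
  with \<open>a\<close>.\<close>

fun corner :: "letter \<Rightarrow> letter set" where
  "corner (L0 i) = base_triple"
| "corner (L1 i) = insert (L1 i) (base_triple - {L0 i})"
| "corner (L2 DX) = {L2 DX, L0 DX, L1 DY}"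
| "corner (L2 DY) = {L2 DY, L0 DY, L1 DX}"
| "corner (L2 DZ) = {L2 DZ, L0 DZ, L1 DX}"
| "corner (L3 _) = range L3"

lemma range_L3: "range L3 = {L3 DX, L3 DY, L3 DZ}"
  by (auto intro: dir.exhaust)

lemma corner:
  "clique (corner a)" "card (corner a) = 3" "a \<in> corner a"
  "i \<in> base_triple \<Longrightarrow> commutes a i \<Longrightarrow> i \<in> corner a"
proof -
  have "clique (corner a) \<and> card (corner a) = 3 \<and> a \<in> corner a \<and>
    (i \<in> base_triple \<longrightarrow> commutes a i \<longrightarrow> i \<in> corner a)"
  proof (cases a)
    case (L0 j)
    thus ?thesis
      using clique_base_triple card_base_triple by (auto simp: base_triple_def)
  next
    case (L1 j)
    have "card (insert (L1 j) (base_triple - {L0 j})) = Suc (card (base_triple - {L0 j}))"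
      by (intro card_insert_disjoint) (auto simp: base_triple_def)
    hence "card (corner a) = 3"
      using L1 card_base_triple_minus[of j] by simp
    moreover have "clique (corner a) \<and> a \<in> corner a \<and> (i \<in> base_triple \<longrightarrow> commutes a i \<longrightarrow> i \<in> corner a)"
      using L1 by (auto simp: clique_def base_triple_def)
    ultimately show ?thesis by blast
  next
    case (L2 j)
    thus ?thesis
      by (cases j) (auto simp: clique_def base_triple_eq)
  next
    case (L3 j)
    hence "corner a = {L3 DX, L3 DY, L3 DZ}"
      using range_L3 by simp
    thus ?thesis
      using L3 by (cases j) (auto simp: clique_def base_triple_eq)
  qed
  thus "clique (corner a)" "card (corner a) = 3" "a \<in> corner a"
    "i \<in> base_triple \<Longrightarrow> commutes a i \<Longrightarrow> i \<in> corner a"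
    by blast+
qed

text \<open>A crossed wall has \<open>point_of us\<close> itself beyond it. An uncrossed one equals
  or commutes with \<open>a\<close>, hence belongs to \<open>corner a\<close>, and the cube extends
  across it.\<close>

lemma admissible_edge_in_base_pyramid:
  assumes "admissible base_triple (a # us)"
  shows "act us ` cell (corner a) \<in> base_pyramid"
proof -
  have "act us ` cell (corner a) \<in> cubes"
    unfolding cubes_eq using corner by blast
  moreover have "\<exists>p\<in>act us ` cell (corner a). mink p (normal (L0 i)) > 0" for i
  proof (cases "L0 i \<in> uncrossed base_triple us")
    case False
    hence "mink (act us apex) (normal (L0 i)) > 0"
      using mink_point_of_beyond[of base_triple us "L0 i"] assms by (auto simp: base_triple_def point_of_def)
    thus ?thesis
      using apex_in_cell by blast
  next
    case True
    have "L0 i \<in> corner a"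
      using True assms corner(3)[of a] corner(4)[of "L0 i" a] by (auto simp: base_triple_def)
    hence "point_of [L0 i] \<in> cell (corner a)"
      by (intro point_of_in_cell) simp
    moreover have "mink (act us (point_of [L0 i])) (normal (L0 i)) > 0"
      using mink_uncrossed[OF _ True] assms apex_depth_pos
      by (simp add: point_of_def letter_refl_eq mink_simps mink_apex_normal)
    ultimately show ?thesis by blast
  qed
  ultimately show ?thesis
    unfolding base_pyramid_def by blast
qed

lemma edge_iff: "e \<in> edges \<longleftrightarrow> (\<exists>us a. e = {point_of us, point_of (a # us)})"
proof -
  have cell1: "cell {a} = {apex, point_of [a]}" for a
  proof -
    have "point_of zs = apex \<or> point_of zs = point_of [a]" if "set zs \<subseteq> {a}" for zs
      using that by (induction zs rule: rev_induct) (auto simp: point_of_def act_append)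
    hence "cell {a} \<subseteq> {apex, point_of [a]}"
      by (metis in_cellE insert_iff subsetI)
    thus ?thesis
      using apex_in_cell[of "{a}"] point_of_in_cell[of "[a]" "{a}"] by auto
  qed
  have "clique {a}" for a
    by (simp add: clique_def)
  hence "e \<in> edges \<longleftrightarrow> (\<exists>us a. e = act us ` cell {a})"
    unfolding edges_eq by (auto simp: card_1_singleton_iff)
  thus ?thesis
    unfolding cell1 by (simp add: point_of_def)
qed

lemma point_of_Cons_neq: "point_of (a # us) \<noteq> point_of us"
proof
  assume "point_of (a # us) = point_of us"
  hence "letter_refl a apex = apex"
    using isometry_inj[OF isometry_act, of us] by (auto simp: point_of_def dest: injD)
  hence "normal a = 0"
    using apex_depth_pos by (simp add: letter_refl_eq mink_apex_normal)
  thus False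
    using mink_normal_self[of a] by (simp add: mink_def)
qed

lemma point_of_Cons_inj: "point_of (a # us) = point_of (b # us) \<Longrightarrow> a = b"
proof -
  assume "point_of (a # us) = point_of (b # us)"
  hence "same_action (a # us) (b # us)"
    by (rule point_of_faithful)
  hence "act us (letter_refl a p) = act us (letter_refl b p)" for p
    using sameD[of "a # us" "b # us" p] by simp
  hence "letter_refl a p = letter_refl b p" for p
    using isometry_inj[OF isometry_act, of us] injD by metis
  thus "a = b"
    by (rule letter_refl_inj)
qed

lemma base_adj_sym: "base_adj u v \<Longrightarrow> base_adj v u"
  by (auto simp: base_adj_def insert_commute)

lemma base_adj_Cons:
  assumes "admissible base_triple (a # us)"
  shows "base_adj (point_of us) (point_of (a # us))"
proof -
  have "point_of us = act us apex" "point_of (a # us) = act us (point_of [a])"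
    by (simp_all add: point_of_def)
  moreover have "point_of [a] \<in> cell (corner a)"
    using corner(3) by (intro point_of_in_cell) simp
  ultimately have "{point_of us, point_of (a # us)} \<subseteq> act us ` cell (corner a)"
    using apex_in_cell by blast
  hence "\<exists>K\<in>base_pyramid. {point_of us, point_of (a # us)} \<subseteq> K"
    using admissible_edge_in_base_pyramid[OF assms] by (rule bexI)
  moreover have "{point_of us, point_of (a # us)} \<in> edges"
    unfolding edge_iff by blast
  ultimately show ?thesis
    unfolding base_adj_def using point_of_Cons_neq[of a us] by simp
qed

text \<open>A step that is neither admissible nor backward would by \<open>mink_exit\<close> end too
  far behind a midplane for a vertex of the pyramid.\<close>

lemma base_adj_iff:
  assumes "admissible base_triple us"
  shows "base_adj (point_of us) v \<longleftrightarrow> (\<exists>a. v = point_of (a # us) \<and> (admissible base_triple (a # us) \<or> a \<in> descents us))"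
proof
  assume adj: "base_adj (point_of us) v"
  hence "{point_of us, v} \<in> edges" and K: "\<exists>K\<in>base_pyramid. v \<in> K"
    by (auto simp: base_adj_def)
  then obtain vs b where vs: "{point_of us, v} = {point_of vs, point_of (b # vs)}"
    unfolding edge_iff by blast
  have "point_of us = point_of vs \<and> v = point_of (b # vs) \<or> point_of us = point_of (b # vs) \<and> v = point_of vs"
    using vs unfolding doubleton_eq_iff .
  hence "\<exists>a. v = point_of (a # us)"
  proof (elim disjE conjE)
    assume *: "point_of us = point_of vs" "v = point_of (b # vs)"
    have "v = point_of (b # us)"
      using *(2) point_of_cong[OF same_action_Cons[OF point_of_faithful[OF *(1)]]] by simp
    thus ?thesis by blast
  next
    assume *: "point_of us = point_of (b # vs)" "v = point_of vs"
    have "v = point_of (b # b # vs)"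
      using *(2) point_of_cong[OF same_action_double] by simp
    also have "\<dots> = point_of (b # us)"
      using point_of_cong[OF same_action_Cons[OF point_of_faithful[OF *(1)]]] by simp
    finally show ?thesis by blast
  qed
  then obtain a where a: "v = point_of (a # us)" by blast
  obtain K where K: "K \<in> base_pyramid" "v \<in> K"
    using K by blast
  have "admissible base_triple (a # us)" if nd: "a \<notin> descents us"
  proof (rule ccontr)
    assume "\<not> admissible base_triple (a # us)"
    then obtain i where "mink v (normal (L0 i)) < - apex_depth"
      using mink_exit[OF assms nd] a unfolding base_triple_def by blast
    thus False
      using base_pyramid_mink[OF K, of i] apex_depth_pos by auto
  qed
  thus "\<exists>a. v = point_of (a # us) \<and> (admissible base_triple (a # us) \<or> a \<in> descents us)"
    using a by blast
next
  assume "\<exists>a. v = point_of (a # us) \<and> (admissible base_triple (a # us) \<or> a \<in> descents us)"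
  then obtain a where a: "v = point_of (a # us)" "admissible base_triple (a # us) \<or> a \<in> descents us"
    by blast
  show "base_adj (point_of us) v"
  proof (cases "a \<in> descents us")
    case False
    thus ?thesis
      using a base_adj_Cons by blast
  next
    case True
    then obtain us' where us': "admissible base_triple (a # us')" "same_action us (a # us')"
      using admissible_pop[OF assms] by blast
    have "base_adj (point_of us') (point_of (a # us'))"
      by (rule base_adj_Cons[OF us'(1)])
    moreover have "point_of (a # us') = point_of us"
      using point_of_cong[OF us'(2)] by simp
    moreover have "point_of us' = point_of (a # us)"
      using point_of_cong[OF same_action_cancel[OF us'(2)]] by simp
    ultimately show ?thesis
      using a(1) base_adj_sym by simp
  qed
qed

text \<open>A wall face lies in a cube without vertices beyond the midplane, which excludes crossed
  walls. At an uncrossed wall \<open>act us\<close> fixes the normal of \<open>L0 i\<close> and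
  carries along the face at the apex with its two cubes.\<close>

lemma on_wall_iff:
  assumes "admissible base_triple us"
  shows "on_wall i (point_of us) \<longleftrightarrow> L0 i \<in> uncrossed base_triple us"
proof
  assume "on_wall i (point_of us)"
  hence "\<not> mink (point_of us) (normal (L0 i)) > 0"
    unfolding on_wall_def wall_face_def by blast
  thus "L0 i \<in> uncrossed base_triple us"
    using mink_point_of_beyond[OF assms, of "L0 i"] by (auto simp: base_triple_def)
next
  assume i: "L0 i \<in> uncrossed base_triple us"
  define T where "T = base_triple - {L0 i}"
  have T: "clique T" "card T = 2"
    using clique_subset[OF clique_base_triple] card_base_triple_minus by (auto simp: T_def)
  have G: "act us ` cell T \<in> faces"
    unfolding faces_eq using T by blast
  have "point_of us \<in> act us ` cell T"
    using apex_in_cell by (auto simp: point_of_def)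
  moreover have "\<exists>K\<in>cubes. (\<exists>p\<in>K. mink p (normal (L0 i)) > 0) \<and> act us ` cell T \<subseteq> K"
  proof (rule bexI[of _ "act us ` cell base_triple"], rule conjI)
    show "act us ` cell base_triple \<in> cubes"
      unfolding cubes_eq using clique_base_triple card_base_triple by blast
    show "act us ` cell T \<subseteq> act us ` cell base_triple"
      by (intro image_mono cell_mono) (auto simp: T_def)
    have "point_of [L0 i] \<in> cell base_triple"
      by (intro point_of_in_cell) (simp add: base_triple_def)
    moreover have "mink (act us (point_of [L0 i])) (normal (L0 i)) > 0"
      using mink_uncrossed[OF assms i] apex_depth_pos
      by (simp add: point_of_def letter_refl_eq mink_simps mink_apex_normal)
    ultimately show "\<exists>p\<in>act us ` cell base_triple. mink p (normal (L0 i)) > 0"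
      by blast
  qed
  \<comment> \<open>On the outer side of the face \<open>L1 i\<close> takes the place of
    \<open>L0 i\<close>, of which it is the mirror image in this face.\<close>
  moreover have "\<exists>K\<in>cubes. \<not> (\<exists>p\<in>K. mink p (normal (L0 i)) > 0) \<and> act us ` cell T \<subseteq> K"
  proof (rule bexI[of _ "act us ` cell (corner (L1 i))"], rule conjI)
    show "act us ` cell (corner (L1 i)) \<in> cubes"
      unfolding cubes_eq using corner by blast
    show "act us ` cell T \<subseteq> act us ` cell (corner (L1 i))"
      by (intro image_mono cell_mono) (auto simp: T_def)
    have "\<not> mink (act us p) (normal (L0 i)) > 0" if p: "p \<in> cell (corner (L1 i))" for p
    proof
      assume "mink (act us p) (normal (L0 i)) > 0"
      hence pos: "mink p (normal (L0 i)) > 0"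
        by (simp add: mink_uncrossed[OF assms i])
      obtain zs where "set zs \<subseteq> corner (L1 i)" "p = point_of zs"
        using p by (rule in_cellE)
      then obtain a where "a \<in> corner (L1 i)" "\<forall>p. letter_refl a p = letter_refl (L0 i) p"
        using clique_crossing[OF corner(1), of zs "L1 i" "[]" "L0 i"] pos apex_depth_pos
        by (auto simp: point_of_def mink_apex_normal)
      thus False
        using letter_refl_inj[of a "L0 i"] by auto
    qed
    thus "\<not> (\<exists>p\<in>act us ` cell (corner (L1 i)). mink p (normal (L0 i)) > 0)"
      by blast
  qed
  ultimately show "on_wall i (point_of us)"
    unfolding on_wall_def wall_face_def using G by blast
qed

text \<open>Without finiteness the vertex sums in \<open>inner_side\<close> would take the default
  value 0.\<close>

lemma finite_base_cube: "finite base_cube"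
proof -
  define f where "f = (\<lambda>(a, b, c). (vector [a, b, c] :: real^3, snd apex))"
  define S where "S = {cube_radius * snd apex, - (cube_radius * snd apex)}"
  have "base_cube \<subseteq> f ` (S \<times> S \<times> S)"
  proof
    fix p
    assume p: "p \<in> base_cube"
    have "fst p $ axis_of i \<in> S" for i
      using base_cube_normal(1)[OF p, of i] base_cube_snd[OF p] by (auto simp: S_def mink_L0)
    from this[of DX] this[of DY] this[of DZ] have "(fst p $ 1, fst p $ 2, fst p $ 3) \<in> S \<times> S \<times> S"
      by simp
    moreover have "p = f (fst p $ 1, fst p $ 2, fst p $ 3)"
      using base_cube_snd[OF p] by (cases p) (simp add: f_def vec_eq_iff forall_3 vector_3)
    ultimately show "p \<in> f ` (S \<times> S \<times> S)"
      by blast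
  qed
  thus ?thesis
    by (rule finite_subset) (simp add: S_def)
qed

section \<open>Transport to an arbitrary cube and vertex\<close>

locale apex_frame =
  fixes h :: "point \<Rightarrow> point" and Q :: "point set" and V :: point
  assumes frame: "frame h" and Q: "Q = h ` cell base_triple" and V: "V = h apex"
begin

definition wface :: "dir \<Rightarrow> point set" where
  "wface i = h ` cell (base_triple - {L0 i})"

lemma isometry_h: "isometry h" and inj_h: "inj h" and surj_h: "surj h"
  using frame isometry_inj unfolding frame_def by blast+

lemma orbit_h: "h ` X \<in> cubes \<longleftrightarrow> X \<in> cubes" "h ` X \<in> faces \<longleftrightarrow> X \<in> faces" "h ` X \<in> edges \<longleftrightarrow> X \<in> edges"
  using frame unfolding frame_def cubes_orbit faces_orbit edges_orbit by blast+

lemma image_ex: "\<exists>X. Y = h ` X"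
  using surj_h by (metis subset_imageE top_greatest)

lemma corner_faces_eq: "corner_faces Q V = range wface"
proof (intro equalityI subsetI)
  fix F
  assume F: "F \<in> corner_faces Q V"
  obtain X where X: "F = h ` X"
    using image_ex by blast
  have "X \<in> faces" "X \<subseteq> cell base_triple" "apex \<in> X"
    using F inj_h unfolding corner_faces_def X Q V
    by (auto simp: orbit_h inj_image_subset_iff inj_image_mem_iff)
  then obtain us T where T: "clique T" "card T = 2" "X = act us ` cell T"
    unfolding faces_eq by blast
  have XT: "X = cell T"
    using rebase[of "[]" us T] T(3) \<open>apex \<in> X\<close> by (simp add: point_of_def)
  \<comment> \<open>The neighbour of the apex along \<open>a\<close> lies in the base cube and
    beyond the midplane \<open>a\<close>, so a letter of \<open>base_triple\<close> crosses this
    midplane and must be \<open>a\<close>.\<close>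
  have "T \<subseteq> base_triple"
  proof
    fix a
    assume "a \<in> T"
    hence "point_of [a] \<in> cell base_triple"
      using \<open>X \<subseteq> cell base_triple\<close> point_of_in_cell[of "[a]" T] unfolding XT by auto
    then obtain zs where zs: "set zs \<subseteq> base_triple" "point_of [a] = point_of zs"
      by (rule in_cellE)
    have "mink (point_of [a]) (normal a) > 0"
      using apex_depth_pos by (simp add: point_of_def letter_refl_eq mink_simps mink_apex_normal)
    then obtain b where "b \<in> base_triple" "\<forall>p. letter_refl b p = letter_refl a p"
      using clique_crossing[OF clique_base_triple zs(1), of "[]" a] zs(2) apex_depth_pos
      by (auto simp: point_of_def mink_apex_normal)
    thus "a \<in> base_triple"
      using letter_refl_inj[of b a] by auto
  qed
  thus "F \<in> range wface"
    using card_2_base_triple[OF _ T(2)] unfolding X XT wface_def by auto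
next
  fix F
  assume "F \<in> range wface"
  then obtain i where i: "F = h ` cell (base_triple - {L0 i})"
    by (auto simp: wface_def)
  have "act [] ` cell (base_triple - {L0 i}) \<in> faces"
    unfolding faces_eq using clique_subset[OF clique_base_triple] card_base_triple_minus by blast
  hence "cell (base_triple - {L0 i}) \<in> faces"
    by simp
  thus "F \<in> corner_faces Q V"
    unfolding corner_faces_def i Q V
    using apex_in_cell cell_mono[of "base_triple - {L0 i}" base_triple] by (auto simp: orbit_h)
qed

lemma wface_inj: "inj wface"
proof (rule injI)
  fix i j
  assume "wface i = wface j"
  hence eq: "cell (base_triple - {L0 i}) = cell (base_triple - {L0 j})"
    unfolding wface_def using inj_h by (simp add: inj_image_eq_iff)
  show "i = j"
  proof (rule ccontr)
    assume "i \<noteq> j"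
    hence "point_of [L0 i] \<in> cell (base_triple - {L0 i})"
      unfolding eq by (intro point_of_in_cell) (auto simp: base_triple_def)
    hence "mink (point_of [L0 i]) (normal (L0 i)) < 0"
      by (subst (asm) cell_base) (auto simp: base_triple_def)
    thus False
      using apex_depth_pos by (simp add: point_of_def letter_refl_eq mink_simps mink_apex_normal)
  qed
qed

text \<open>The opposite face is the mirror image of \<open>wface i\<close> in the midplane, so the
  difference of the vertex sums adds up displacements, all positive multiples of the same
  normal.\<close>

lemma midplane_normal: "\<exists>c>0. \<Sum>(Q - wface i) - \<Sum>(wface i) = c *\<^sub>R h (normal (L0 i))"
proof -
  define C where "C = cell (base_triple - {L0 i})"
  define n where "n = normal (L0 i)"
  have C: "C = {p \<in> base_cube. mink p n < 0}"
    unfolding C_def n_def by (subst cell_base) (auto simp: base_triple_def)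
  have fin: "finite C"
    using finite_base_cube by (rule finite_subset[rotated]) (auto simp: C)
  have lin: "linear h"
    by (rule isometry_linear[OF isometry_h])
  have sum_h: "\<Sum>(h ` X) = h (\<Sum>X)" for X
    using linear_sum[OF lin, of id X] inj_h
    by (subst sum.reindex) (auto intro: inj_on_subset)
  have "cell base_triple - C = letter_refl (L0 i) ` C"
  proof (intro equalityI subsetI)
    fix p
    assume "p \<in> cell base_triple - C"
    hence "p \<in> base_cube" "\<not> mink p n < 0"
      by (auto simp: C base_cube_eq)
    hence "letter_refl (L0 i) p \<in> C"
      using base_cube_normal(1)[of p i] base_cube_normal(2)[of p] refl_L0_base_cube[of p i] unfolding C n_def
      by (auto simp: mink_refl_L0)
    thus "p \<in> letter_refl (L0 i) ` C"
      by (rule rev_image_eqI) simp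
  next
    fix p
    assume "p \<in> letter_refl (L0 i) ` C"
    thus "p \<in> cell base_triple - C"
      using refl_L0_base_cube unfolding base_cube_eq[symmetric] C n_def
      by (auto simp: mink_refl_L0)
  qed
  hence "Q - wface i = h ` letter_refl (L0 i) ` C"
    unfolding Q wface_def C_def[symmetric] by (simp only: image_set_diff[OF inj_h, symmetric])
  hence "\<Sum>(Q - wface i) - \<Sum>(wface i) = h (\<Sum>(letter_refl (L0 i) ` C)) - h (\<Sum>C)"
    unfolding sum_h wface_def C_def[symmetric] by (simp add: sum_h)
  also have "\<dots> = h (\<Sum>(letter_refl (L0 i) ` C) - \<Sum>C)"
    by (simp add: linear_diff[OF lin])
  also have "\<Sum>(letter_refl (L0 i) ` C) = (\<Sum>p\<in>C. letter_refl (L0 i) p)"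
    by (subst sum.reindex) (auto intro: inj_on_subset[OF isometry_inj[OF isometry_letter_refl]])
  also have "\<dots> - \<Sum>C = (\<Sum>p\<in>C. (- 2 * mink p n) *\<^sub>R n)"
    by (simp add: letter_refl_eq n_def sum_subtractf sum_negf)
  also have "\<dots> = (\<Sum>p\<in>C. - 2 * mink p n) *\<^sub>R n"
    by (rule scaleR_sum_left[symmetric])
  also have "h \<dots> = (\<Sum>p\<in>C. - 2 * mink p n) *\<^sub>R h n"
    by (rule linear_scale[OF lin])
  finally have "\<Sum>(Q - wface i) - \<Sum>(wface i) = (\<Sum>p\<in>C. - 2 * mink p n) *\<^sub>R h n" .
  moreover have "(\<Sum>p\<in>C. - 2 * mink p n) > 0"
  proof (rule sum_pos[OF fin])
    show "C \<noteq> {}"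
      using apex_in_cell[of "base_triple - {L0 i}"] unfolding C_def by blast
  qed (auto simp: C)
  ultimately show ?thesis
    unfolding n_def by blast
qed

lemma inner_side_iff: "h ` K \<in> inner_side Q (wface i) \<longleftrightarrow> K \<in> cubes \<and> (\<exists>p\<in>K. mink p (normal (L0 i)) > 0)"
proof -
  obtain c where c: "c > 0" "\<Sum>(Q - wface i) - \<Sum>(wface i) = c *\<^sub>R h (normal (L0 i))"
    using midplane_normal by blast
  show ?thesis
    unfolding inner_side_def c(2) using c(1)
    by (simp add: orbit_h mink_simps isometry_mink[OF isometry_h] zero_less_mult_iff)
qed

lemma pyramid_iff: "h ` K \<in> pyramid Q V \<longleftrightarrow> K \<in> base_pyramid"
  unfolding pyramid_def base_pyramid_def corner_faces_eq by (auto simp: inner_side_iff orbit_h)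

lemma adj_iff: "adj Q V (h u) (h v) \<longleftrightarrow> base_adj u v"
proof -
  have ex: "(\<exists>Y. P Y) \<longleftrightarrow> (\<exists>X. P (h ` X))" for P
    using image_ex by metis
  have "h ` {u, v} \<in> edges \<longleftrightarrow> {u, v} \<in> edges"
    by (rule orbit_h)
  moreover have "h ` {u, v} \<subseteq> h ` K \<longleftrightarrow> {u, v} \<subseteq> K" for K
    using inj_h by (rule inj_image_subset_iff)
  ultimately show ?thesis
    unfolding adj_def base_adj_def Bex_def ex[of "\<lambda>K. K \<in> pyramid Q V \<and> _ K"] pyramid_iff
    using inj_h by (auto simp: inj_eq)
qed

lemma verts_iff: "h u \<in> verts Q V \<longleftrightarrow> (\<exists>K\<in>base_pyramid. u \<in> K)"
proof
  assume "h u \<in> verts Q V"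
  then obtain Y where Y: "Y \<in> pyramid Q V" "h u \<in> Y"
    unfolding verts_def by blast
  obtain K where "Y = h ` K"
    using image_ex by blast
  thus "\<exists>K\<in>base_pyramid. u \<in> K"
    using Y pyramid_iff inj_h by (auto simp: inj_image_mem_iff)
next
  assume "\<exists>K\<in>base_pyramid. u \<in> K"
  thus "h u \<in> verts Q V"
    unfolding verts_def using pyramid_iff by blast
qed

lemma ex_image: "(\<exists>Y\<in>A. h ` G \<subseteq> Y) \<longleftrightarrow> (\<exists>K. h ` K \<in> A \<and> G \<subseteq> K)"
  by (metis image_ex inj_image_subset_iff[OF inj_h])

lemma wall_iff: "h ` G \<in> wall Q (wface i) \<longleftrightarrow> wall_face i G"
  unfolding wall_def wall_face_def mem_Collect_eq orbit_h ex_image Diff_iff inner_side_iff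
  by auto

lemma walls_at_eq: "walls_at Q V (h u) = wface ` {i. on_wall i u}"
proof -
  have "h u \<in> \<Union>(wall Q (wface i)) \<longleftrightarrow> on_wall i u" for i
  proof
    assume "h u \<in> \<Union>(wall Q (wface i))"
    then obtain Y where Y: "Y \<in> wall Q (wface i)" "h u \<in> Y"
      by blast
    obtain G where G: "Y = h ` G"
      using image_ex by blast
    have "wall_face i G" "u \<in> G"
      using Y inj_h unfolding G wall_iff by (auto simp: inj_image_mem_iff)
    thus "on_wall i u"
      unfolding on_wall_def by blast
  next
    assume "on_wall i u"
    then obtain G where "h ` G \<in> wall Q (wface i)" "u \<in> G"
      unfolding on_wall_def wall_iff by blast
    thus "h u \<in> \<Union>(wall Q (wface i))"
      by blast
  qed
  thus ?thesis
    unfolding walls_at_def corner_faces_eq by auto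
qed

end

section \<open>Shortest paths as admissible words\<close>

definition words :: "nat \<Rightarrow> letter list set" where
  "words n = {us. admissible base_triple us \<and> length us = n}"

lemma finite_words: "finite (words n)"
  by (rule finite_subset[OF _ finite_lists_length_eq[of UNIV n]]) (auto simp: words_def)

context apex_frame
begin

definition vert :: "letter list \<Rightarrow> point" where
  "vert us = h (point_of us)"

primrec trace :: "letter list \<Rightarrow> point list" where
  "trace [] = [V]"
| "trace (a # us) = trace us @ [vert (a # us)]"

lemma vert_Nil: "vert [] = V"
  by (simp add: vert_def point_of_def V)

lemma trace_simps [simp]:
  "length (trace us) = Suc (length us)" "hd (trace us) = V" "last (trace us) = vert us" "trace us \<noteq> []"
proof -
  show l: "length (trace us) = Suc (length us)" for us
    by (induction us) auto
  show n: "trace us \<noteq> []" for us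
    using l[of us] by auto
  show "hd (trace us) = V"
    by (induction us) (auto simp: n)
  show "last (trace us) = vert us"
    by (cases us) (auto simp: vert_Nil)
qed

lemma vert_eq_iff: "vert us = vert vs \<longleftrightarrow> point_of us = point_of vs"
  using inj_h by (simp add: vert_def inj_eq)

text \<open>Different letters lead to different neighbours, so the vertices of a path determine its
  letters.\<close>

lemma trace_inj: "trace us = trace vs \<Longrightarrow> us = vs"
proof (induction us arbitrary: vs)
  case Nil
  hence "length (trace vs) = 1"
    by (metis length_Cons list.size(3) trace.simps(1) One_nat_def)
  thus ?case by simp
next
  case (Cons a us)
  have "length (trace vs) = length (trace (a # us))"
    using Cons.prems by simp
  then obtain b vs' where vs: "vs = b # vs'"
    by (cases vs) auto
  have "us = vs'"
    using Cons.prems by (intro Cons.IH) (simp add: vs)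
  moreover have "point_of (a # us) = point_of (b # vs')"
    using Cons.prems by (simp add: vs vert_eq_iff)
  ultimately show ?case
    using point_of_Cons_inj vs by blast
qed

lemma vert_length:
  assumes "admissible base_triple us" "admissible base_triple vs" "vert us = vert vs"
  shows "length us = length vs"
  using assms reduced_length_cong[OF admissible_reduced admissible_reduced point_of_faithful]
  unfolding vert_eq_iff by blast

lemma adj_vert:
  assumes "admissible base_triple us" "adj Q V (vert us) v"
  shows "\<exists>a. v = vert (a # us) \<and> (admissible base_triple (a # us) \<or> a \<in> descents us)"
proof -
  obtain u where u: "v = h u"
    using surj_h by (metis surjD)
  thus ?thesis
    using assms base_adj_iff[OF assms(1), of u] unfolding vert_def u adj_iff by blast
qed

lemma adj_vertI:
  assumes "admissible base_triple us" "admissible base_triple (a # us) \<or> a \<in> descents us"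
  shows "adj Q V (vert us) (vert (a # us))"
  using assms base_adj_iff[OF assms(1)] unfolding vert_def adj_iff by blast

lemma adj_sym: "adj Q V u v \<Longrightarrow> adj Q V v u"
  unfolding adj_def by (auto simp: insert_commute)

lemma vert_pop:
  assumes "admissible base_triple us" "a \<in> descents us"
  shows "\<exists>us'. admissible base_triple us' \<and> length us = Suc (length us') \<and> vert (a # us) = vert us'"
proof -
  obtain us' where us': "admissible base_triple (a # us')" "length us = length (a # us')" "same_action us (a # us')"
    using admissible_pop[OF assms] by blast
  have "vert (a # us) = vert us'"
    unfolding vert_eq_iff by (rule point_of_cong[OF same_action_cancel[OF us'(3)]])
  thus ?thesis
    using us' by auto
qed

lemma vert_in_verts:
  assumes "admissible base_triple us"
  shows "vert us \<in> verts Q V"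
proof -
  have "\<exists>K\<in>base_pyramid. point_of us \<in> K"
  proof (cases us)
    case Nil
    have "admissible base_triple [L0 DX]"
      by (auto simp: base_triple_def)
    hence "base_adj (point_of []) (point_of [L0 DX])"
      by (rule base_adj_Cons)
    thus ?thesis
      unfolding Nil base_adj_def by blast
  next
    case (Cons a us')
    hence "base_adj (point_of us') (point_of us)"
      using base_adj_Cons assms by blast
    thus ?thesis
      unfolding base_adj_def by blast
  qed
  thus ?thesis
    unfolding vert_def verts_iff .
qed

lemma walks_snoc:
  assumes "xs \<in> walks Q V (Suc n) v"
  shows "\<exists>ys. xs = ys @ [v] \<and> ys \<in> walks Q V n (last ys) \<and> adj Q V (last ys) v"
proof -
  have xs: "length xs = Suc (Suc n)" "hd xs = V" "last xs = v" "set xs \<subseteq> verts Q V"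
    "successively (adj Q V) xs"
    using assms by (auto simp: walks_def)
  define ys where "ys = butlast xs"
  have "length ys = Suc n"
    using xs(1) by (simp add: ys_def)
  hence ne: "ys \<noteq> []" by auto
  have eq: "xs = ys @ [v]"
    using xs(1,3) append_butlast_last_id[of xs] unfolding ys_def by fastforce
  have "ys \<in> walks Q V n (last ys)" "adj Q V (last ys) v"
    using xs ne unfolding eq walks_def by (auto simp: successively_append_iff)
  thus ?thesis
    using eq by blast
qed

text \<open>A forward step adds a letter and a backward step removes one; so a vertex cannot be
  reached with fewer edges than its word has letters.\<close>

lemma walk_word:
  "xs \<in> walks Q V n v \<Longrightarrow> \<exists>us. admissible base_triple us \<and> length us \<le> n \<and> v = vert us"
proof (induction n arbitrary: xs v)
  case 0
  then obtain x where "xs = [x]"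
    by (auto simp: walks_def length_Suc_conv)
  hence "v = vert []"
    using 0 by (auto simp: walks_def vert_Nil)
  thus ?case
    by (intro exI[of _ "[]"]) auto
next
  case (Suc n)
  obtain ys where ys: "ys \<in> walks Q V n (last ys)" "adj Q V (last ys) v"
    using walks_snoc[OF Suc.prems] by blast
  obtain us where us: "admissible base_triple us" "length us \<le> n" "last ys = vert us"
    using Suc.IH[OF ys(1)] by blast
  obtain a where a: "v = vert (a # us)" "admissible base_triple (a # us) \<or> a \<in> descents us"
    using adj_vert[OF us(1) ys(2)[unfolded us(3)]] by blast
  show ?case
  proof (cases "a \<in> descents us")
    case True
    then obtain us' where "admissible base_triple us'" "length us = Suc (length us')" "v = vert us'"
      using vert_pop[OF us(1)] a(1) by auto
    thus ?thesis
      using us(2) by (intro exI[of _ us']) auto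
  next
    case False
    thus ?thesis
      using a us(2) by (intro exI[of _ "a # us"]) auto
  qed
qed

lemma trace_walk:
  assumes "admissible base_triple us"
  shows "trace us \<in> walks Q V (length us) (vert us)"
proof -
  have "set (trace us) \<subseteq> verts Q V \<and> successively (adj Q V) (trace us)"
    using assms
  proof (induction us)
    case Nil
    thus ?case
      using vert_in_verts[of "[]"] by (simp add: vert_Nil)
  next
    case (Cons a us)
    hence "adj Q V (vert us) (vert (a # us))"
      by (intro adj_vertI) auto
    thus ?case
      using Cons vert_in_verts[OF Cons.prems] by (auto simp: successively_append_iff)
  qed
  thus ?thesis
    by (simp add: walks_def)
qed

text \<open>Word length is graph distance: \<open>walk_word\<close> gives the lower bound and
  \<open>trace_walk\<close> the upper one.\<close>

lemma level_eq: "level Q V n = vert ` words n"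
proof (intro equalityI subsetI)
  fix v
  assume v: "v \<in> level Q V n"
  then obtain us where us: "admissible base_triple us" "length us \<le> n" "v = vert us"
    unfolding level_def using walk_word by blast
  have "length us = n"
    using v trace_walk[OF us(1)] us(2) unfolding level_def us(3) by (metis (mono_tags, lifting) empty_iff le_neq_implies_less mem_Collect_eq)
  thus "v \<in> vert ` words n"
    using us by (auto simp: words_def)
next
  fix v
  assume "v \<in> vert ` words n"
  then obtain us where us: "admissible base_triple us" "length us = n" "v = vert us"
    by (auto simp: words_def)
  have "walks Q V m v = {}" if "m < n" for m
  proof (rule ccontr)
    assume "walks Q V m v \<noteq> {}"
    then obtain us' where "admissible base_triple us'" "length us' \<le> m" "v = vert us'"
      using walk_word by blast
    thus False
      using vert_length[of us us'] us that by auto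
  qed
  moreover have "walks Q V n v \<noteq> {}"
    using trace_walk[OF us(1)] us by auto
  ultimately show "v \<in> level Q V n"
    unfolding level_def using vert_in_verts[OF us(1)] us(3) by blast
qed

lemma level_unique:
  assumes "v \<in> level Q V n" "v \<in> level Q V m"
  shows "m = n"
proof -
  obtain us vs where "us \<in> words n" "vs \<in> words m" "vert us = vert vs"
    using assms unfolding level_eq by (metis imageE)
  thus ?thesis
    using vert_length[of us vs] by (simp add: words_def)
qed

text \<open>A backward step would put \<open>v\<close> on a lower level, so each step of a shortest
  path appends an admissible letter.\<close>

lemma geodesic_word:
  assumes "xs \<in> walks Q V n v" "v \<in> level Q V n"
  shows "\<exists>us\<in>words n. xs = trace us \<and> vert us = v"
  using assms
proof (induction n arbitrary: xs v)
  case 0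
  then obtain x where "xs = [x]"
    by (auto simp: walks_def length_Suc_conv)
  hence "xs = [V]" "v = V"
    using 0 by (auto simp: walks_def)
  thus ?case
    by (intro bexI[of _ "[]"]) (auto simp: words_def vert_Nil)
next
  case (Suc n)
  obtain ys where ys: "xs = ys @ [v]" "ys \<in> walks Q V n (last ys)" "adj Q V (last ys) v"
    using walks_snoc[OF Suc.prems(1)] by blast
  have next_word: "\<exists>a. v = vert (a # us) \<and> admissible base_triple (a # us) \<and> length us = n"
    if us: "admissible base_triple us" "length us \<le> n" "last ys = vert us" for us
  proof -
    obtain a where a: "v = vert (a # us)" "admissible base_triple (a # us) \<or> a \<in> descents us"
      using adj_vert[OF us(1) ys(3)[unfolded us(3)]] by blast
    have "admissible base_triple (a # us)"
    proof (rule ccontr)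
      assume "\<not> admissible base_triple (a # us)"
      hence "a \<in> descents us"
        using a(2) by blast
      then obtain us' where us': "admissible base_triple us'" "length us = Suc (length us')" "v = vert us'"
        using vert_pop[OF us(1)] a(1) by blast
      hence "v \<in> level Q V (length us')"
        unfolding level_eq words_def by blast
      from level_unique[OF Suc.prems(2) this] show False
        using us'(2) us(2) by simp
    qed
    moreover from this have "v \<in> level Q V (length (a # us))"
      unfolding level_eq words_def using a(1) by blast
    from level_unique[OF Suc.prems(2) this] have "length us = n"
      by simp
    ultimately show ?thesis
      using a(1) by blast
  qed
  \<comment> \<open>This word only serves to show that \<open>ys\<close> is itself a shortest path;
    the word that \<open>ys\<close> traces comes from the induction hypothesis.\<close>
  obtain us where us: "admissible base_triple us" "length us \<le> n" "last ys = vert us"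
    using walk_word[OF ys(2)] by blast
  have "length us = n"
    using next_word[OF us] by blast
  hence "last ys \<in> level Q V n"
    unfolding level_eq us(3) using us(1) by (intro imageI) (simp add: words_def)
  then obtain us' where us': "us' \<in> words n" "ys = trace us'" "vert us' = last ys"
    using Suc.IH[OF ys(2)] by blast
  have "admissible base_triple us'" "length us' \<le> n"
    using us'(1) by (simp_all add: words_def)
  then obtain a where a: "v = vert (a # us')" "admissible base_triple (a # us')"
    using next_word[OF _ _ us'(3)[symmetric]] by blast
  have "xs = trace (a # us')"
    using ys(1) us'(2) a(1) by simp
  moreover have "a # us' \<in> words (Suc n)"
    using a(2) us'(1) by (simp add: words_def)
  ultimately show ?case
    using a(1) by blast
qed

lemma label_eq:
  assumes "v \<in> level Q V n"
  shows "label Q V v = card {us \<in> words n. vert us = v}"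
proof -
  have "(LEAST n. walks Q V n v \<noteq> {}) = n"
    using assms unfolding level_def by (intro Least_equality) (auto simp: not_less[symmetric])
  moreover have "walks Q V n v = trace ` {us \<in> words n. vert us = v}"
  proof -
    have "trace us \<in> walks Q V n v" if "us \<in> words n" "vert us = v" for us
      using trace_walk[of us] that by (auto simp: words_def)
    thus ?thesis
      using geodesic_word[OF _ assms] by blast
  qed
  moreover have "inj_on trace A" for A
    using trace_inj by (auto intro: inj_onI)
  ultimately show ?thesis
    unfolding label_def by (simp add: card_image)
qed

text \<open>Grouping words by their end vertex turns sums of labels into numbers of words, so the
  vertices never have to be counted.\<close>

lemma label_sum_eq:
  assumes "S \<subseteq> level Q V n"
  shows "label_sum Q V S = real (card {us \<in> words n. vert us \<in> S})"
proof -
  define A where "A = {us \<in> words n. vert us \<in> S}"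
  have fin: "finite S" "finite A"
    using finite_subset[OF assms[unfolded level_eq] finite_imageI[OF finite_words]] finite_words
    by (auto simp: A_def)
  have "label_sum Q V S = (\<Sum>v\<in>S. real (card {us \<in> words n. vert us = v}))"
    unfolding label_sum_def using assms by (intro sum.cong) (auto simp: label_eq)
  also have "\<dots> = real (\<Sum>v\<in>S. card {us \<in> A. vert us = v})"
    unfolding of_nat_sum by (intro sum.cong) (auto simp: A_def intro: arg_cong[of _ _ card])
  also have "(\<Sum>v\<in>S. card {us \<in> A. vert us = v}) = card A"
    using sum.group[OF fin(2,1), of vert "\<lambda>_. 1::nat"] by (auto simp: A_def)
  finally show ?thesis
    by (simp add: A_def)
qed

lemma walls_at_vert:
  assumes "admissible base_triple us"
  shows "walls_at Q V (vert us) = wface ` {i. L0 i \<in> uncrossed base_triple us}"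
  unfolding vert_def walls_at_eq using on_wall_iff[OF assms] by simp

lemma card_walls_at:
  assumes "admissible base_triple us"
  shows "card (walls_at Q V (vert us)) = card (uncrossed base_triple us)" "finite (walls_at Q V (vert us))"
proof -
  have "uncrossed base_triple us = L0 ` {i. L0 i \<in> uncrossed base_triple us}"
    using uncrossed_subset[of base_triple us] by (auto simp: base_triple_def)
  moreover have "inj L0"
    by (rule injI) simp
  ultimately have "card (uncrossed base_triple us) = card {i. L0 i \<in> uncrossed base_triple us}"
    by (metis card_image inj_on_subset subset_UNIV)
  thus "card (walls_at Q V (vert us)) = card (uncrossed base_triple us)"
    unfolding walls_at_vert[OF assms] using wface_inj
    by (simp add: card_image inj_on_subset[OF wface_inj])
  have "finite (UNIV :: dir set)"
    by (rule finite_subset[of _ "{DX, DY, DZ}"]) (auto intro: dir.exhaust)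
  hence "finite {i. L0 i \<in> uncrossed base_triple us}"
    using finite_subset subset_UNIV by blast
  thus "finite (walls_at Q V (vert us))"
    unfolding walls_at_vert[OF assms] by simp
qed

lemma card_ascendants:
  assumes "us \<in> words n"
  shows "card (ascendants Q V n (vert us)) = card (descents us)"
proof -
  have us: "admissible base_triple us" "length us = n"
    using assms by (auto simp: words_def)
  have "ascendants Q V n (vert us) = (\<lambda>a. vert (a # us)) ` descents us"
  proof (intro equalityI subsetI)
    fix u
    assume u: "u \<in> ascendants Q V n (vert us)"
    hence "adj Q V (vert us) u"
      unfolding ascendants_def using adj_sym by blast
    then obtain a where a: "u = vert (a # us)" "admissible base_triple (a # us) \<or> a \<in> descents us"
      using adj_vert[OF us(1)] by blast
    have "\<not> admissible base_triple (a # us)"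
    proof
      assume "admissible base_triple (a # us)"
      hence "u \<in> level Q V (Suc n)"
        unfolding level_eq words_def using a(1) us(2) by auto
      moreover have "u \<in> level Q V (n - 1)"
        using u unfolding ascendants_def by blast
      ultimately show False
        using level_unique by fastforce
    qed
    thus "u \<in> (\<lambda>a. vert (a # us)) ` descents us"
      using a by blast
  next
    fix u
    assume "u \<in> (\<lambda>a. vert (a # us)) ` descents us"
    then obtain a where a: "a \<in> descents us" "u = vert (a # us)"
      by blast
    obtain us' where us': "admissible base_triple us'" "length us = Suc (length us')" "u = vert us'"
      using vert_pop[OF us(1) a(1)] a(2) by auto
    have "u \<in> level Q V (n - 1)"
      unfolding level_eq words_def using us' us(2) by auto
    moreover have "adj Q V u (vert us)"
      using adj_sym[OF adj_vertI[OF us(1)]] a by blast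
    ultimately show "u \<in> ascendants Q V n (vert us)"
      unfolding ascendants_def by blast
  qed
  moreover have "inj_on (\<lambda>a. vert (a # us)) (descents us)"
    by (intro inj_onI) (simp add: vert_eq_iff point_of_Cons_inj)
  ultimately show ?thesis
    by (simp add: card_image)
qed

end

section \<open>Label sums as numbers of words\<close>

definition word_count :: "nat \<Rightarrow> nat \<Rightarrow> nat \<Rightarrow> nat" where
  "word_count m k n = card {us \<in> words n. card (uncrossed base_triple us) = m \<and> card (descents us) = k}"

lemma words_0: "words 0 = {[]}"
  by (auto simp: words_def)

text \<open>The empty word has all three walls uncrossed.\<close>

lemma word_count_0: "m < 3 \<Longrightarrow> word_count m k 0 = 0"
  by (auto simp: word_count_def words_0 card_base_triple)

context apex_frame
begin

lemma type_One_iff: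
  assumes "us \<in> words n" "n \<ge> 1"
  shows "vert us \<in> type_One Q V n \<longleftrightarrow> card (uncrossed base_triple us) \<ge> 2"
proof -
  have us: "admissible base_triple us"
    using assms by (auto simp: words_def)
  have "(\<exists>F\<in>A. \<exists>F'\<in>A. F \<noteq> F') \<longleftrightarrow> 2 \<le> card A" if "finite A" for A :: "point set set"
  proof
    assume "\<exists>F\<in>A. \<exists>F'\<in>A. F \<noteq> F'"
    then obtain F F' where F: "{F, F'} \<subseteq> A" "F \<noteq> F'"
      by blast
    thus "2 \<le> card A"
      using card_mono[OF that F(1)] card_insert_disjoint[of "{F'}" F] by simp
  next
    assume "2 \<le> card A"
    thus "\<exists>F\<in>A. \<exists>F'\<in>A. F \<noteq> F'"
      by (metis card_le_Suc0_iff_eq[OF that] not_less_eq_eq numeral_2_eq_2)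
  qed
  from this[OF card_walls_at(2)[OF us]] show ?thesis
    unfolding type_One_def card_walls_at(1)[OF us] using assms level_eq by auto
qed

lemma label_sum_types:
  "label_sum Q V (type_A Q V n) = real (word_count 1 2 n)"
  "label_sum Q V (type_B Q V n) = real (word_count 1 1 n)"
  "label_sum Q V (type_C Q V n) = real (word_count 0 3 n)"
  "label_sum Q V (type_D Q V n) = real (word_count 0 2 n)"
  "label_sum Q V (type_E Q V n) = real (word_count 0 1 n)"
proof -
  \<comment> \<open>Common to the five types; on level 0 both sides vanish because
    \<open>m < 3\<close>.\<close>
  have gen: "label_sum Q V S = real (word_count m k n)"
    if S: "S \<subseteq> level Q V n" "n = 0 \<Longrightarrow> S = {}" "m < 3"
      "\<And>us. us \<in> words n \<Longrightarrow> n \<ge> 1 \<Longrightarrow> vert us \<in> S \<longleftrightarrow> card (uncrossed base_triple us) = m \<and> card (descents us) = k"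
    for S m k
  proof (cases "n = 0")
    case True
    thus ?thesis
      using S(2,3) word_count_0 by (simp add: label_sum_def)
  next
    case False
    hence "{us \<in> words n. vert us \<in> S} =
        {us \<in> words n. card (uncrossed base_triple us) = m \<and> card (descents us) = k}"
      using S(4) by auto
    thus ?thesis
      using label_sum_eq[OF S(1)] by (simp add: word_count_def)
  qed
  have in_level: "vert us \<in> level Q V n" if "us \<in> words n" for us
    using that level_eq by blast
  have walls: "walls_at Q V (vert us) = {} \<longleftrightarrow> \<not> card (uncrossed base_triple us) \<ge> 1" if "us \<in> words n" for us
    using card_walls_at[of us] card_0_eq[OF card_walls_at(2)[of us]] that
    by (auto simp: words_def Suc_le_eq)
  show "label_sum Q V (type_A Q V n) = real (word_count 1 2 n)"
    by (rule gen) (auto simp: type_A_def in_level walls card_ascendants type_One_iff simp del: card_0_eq card_eq_0_iff)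
  show "label_sum Q V (type_B Q V n) = real (word_count 1 1 n)"
    by (rule gen) (auto simp: type_B_def in_level walls card_ascendants type_One_iff simp del: card_0_eq card_eq_0_iff)
  show "label_sum Q V (type_C Q V n) = real (word_count 0 3 n)"
    by (rule gen) (auto simp: type_C_def in_level walls card_ascendants simp del: card_0_eq card_eq_0_iff)
  show "label_sum Q V (type_D Q V n) = real (word_count 0 2 n)"
    by (rule gen) (auto simp: type_D_def in_level walls card_ascendants simp del: card_0_eq card_eq_0_iff)
  show "label_sum Q V (type_E Q V n) = real (word_count 0 1 n)"
    by (rule gen) (auto simp: type_E_def in_level walls card_ascendants simp del: card_0_eq card_eq_0_iff)
qed

lemma label_sum_level: "label_sum Q V (level Q V n) = real (card (words n))"
proof -
  have "{us \<in> words n. vert us \<in> level Q V n} = words n"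
    using level_eq by auto
  thus ?thesis
    using label_sum_eq[of "level Q V n" n] by simp
qed

lemma finite_level: "finite (level Q V n)"
  unfolding level_eq using finite_words by simp

end

section \<open>Counting admissible words\<close>

text \<open>A new letter commutes with the descents that survive by the definition of
  \<open>descents\<close>, and with the remaining walls by admissibility.\<close>

lemma state_clique:
  assumes "admissible base_triple us"
  shows "clique (descents us \<union> uncrossed base_triple us)" "descents us \<inter> uncrossed base_triple us = {}"
proof -
  have "clique (descents us \<union> uncrossed base_triple us) \<and> descents us \<inter> uncrossed base_triple us = {}"
    using assms
  proof (induction us)
    case Nil
    thus ?case
      using clique_base_triple by simp
  next
    case (Cons a us)
    hence IH: "clique (descents us \<union> uncrossed base_triple us)" "descents us \<inter> uncrossed base_triple us = {}"
      by auto
    have "commutes a b" if "b \<in> descents (a # us) \<union> uncrossed base_triple (a # us)" "b \<noteq> a" for b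
      using that Cons.prems by auto
    moreover have "commutes b c" if "b \<in> descents us \<union> uncrossed base_triple us" "c \<in> descents us \<union> uncrossed base_triple us" "b \<noteq> c" for b c
      using that IH(1) unfolding clique_def by blast
    ultimately have "clique (descents (a # us) \<union> uncrossed base_triple (a # us))"
      unfolding clique_def using commutes_sym by auto
    thus ?case
      using IH(2) by auto
  qed
  thus "clique (descents us \<union> uncrossed base_triple us)" "descents us \<inter> uncrossed base_triple us = {}"
    by blast+
qed

text \<open>The icosahedron has no four mutually adjacent vertices, which leaves only six kinds of
  states.\<close>

lemma no_clique_4_check:
  "list_all (\<lambda>a. list_all (\<lambda>b. list_all (\<lambda>c. list_all (\<lambda>d. \<not> commutes c d)
     (filter (commutes b) (filter (commutes a) letters))) (filter (commutes b) (filter (commutes a) letters)))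
     (filter (commutes a) letters)) letters"
  by code_simp

lemma no_clique_4:
  assumes "commutes a b" "commutes a c" "commutes b c" "commutes a d" "commutes b d" "commutes c d"
  shows False
  using no_clique_4_check assms unfolding list_all_iff set_filter set_letters by blast

lemma clique_card_le:
  assumes "clique T"
  shows "card T \<le> 3"
proof (rule ccontr)
  assume "\<not> card T \<le> 3"
  hence "Suc 3 \<le> card T"
    by simp
  then obtain S where S: "S \<subseteq> T" "card S = Suc 3"
    by (rule obtain_subset_with_card_n) blast
  obtain d S' where d: "S = insert d S'" "d \<notin> S'" "card S' = 3"
    using S(2) unfolding card_Suc_eq by blast
  obtain a b c where abc: "S' = {a, b, c}" "a \<noteq> b" "b \<noteq> c" "a \<noteq> c"
    using d(3) unfolding card_3_iff by blast
  have ad: "a \<noteq> d" "b \<noteq> d" "c \<noteq> d" and inT: "a \<in> T" "b \<in> T" "c \<in> T" "d \<in> T"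
    using S(1) d(1,2) abc(1) by auto
  have commutes: "commutes x y" if "x \<in> T" "y \<in> T" "x \<noteq> y" for x y
    using assms that unfolding clique_def by blast
  show False
    using commutes[OF inT(1,2) abc(2)] commutes[OF inT(1,3) abc(4)] commutes[OF inT(2,3) abc(3)]
      commutes[OF inT(1,4) ad(1)] commutes[OF inT(2,4) ad(2)] commutes[OF inT(3,4) ad(3)]
    by (rule no_clique_4)
qed

text \<open>The pairs (number of uncrossed walls, number of ascendants) of the descendants of a vertex with
  descents \<open>xs\<close> and uncrossed walls \<open>bs\<close>.\<close>

definition profile :: "letter list \<Rightarrow> letter list \<Rightarrow> (nat \<times> nat) list" where
  "profile xs bs = map (\<lambda>a. (length (filter (\<lambda>i. i \<noteq> a) bs), Suc (length (filter (commutes a) xs))))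
     (filter (\<lambda>a. a \<notin> set xs \<and> list_all (\<lambda>i. a = i \<or> commutes a i) bs) letters)"

text \<open>The pairs belonging to the types \<open>A\<close>, \<open>B\<close>, \<open>C\<close>, \<open>D\<close>, \<open>E\<close> and "1".\<close>

definition types :: "(nat \<times> nat) list" where
  "types = [(1, 2), (1, 1), (0, 3), (0, 2), (0, 1), (2, 1)]"

definition tally :: "(nat \<times> nat) list \<Rightarrow> nat list" where
  "tally L = map (count_list L) types"

definition base_letters :: "letter list" where
  "base_letters = [L0 DX, L0 DY, L0 DZ]"

lemma children_initial: "tally (profile [] base_letters) = [0, 0, 0, 0, 0, 3]"
  by code_simp

text \<open>The five neighbours of \<open>x\<close> keep it as a descent (type D), the six other
  letters do not (type E). Here and below, evaluation over all letters replaces an appeal to the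
  symmetry of the icosahedron.\<close>

lemma children_E_check: "list_all (\<lambda>x. tally (profile [x] []) = [0, 0, 0, 5, 6, 0]) letters"
  by code_simp

lemma children_E: "tally (profile [x] []) = [0, 0, 0, 5, 6, 0]"
  using children_E_check unfolding list_all_iff set_filter set_letters by blast

lemma children_D_check: "list_all (\<lambda>x. list_all (\<lambda>y. tally (profile [x, y] []) = [0, 0, 2, 4, 4, 0])
    (filter (commutes x) letters)) letters"
  by code_simp

lemma children_D: "commutes x y \<Longrightarrow> tally (profile [x, y] []) = [0, 0, 2, 4, 4, 0]"
  using children_D_check unfolding list_all_iff set_filter set_letters by blast

lemma children_C_check: "list_all (\<lambda>x. list_all (\<lambda>y. list_all (\<lambda>z.
    tally (profile [x, y, z] []) = [0, 0, 3, 3, 3, 0])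
    (filter (commutes y) (filter (commutes x) letters))) (filter (commutes x) letters)) letters"
  by code_simp

lemma children_C: "commutes x y \<Longrightarrow> commutes x z \<Longrightarrow> commutes y z \<Longrightarrow>
    tally (profile [x, y, z] []) = [0, 0, 3, 3, 3, 0]"
  using children_C_check unfolding list_all_iff set_filter set_letters by blast

text \<open>The letter \<open>i\<close> crosses the wall and gives type D. Of the other four
  neighbours of \<open>i\<close>, two commute with \<open>x\<close> (type A) and two do not (type
  B).\<close>

lemma children_B_check: "list_all (\<lambda>i. list_all (\<lambda>x. tally (profile [x] [i]) = [2, 2, 0, 1, 0, 0])
    (filter (commutes i) letters)) base_letters"
  by code_simp

lemma set_base_letters: "set base_letters = base_triple"
  by (simp add: base_letters_def base_triple_eq)

lemma children_B: "i \<in> base_triple \<Longrightarrow> commutes i x \<Longrightarrow> tally (profile [x] [i]) = [2, 2, 0, 1, 0, 0]"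
  using children_B_check unfolding list_all_iff set_filter set_letters set_base_letters by blast

lemma children_A_check: "list_all (\<lambda>i. list_all (\<lambda>x. list_all (\<lambda>y.
    tally (profile [x, y] [i]) = [2, 1, 1, 0, 0, 0])
    (filter (commutes x) (filter (commutes i) letters))) (filter (commutes i) letters)) base_letters"
  by code_simp

lemma children_A: "i \<in> base_triple \<Longrightarrow> commutes i x \<Longrightarrow> commutes i y \<Longrightarrow> commutes x y \<Longrightarrow>
    tally (profile [x, y] [i]) = [2, 1, 1, 0, 0, 0]"
  using children_A_check unfolding list_all_iff set_filter set_letters set_base_letters by blast

text \<open>Crossing one of the walls gives type A; the single letter that stays on both, the other
  common neighbour of \<open>i\<close> and \<open>j\<close>, continues the line of type 1.\<close>

lemma children_One_check: "list_all (\<lambda>i. list_all (\<lambda>j. list_all (\<lambda>x.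
    tally (profile [x] [i, j]) = [2, 0, 0, 0, 0, 1])
    (filter (commutes j) (filter (commutes i) letters))) (filter (commutes i) base_letters)) base_letters"
  by code_simp

lemma children_One: "i \<in> base_triple \<Longrightarrow> j \<in> base_triple \<Longrightarrow> commutes i j \<Longrightarrow> commutes i x \<Longrightarrow> commutes j x \<Longrightarrow>
    tally (profile [x] [i, j]) = [2, 0, 0, 0, 0, 1]"
  using children_One_check unfolding list_all_iff set_filter set_letters set_base_letters by blast

lemma finite_filter_card: "distinct xs \<Longrightarrow> card (set xs \<inter> {b. P b}) = length (filter P xs)"
  by (simp flip: distinct_card[of "filter P xs"] add: Int_def)

text \<open>The counterpart of \<open>profile\<close> for sets; \<open>step_count_profile\<close>
  reduces it to lists, where it can be evaluated.\<close>

definition step_count :: "letter set \<Rightarrow> letter set \<Rightarrow> nat \<times> nat \<Rightarrow> nat" where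
  "step_count R B = (\<lambda>(m, k). card {a. a \<notin> R \<and> (\<forall>i\<in>B. a = i \<or> commutes a i) \<and>
     card (B - {a}) = m \<and> card (insert a (R \<inter> {b. commutes a b})) = k})"

lemma distinct_letters: "distinct letters"
  by (simp add: letters_def)

lemma step_count_profile:
  assumes "distinct xs" "distinct bs"
  shows "step_count (set xs) (set bs) mk = count_list (profile xs bs) mk"
proof -
  obtain m k where mk: "mk = (m, k)" by (cases mk)
  have 1: "card (set bs - {a}) = length (filter (\<lambda>i. i \<noteq> a) bs)" for a
    using finite_filter_card[OF assms(2), of "\<lambda>i. i \<noteq> a"] by (simp add: Diff_eq Compl_eq)
  have 2: "card (insert a (set xs \<inter> {b. commutes a b})) = Suc (length (filter (commutes a) xs))"
    if "a \<notin> set xs" for a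
    using finite_filter_card[OF assms(1), of "commutes a"] that by (subst card_insert_disjoint) auto
  have "{a. a \<notin> set xs \<and> (\<forall>i\<in>set bs. a = i \<or> commutes a i) \<and>
     card (set bs - {a}) = m \<and> card (insert a (set xs \<inter> {b. commutes a b})) = k} =
     set letters \<inter> {a. (a \<notin> set xs \<and> list_all (\<lambda>i. a = i \<or> commutes a i) bs) \<and>
     (m, k) = (length (filter (\<lambda>i. i \<noteq> a) bs), Suc (length (filter (commutes a) xs)))}"
    using 1 2 by (auto simp: set_letters list_all_iff)
  thus ?thesis
    using finite_filter_card[OF distinct_letters]
    by (simp add: mk step_count_def profile_def count_list_eq_length_filter filter_map o_def)
qed

lemma step_count_eq:
  assumes "distinct xs" "distinct bs" "R = set xs" "B = set bs" "tally (profile xs bs) = vs"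
  shows "map (step_count R B) types = vs"
proof -
  have "step_count R B = count_list (profile xs bs)"
    unfolding assms(3,4) by (rule ext) (rule step_count_profile[OF assms(1,2)])
  thus ?thesis
    using assms(5) by (simp add: tally_def)
qed

text \<open>\<open>R\<close> is nonempty and, by \<open>state_clique\<close>, forms with the
  disjoint set \<open>B\<close> a clique, which has at most three letters. So only six pairs occur,
  and the final \<open>else\<close> is the pair (2, 1).\<close>

lemma step_counts:
  assumes us: "us \<in> words n" "n \<ge> 1"
  defines "R \<equiv> descents us" and "B \<equiv> uncrossed base_triple us"
  shows "(card B, card R) \<in> set types" and
    "map (step_count R B) types =
      (if (card B, card R) = (1, 2) then [2, 1, 1, 0, 0, 0]
       else if (card B, card R) = (1, 1) then [2, 2, 0, 1, 0, 0]
       else if (card B, card R) = (0, 3) then [0, 0, 3, 3, 3, 0]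
       else if (card B, card R) = (0, 2) then [0, 0, 2, 4, 4, 0]
       else if (card B, card R) = (0, 1) then [0, 0, 0, 5, 6, 0]
       else [2, 0, 0, 0, 0, 1])"
proof -
  have admissible: "admissible base_triple us"
    using us by (simp add: words_def)
  have cl: "clique (R \<union> B)" and dis: "R \<inter> B = {}"
    using state_clique[OF admissible] by (simp_all add: R_def B_def)
  have BT: "B \<subseteq> base_triple"
    unfolding B_def by (rule uncrossed_subset)
  have "R \<noteq> {}"
    using us by (cases us) (auto simp: words_def R_def)
  hence R1: "card R \<ge> 1"
    by (simp add: Suc_le_eq card_gt_0_iff)
  have "card R + card B \<le> 3"
    using clique_card_le[OF cl] dis by (simp add: card_Un_disjoint)
  with R1 consider "card B = 0" "card R = 1" | "card B = 0" "card R = 2" | "card B = 0" "card R = 3"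
    | "card B = 1" "card R = 1" | "card B = 1" "card R = 2" | "card B = 2" "card R = 1"
    by linarith
  note cases = this
  from cases show "(card B, card R) \<in> set types"
    by cases (simp_all add: types_def)
  have cm: "commutes a b" if "a \<in> R \<union> B" "b \<in> R \<union> B" "a \<noteq> b" for a b
    using cl that unfolding clique_def by blast
  from cases show "map (step_count R B) types =
      (if (card B, card R) = (1, 2) then [2, 1, 1, 0, 0, 0]
       else if (card B, card R) = (1, 1) then [2, 2, 0, 1, 0, 0]
       else if (card B, card R) = (0, 3) then [0, 0, 3, 3, 3, 0]
       else if (card B, card R) = (0, 2) then [0, 0, 2, 4, 4, 0]
       else if (card B, card R) = (0, 1) then [0, 0, 0, 5, 6, 0]
       else [2, 0, 0, 0, 0, 1])"
  proof cases
    case 1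
    then obtain x where x: "R = {x}" "B = {}"
      by (auto simp: card_1_singleton_iff)
    have "map (step_count R B) types = [0, 0, 0, 5, 6, 0]"
      using children_E by (intro step_count_eq[of "[x]" "[]"]) (auto simp: x)
    thus ?thesis using 1 by simp
  next
    case 2
    then obtain x y where x: "R = {x, y}" "x \<noteq> y" "B = {}"
      by (auto simp: card_2_iff)
    have "map (step_count R B) types = [0, 0, 2, 4, 4, 0]"
    proof (rule step_count_eq[of "[x, y]" "[]"])
      show "tally (profile [x, y] []) = [0, 0, 2, 4, 4, 0]"
        using cm[of x y] x by (intro children_D) auto
    qed (auto simp: x)
    thus ?thesis using 2 by simp
  next
    case 3
    then obtain x y z where x: "R = {x, y, z}" "x \<noteq> y" "y \<noteq> z" "x \<noteq> z" "B = {}"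
      by (auto simp: card_3_iff)
    have "map (step_count R B) types = [0, 0, 3, 3, 3, 0]"
    proof (rule step_count_eq[of "[x, y, z]" "[]"])
      show "tally (profile [x, y, z] []) = [0, 0, 3, 3, 3, 0]"
        using cm[of x y] cm[of x z] cm[of y z] x by (intro children_C) auto
    qed (auto simp: x)
    thus ?thesis using 3 by simp
  next
    case 4
    then obtain x i where x: "R = {x}" "B = {i}"
      by (auto simp: card_1_singleton_iff)
    have "map (step_count R B) types = [2, 2, 0, 1, 0, 0]"
    proof (rule step_count_eq[of "[x]" "[i]"])
      show "tally (profile [x] [i]) = [2, 2, 0, 1, 0, 0]"
        using BT cm[of i x] x dis by (intro children_B) auto
    qed (auto simp: x)
    thus ?thesis using 4 by simp
  next
    case 5
    then obtain x y i where x: "R = {x, y}" "x \<noteq> y" "B = {i}"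
      by (auto simp: card_1_singleton_iff card_2_iff)
    have "map (step_count R B) types = [2, 1, 1, 0, 0, 0]"
    proof (rule step_count_eq[of "[x, y]" "[i]"])
      show "tally (profile [x, y] [i]) = [2, 1, 1, 0, 0, 0]"
        using BT cm[of i x] cm[of i y] cm[of x y] x dis by (intro children_A) auto
    qed (auto simp: x)
    thus ?thesis using 5 by simp
  next
    case 6
    then obtain x i j where x: "R = {x}" "B = {i, j}" "i \<noteq> j"
      by (auto simp: card_1_singleton_iff card_2_iff)
    have "map (step_count R B) types = [2, 0, 0, 0, 0, 1]"
    proof (rule step_count_eq[of "[x]" "[i, j]"])
      show "tally (profile [x] [i, j]) = [2, 0, 0, 0, 0, 1]"
        using BT cm[of i x] cm[of j x] cm[of i j] x dis by (intro children_One) auto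
    qed (auto simp: x)
    thus ?thesis using 6 by simp
  qed
qed

lemma word_count_step: "word_count m k (Suc n) = (\<Sum>us\<in>words n. step_count (descents us) (uncrossed base_triple us) (m, k))"
proof -
  define A where "A us = {a. a \<notin> descents us \<and> (\<forall>i\<in>uncrossed base_triple us. a = i \<or> commutes a i) \<and>
     card (uncrossed base_triple us - {a}) = m \<and> card (insert a (descents us \<inter> {b. commutes a b})) = k}" for us
  have "{us \<in> words (Suc n). card (uncrossed base_triple us) = m \<and> card (descents us) = k} =
      (\<lambda>(us, a). a # us) ` (SIGMA us:words n. A us)"
  proof (intro equalityI subsetI)
    fix ws
    assume ws: "ws \<in> {us \<in> words (Suc n). card (uncrossed base_triple us) = m \<and> card (descents us) = k}"
    then obtain a us where "ws = a # us"
      by (cases ws) (auto simp: words_def)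
    thus "ws \<in> (\<lambda>(us, a). a # us) ` (SIGMA us:words n. A us)"
      using ws by (intro image_eqI[of _ _ "(us, a)"]) (auto simp: words_def A_def)
  next
    fix ws
    assume "ws \<in> (\<lambda>(us, a). a # us) ` (SIGMA us:words n. A us)"
    thus "ws \<in> {us \<in> words (Suc n). card (uncrossed base_triple us) = m \<and> card (descents us) = k}"
      by (auto simp: words_def A_def)
  qed
  moreover have "inj_on (\<lambda>(us, a). a # us) X" for X :: "(letter list \<times> letter) set"
    by (auto intro: inj_onI)
  ultimately have "word_count m k (Suc n) = card (SIGMA us:words n. A us)"
    by (simp add: word_count_def card_image)
  also have "\<dots> = (\<Sum>us\<in>words n. card (A us))"
    by (rule card_SigmaI) (simp_all add: finite_words)
  finally show ?thesis
    by (simp add: A_def step_count_def)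
qed

text \<open>From level 1 on the indicators of the six states add up to 1 and express
  \<open>step_count\<close> linearly; summing over \<open>words n\<close> gives the
  recurrences.\<close>

definition type_indicator :: "nat \<Rightarrow> nat \<Rightarrow> letter list \<Rightarrow> nat" where
  "type_indicator m k us = (if card (uncrossed base_triple us) = m \<and> card (descents us) = k then 1 else 0)"

lemma word_count_type_indicator: "word_count m k n = (\<Sum>us\<in>words n. type_indicator m k us)"
proof -
  have "(\<Sum>us\<in>words n. type_indicator m k us) = card ({us \<in> words n. card (uncrossed base_triple us) = m \<and> card (descents us) = k})"
    using finite_words by (simp add: type_indicator_def sum.If_cases Int_def)
  thus ?thesis
    by (simp add: word_count_def)
qed

lemma step_count_type_indicator:
  assumes "us \<in> words n" "n \<ge> 1"
  defines "S \<equiv> step_count (descents us) (uncrossed base_triple us)"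
  shows "S (1, 2) = 2 * type_indicator 1 2 us + 2 * type_indicator 1 1 us + 2 * type_indicator 2 1 us"
    "S (1, 1) = type_indicator 1 2 us + 2 * type_indicator 1 1 us"
    "S (0, 3) = type_indicator 1 2 us + 3 * type_indicator 0 3 us + 2 * type_indicator 0 2 us"
    "S (0, 2) = type_indicator 1 1 us + 3 * type_indicator 0 3 us + 4 * type_indicator 0 2 us + 5 * type_indicator 0 1 us"
    "S (0, 1) = 3 * type_indicator 0 3 us + 4 * type_indicator 0 2 us + 6 * type_indicator 0 1 us"
    "S (2, 1) = type_indicator 2 1 us"
    "1 = type_indicator 1 2 us + type_indicator 1 1 us + type_indicator 0 3 us + type_indicator 0 2 us + type_indicator 0 1 us + type_indicator 2 1 us"
  using step_counts[OF assms(1,2)] unfolding S_def[symmetric]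
  by (auto simp: types_def type_indicator_def split: if_splits)

lemma word_count_rec:
  assumes "n \<ge> 1"
  shows "word_count 1 2 (Suc n) = 2 * word_count 1 2 n + 2 * word_count 1 1 n + 2 * word_count 2 1 n"
    "word_count 1 1 (Suc n) = word_count 1 2 n + 2 * word_count 1 1 n"
    "word_count 0 3 (Suc n) = word_count 1 2 n + 3 * word_count 0 3 n + 2 * word_count 0 2 n"
    "word_count 0 2 (Suc n) = word_count 1 1 n + 3 * word_count 0 3 n + 4 * word_count 0 2 n + 5 * word_count 0 1 n"
    "word_count 0 1 (Suc n) = 3 * word_count 0 3 n + 4 * word_count 0 2 n + 6 * word_count 0 1 n"
    "word_count 2 1 (Suc n) = word_count 2 1 n"
    "card (words n) = word_count 1 2 n + word_count 1 1 n + word_count 0 3 n + word_count 0 2 n + word_count 0 1 n + word_count 2 1 n"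
proof -
  note S = step_count_type_indicator[OF _ assms]
  show "word_count 1 2 (Suc n) = 2 * word_count 1 2 n + 2 * word_count 1 1 n + 2 * word_count 2 1 n"
    "word_count 1 1 (Suc n) = word_count 1 2 n + 2 * word_count 1 1 n"
    "word_count 0 3 (Suc n) = word_count 1 2 n + 3 * word_count 0 3 n + 2 * word_count 0 2 n"
    "word_count 0 2 (Suc n) = word_count 1 1 n + 3 * word_count 0 3 n + 4 * word_count 0 2 n + 5 * word_count 0 1 n"
    "word_count 0 1 (Suc n) = 3 * word_count 0 3 n + 4 * word_count 0 2 n + 6 * word_count 0 1 n"
    "word_count 2 1 (Suc n) = word_count 2 1 n"
    unfolding word_count_step by (simp_all only: word_count_type_indicator S(1-6) sum.distrib sum_distrib_left cong: sum.cong)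
  have "card (words n) = (\<Sum>us\<in>words n. 1)"
    by simp
  also have "\<dots> = (\<Sum>us\<in>words n. type_indicator 1 2 us + type_indicator 1 1 us + type_indicator 0 3 us + type_indicator 0 2 us + type_indicator 0 1 us + type_indicator 2 1 us)"
    by (rule sum.cong[OF refl S(7)])
  finally show "card (words n) = word_count 1 2 n + word_count 1 1 n + word_count 0 3 n + word_count 0 2 n + word_count 0 1 n + word_count 2 1 n"
    by (simp add: sum.distrib word_count_type_indicator)
qed

lemma word_count_1: "map (\<lambda>(m, k). word_count m k 1) types = [0, 0, 0, 0, 0, 3]"
proof -
  have "set [] = descents []" "set base_letters = base_triple"
    by (auto simp: base_letters_def base_triple_eq)
  hence "map (step_count (descents []) base_triple) types = [0, 0, 0, 0, 0, 3]"
    using children_initial by (intro step_count_eq[of "[]" base_letters]) (auto simp: base_letters_def)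
  thus ?thesis
    by (simp add: types_def word_count_step words_0)
qed

lemma word_count_One: "n \<ge> 1 \<Longrightarrow> word_count 2 1 n = 3"
proof (induction n rule: dec_induct)
  case base
  show ?case using word_count_1 by (simp add: types_def)
next
  case (step n)
  thus ?case using word_count_rec(6)[of n] by simp
qed

section \<open>Solving the recurrences\<close>

text \<open>The 6 comes from type 1: three vertices of label 1 on each level, each with two
  descendants of type A.\<close>

locale label_rec =
  fixes a b c d e s :: "nat \<Rightarrow> real"
  assumes init: "a 1 = 0" "b 1 = 0" "c 1 = 0" "d 1 = 0" "e 1 = 0"
    and rec: "\<And>n. n \<ge> 1 \<Longrightarrow> a (Suc n) = 2 * a n + 2 * b n + 6"
      "\<And>n. n \<ge> 1 \<Longrightarrow> b (Suc n) = a n + 2 * b n"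
      "\<And>n. n \<ge> 1 \<Longrightarrow> c (Suc n) = a n + 3 * c n + 2 * d n"
      "\<And>n. n \<ge> 1 \<Longrightarrow> d (Suc n) = b n + 3 * c n + 4 * d n + 5 * e n"
      "\<And>n. n \<ge> 1 \<Longrightarrow> e (Suc n) = 3 * c n + 4 * d n + 6 * e n"
    and total: "\<And>n. n \<ge> 1 \<Longrightarrow> s n = a n + b n + c n + d n + e n + 3"
begin

text \<open>The polynomial is (x - 1) * (x^2 - 4 * x + 2): the quadratic belongs to the 2 by 2
  matrix of \<open>a\<close> and \<open>b\<close>, and x - 1 removes the constant 6.\<close>

lemma rec3:
  assumes "x \<in> {a, b}" "n \<ge> 4"
  shows "x n = 5 * x (n - 1) - 6 * x (n - 2) + 2 * x (n - 3)"
proof -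
  define m where "m = n - 3"
  have m: "m \<ge> 1" "n = Suc (Suc (Suc m))" "n - 1 = Suc (Suc m)" "n - 2 = Suc m" "n - 3 = m"
    using assms(2) by (auto simp: m_def)
  have "a n = 5 * a (n - 1) - 6 * a (n - 2) + 2 * a (n - 3)"
    "b n = 5 * b (n - 1) - 6 * b (n - 2) + 2 * b (n - 3)"
    using rec(1,2)[OF m(1)] rec(1,2)[of "Suc m"] rec(1,2)[of "Suc (Suc m)"]
    unfolding m(3-5) unfolding m(2) by simp_all
  thus ?thesis
    using assms(1) by auto
qed

lemma rec6:
  assumes "x \<in> {a, b, c, d, e, s}" "n \<ge> 7"
  shows "x n = 18 * x (n - 1) - 99 * x (n - 2) + 226 * x (n - 3)
    - 224 * x (n - 4) + 92 * x (n - 5) - 12 * x (n - 6)"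
proof -
  define m where "m = n - 6"
  have m: "m \<ge> 1" "n = Suc (Suc (Suc (Suc (Suc (Suc m)))))" "n - 1 = Suc (Suc (Suc (Suc (Suc m))))"
    "n - 2 = Suc (Suc (Suc (Suc m)))" "n - 3 = Suc (Suc (Suc m))" "n - 4 = Suc (Suc m)"
    "n - 5 = Suc m" "n - 6 = m"
    using assms(2) by (auto simp: m_def)
  define P where "P x \<longleftrightarrow> x n = 18 * x (n - 1) - 99 * x (n - 2) + 226 * x (n - 3)
    - 224 * x (n - 4) + 92 * x (n - 5) - 12 * x (n - 6)" for x :: "nat \<Rightarrow> real"
  have r: "a (Suc n) = 2 * a n + 2 * b n + 6 \<and> b (Suc n) = a n + 2 * b n \<and>
      c (Suc n) = a n + 3 * c n + 2 * d n \<and> d (Suc n) = b n + 3 * c n + 4 * d n + 5 * e n \<and>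
      e (Suc n) = 3 * c n + 4 * d n + 6 * e n" if "n \<ge> 1" for n
    using rec[OF that] by blast
  \<comment> \<open>The recurrence of order six combines four shifts of \<open>rec3\<close> with the
    coefficients 1, -13, 28, -6 of the cubic.\<close>
  have "P a" "P b"
    using rec3[of a n] rec3[of b n] rec3[of a "n - 1"] rec3[of b "n - 1"] rec3[of a "n - 2"]
      rec3[of b "n - 2"] rec3[of a "n - 3"] rec3[of b "n - 3"] assms(2)
    unfolding P_def m(2-8) by auto
  \<comment> \<open>Six steps of the system express all values by those at \<open>m\<close>, in
    which the claim becomes a linear identity.\<close>
  moreover have "P c" "P d" "P e"
    using r[of m] r[of "Suc m"] r[of "Suc (Suc m)"] r[of "Suc (Suc (Suc m))"]
      r[of "Suc (Suc (Suc (Suc m)))"] r[of "Suc (Suc (Suc (Suc (Suc m))))"] m(1)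
    unfolding P_def m(2-8) by simp_all
  \<comment> \<open>The constant 3 satisfies the recurrence because the coefficients add up to
    1.\<close>
  moreover have "P s"
  proof -
    have "s k = a k + b k + c k + d k + e k + 3" if "k \<ge> m" for k
      using total[of k] m(1) that by simp
    thus ?thesis
      using \<open>P a\<close> \<open>P b\<close> \<open>P c\<close> \<open>P d\<close> \<open>P e\<close> unfolding P_def m(2-8) by simp
  qed
  ultimately show ?thesis
    using assms(1) unfolding P_def by auto
qed

lemma closed_ab:
  assumes "n \<ge> 1"
  shows "a n = (9 / 2 * sqrt 2 - 6) * (2 + sqrt 2) ^ n + (- (9 / 2) * sqrt 2 - 6) * (2 - sqrt 2) ^ n + 6"
    and "b n = (9 / 2 - 3 * sqrt 2) * (2 + sqrt 2) ^ n + (9 / 2 + 3 * sqrt 2) * (2 - sqrt 2) ^ n - 6"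
proof -
  have r: "sqrt 2 * (sqrt 2 * x) = 2 * x" for x :: real
    by (simp add: mult.assoc[symmetric])
  have "a n = (9 / 2 * sqrt 2 - 6) * (2 + sqrt 2) ^ n + (- (9 / 2) * sqrt 2 - 6) * (2 - sqrt 2) ^ n + 6 \<and>
    b n = (9 / 2 - 3 * sqrt 2) * (2 + sqrt 2) ^ n + (9 / 2 + 3 * sqrt 2) * (2 - sqrt 2) ^ n - 6"
    using assms
  proof (induction n rule: dec_induct)
    case base
    show ?case
      using init by (simp add: algebra_simps r add_divide_distrib diff_divide_distrib)
  next
    case (step n)
    define P where "P = (2 + sqrt 2) ^ n"
    define Q where "Q = (2 - sqrt 2) ^ n"
    have IH: "a n = (9 / 2 * sqrt 2 - 6) * P + (- (9 / 2) * sqrt 2 - 6) * Q + 6"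
      "b n = (9 / 2 - 3 * sqrt 2) * P + (9 / 2 + 3 * sqrt 2) * Q - 6"
      using step by (auto simp: P_def Q_def)
    show ?case
      unfolding rec(1,2)[OF step(1)] power_Suc P_def[symmetric] Q_def[symmetric] IH
      by (simp add: algebra_simps r add_divide_distrib diff_divide_distrib)
  qed
  thus "a n = (9 / 2 * sqrt 2 - 6) * (2 + sqrt 2) ^ n + (- (9 / 2) * sqrt 2 - 6) * (2 - sqrt 2) ^ n + 6"
    and "b n = (9 / 2 - 3 * sqrt 2) * (2 + sqrt 2) ^ n + (9 / 2 + 3 * sqrt 2) * (2 - sqrt 2) ^ n - 6"
    by blast+
qed

text \<open>What is left of \<open>s\<close> after removing the contributions of the roots 1,
  \<open>2 + sqrt 2\<close> and \<open>2 - sqrt 2\<close>.\<close>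

definition cubic_part :: "nat \<Rightarrow> real" where
  "cubic_part n = s n - (3 + 3 / 2 * (sqrt 2 - 1) * (2 + sqrt 2) ^ n - 3 / 2 * (sqrt 2 + 1) * (2 - sqrt 2) ^ n)"

lemma cubic_part_init: "cubic_part 1 = 0" "cubic_part 2 = 0" "cubic_part 3 = 6"
proof -
  have r: "sqrt 2 * (sqrt 2 * x) = 2 * x" for x :: real
    by (simp add: mult.assoc[symmetric])
  have "s 1 = 3"
    using total[of 1] init by simp
  moreover have "s 2 = 9"
    using total[of 2] rec[of 1] init by (simp add: numeral_2_eq_2)
  moreover have "s 3 = 33"
    using total[of 3] rec[of 1] rec[of 2] init by (simp add: numeral_2_eq_2 numeral_3_eq_3)
  ultimately show "cubic_part 1 = 0" "cubic_part 2 = 0" "cubic_part 3 = 6"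
    by (simp_all add: cubic_part_def power2_eq_square power3_eq_cube algebra_simps
        r add_divide_distrib diff_divide_distrib)
qed

text \<open>The cubic is the characteristic polynomial of the block of \<open>c\<close>,
  \<open>d\<close>, \<open>e\<close>. Applied to \<open>s\<close> it eliminates them and leaves
  \<open>a\<close> and \<open>b\<close>, which \<open>closed_ab\<close> gives explicitly.\<close>

lemma cubic_part_rec:
  assumes "n \<ge> 1"
  shows "cubic_part (Suc (Suc (Suc n))) =
    13 * cubic_part (Suc (Suc n)) - 28 * cubic_part (Suc n) + 6 * cubic_part n"
proof -
  have r: "sqrt 2 * (sqrt 2 * x) = 2 * x" for x :: real
    by (simp add: mult.assoc[symmetric])
  have t: "s k = a k + b k + c k + d k + e k + 3" if "k \<ge> n" for k
    using total[of k] assms that by simp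
  have "s (Suc (Suc (Suc n))) - 13 * s (Suc (Suc n)) + 28 * s (Suc n) - 6 * s n = - 30 - 18 * a n - 28 * b n"
    using rec[of n] rec[of "Suc n"] rec[of "Suc (Suc n)"] assms t[of n] t[of "Suc n"]
      t[of "Suc (Suc n)"] t[of "Suc (Suc (Suc n))"] by simp
  moreover define P where "P = (2 + sqrt 2) ^ n"
  moreover define Q where "Q = (2 - sqrt 2) ^ n"
  ultimately have "s (Suc (Suc (Suc n))) = 13 * s (Suc (Suc n)) - 28 * s (Suc n) + 6 * s n - 30
      - 18 * ((9 / 2 * sqrt 2 - 6) * P + (- (9 / 2) * sqrt 2 - 6) * Q + 6)
      - 28 * ((9 / 2 - 3 * sqrt 2) * P + (9 / 2 + 3 * sqrt 2) * Q - 6)"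
    using closed_ab[OF assms] by simp
  thus ?thesis
    unfolding cubic_part_def power_Suc P_def[symmetric] Q_def[symmetric]
    by (simp add: algebra_simps r add_divide_distrib diff_divide_distrib)
qed

end

section \<open>The cubic: solution of its recurrence, roots, numerical values\<close>

lemma cubic_recurrence_solution:
  fixes x y z :: real and u :: "nat \<Rightarrow> real"
  assumes roots: "\<And>t. t ^ 3 - 13 * t ^ 2 + 28 * t - 6 = (t - x) * (t - y) * (t - z)"
    and distinct: "x \<noteq> y" "y \<noteq> z" "x \<noteq> z"
    and u: "u 1 = 0" "u 2 = 0" "u 3 = 6"
      "\<And>n. n \<ge> 1 \<Longrightarrow> u (Suc (Suc (Suc n))) = 13 * u (Suc (Suc n)) - 28 * u (Suc n) + 6 * u n"
    and "n \<ge> 1"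
  shows "u n = 6 / (x * ((x - y) * (x - z))) * x ^ n + 6 / (y * ((y - x) * (y - z))) * y ^ n
    + 6 / (z * ((z - x) * (z - y))) * z ^ n"
proof -
  have "x * y * z = 6"
    using roots[of 0] by simp
  hence nz: "x \<noteq> 0" "y \<noteq> 0" "z \<noteq> 0"
    by auto
  have root: "x ^ 3 = 13 * x ^ 2 - 28 * x + 6" "y ^ 3 = 13 * y ^ 2 - 28 * y + 6" "z ^ 3 = 13 * z ^ 2 - 28 * z + 6"
    using roots[of x] roots[of y] roots[of z] by simp_all
  \<comment> \<open>Coefficients of the solution with values 0, 0, 6 at \<open>k = 0, 1, 2\<close>.
    The values of \<open>u\<close> start at 1, hence the extra factors \<open>x\<close>,
    \<open>y\<close>, \<open>z\<close> in the claim.\<close>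
  define X Y Z where "X = 6 / ((x - y) * (x - z))" and "Y = 6 / ((y - x) * (y - z))" and "Z = 6 / ((z - x) * (z - y))"
  define v where "v k = X * x ^ k + Y * y ^ k + Z * z ^ k" for k
  \<comment> \<open>The Vandermonde product, up to sign, as a common denominator.\<close>
  define D where "D = (x - y) * (y - z) * (x - z)"
  have D: "D \<noteq> 0"
    using distinct by (simp add: D_def)
  have XYZ: "X * D = 6 * (y - z)" "Y * D = 6 * (z - x)" "Z * D = 6 * (x - y)"
  proof -
    define p q t where "p = x - y" and "q = y - z" and "t = x - z"
    have "y - x = - p" "z - y = - q" "z - x = - t" "p \<noteq> 0" "q \<noteq> 0" "t \<noteq> 0"
      using distinct by (simp_all add: p_def q_def t_def)
    thus "X * D = 6 * (y - z)" "Y * D = 6 * (z - x)" "Z * D = 6 * (x - y)"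
      unfolding X_def Y_def Z_def D_def p_def[symmetric] q_def[symmetric] t_def[symmetric] by simp_all
  qed
  have "v k * D = 6 * (y - z) * x ^ k + 6 * (z - x) * y ^ k + 6 * (x - y) * z ^ k" for k
    unfolding XYZ[symmetric] v_def by (simp add: algebra_simps)
  from this[of 0] this[of 1] this[of 2] have "v 0 * D = 0" "v 1 * D = 0" "v 2 * D = 6 * D"
    by (simp_all add: D_def algebra_simps power2_eq_square)
  hence v: "v 0 = 0" "v 1 = 0" "v 2 = 6"
    using D by simp_all
  have vrec: "v (Suc (Suc (Suc k))) = 13 * v (Suc (Suc k)) - 28 * v (Suc k) + 6 * v k" for k
  proof -
    have *: "w ^ Suc (Suc (Suc k)) = 13 * w ^ Suc (Suc k) - 28 * w ^ Suc k + 6 * w ^ k"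
      if "w ^ 3 = 13 * w ^ 2 - 28 * w + 6" for w :: real
    proof -
      have "w ^ Suc (Suc (Suc k)) = w ^ 3 * w ^ k"
        by (simp add: power3_eq_cube)
      thus ?thesis
        unfolding that by (simp add: algebra_simps power2_eq_square)
    qed
    show ?thesis
      unfolding v_def *[OF root(1)] *[OF root(2)] *[OF root(3)] by (simp add: algebra_simps)
  qed
  have "u (Suc k) = v k \<and> u (Suc (Suc k)) = v (Suc k) \<and> u (Suc (Suc (Suc k))) = v (Suc (Suc k))" for k
  proof (induction k)
    case 0
    show ?case
      using u(1-3) v by (simp add: numeral_2_eq_2 numeral_3_eq_3)
  next
    case (Suc k)
    thus ?case
      using u(4)[of "Suc k"] vrec[of k] by simp
  qed
  then obtain k where k: "n = Suc k" "u n = v k"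
    using assms(9) by (cases n) auto
  have "6 / (w * p) * w ^ n = 6 / p * w ^ k" if "w \<noteq> 0" for w p :: real
    using that by (simp add: k(1))
  thus ?thesis
    unfolding k(2) v_def X_def Y_def Z_def using nz by simp
qed

text \<open>Trigonometric solution: for t = (13 + 2 * sqrt 85 * cos u) / 3 the equation becomes 17 *
  sqrt 85 * cos (3 * u) = 128, and 17^2 * 85 = 128^2 + 81 * 101 explains the arctangent.\<close>

lemma cubic_roots:
  fixes \<phi> x y z :: real
  assumes \<phi>: "\<phi> = 1 / 3 * arctan (9 * sqrt 101 / 128)"
    and x: "x = (- sqrt 85 * cos \<phi> - sqrt 3 * sqrt 85 * sin \<phi> + 13) / 3"
    and y: "y = (- sqrt 85 * cos \<phi> + sqrt 3 * sqrt 85 * sin \<phi> + 13) / 3"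
    and z: "z = (2 * sqrt 85 * cos \<phi> + 13) / 3"
  shows "x < y" "y < z" "t ^ 3 - 13 * t ^ 2 + 28 * t - 6 = (t - x) * (t - y) * (t - z)"
proof -
  have \<phi>0: "0 < \<phi>" "\<phi> < pi / 6"
    using arctan_ubound[of "9 * sqrt 101 / 128"] by (simp_all add: \<phi>)
  have s: "0 < sin \<phi>" "sin \<phi> < 1 / 2"
    using \<phi>0 sin_gt_zero[of \<phi>] sin_monotone_2pi[of \<phi> "pi / 6"] pi_gt_zero by (auto simp: sin_30)
  have c: "cos \<phi> > sqrt 3 / 2"
    using \<phi>0 cos_monotone_0_pi[of \<phi> "pi / 6"] by (auto simp: cos_30)
  have "sqrt 3 * (sqrt 3 / 2) < sqrt 3 * cos \<phi>"
    using c by (intro mult_strict_left_mono) auto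
  hence sc: "sin \<phi> < sqrt 3 * cos \<phi>"
    using s by simp
  show "x < y"
    unfolding x y using s by simp
  have "sqrt 3 * sin \<phi> < sqrt 3 * (sqrt 3 * cos \<phi>)"
    using sc by simp
  hence "sqrt 3 * sin \<phi> < 3 * cos \<phi>"
    by (simp add: mult.assoc[symmetric])
  hence "sqrt 85 * (sqrt 3 * sin \<phi>) < sqrt 85 * (3 * cos \<phi>)"
    by simp
  thus "y < z"
    unfolding y z by (simp add: algebra_simps)
  have "cos (3 * \<phi>) = 128 / (17 * sqrt 85)"
  proof -
    have "cos (3 * \<phi>) = 1 / sqrt (1 + (9 * sqrt 101 / 128)\<^sup>2)"
      by (simp add: \<phi> cos_arctan)
    also have "1 + (9 * sqrt 101 / 128)\<^sup>2 = 85 * (17 / 128)\<^sup>2"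
      by (simp add: power2_eq_square)
    also have "sqrt (85 * (17 / 128)\<^sup>2) = sqrt 85 * (17 / 128)"
      by (simp add: real_sqrt_mult)
    finally show ?thesis by simp
  qed
  hence "17 * sqrt 85 * (4 * cos \<phi> ^ 3 - 3 * cos \<phi>) = 128"
    by (simp add: cos_treble_cos)
  \<comment> \<open>From here on Vieta's formulas \<open>e1\<close>, \<open>e2\<close>,
    \<open>e3\<close> are pure algebra in these four quantities, with the relations
    \<open>c3\<close> and \<open>sq\<close>.\<close>
  define w C S r where defs: "w = sqrt 85" "C = cos \<phi>" "S = sin \<phi>" "r = sqrt 3"
  have c3: "17 * w * (4 * C ^ 3 - 3 * C) = 128"
    using \<open>17 * sqrt 85 * (4 * cos \<phi> ^ 3 - 3 * cos \<phi>) = 128\<close> by (simp add: defs)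
  have sq: "w * w = 85" "r * r = 3" "S * S = 1 - C * C"
    using sin_squared_eq[of \<phi>] by (simp_all add: defs power2_eq_square)
  have xy: "x = (- w * C - r * w * S + 13) / 3" "y = (- w * C + r * w * S + 13) / 3"
    "z = (2 * w * C + 13) / 3"
    by (simp_all add: x y z defs)
  have e1: "x + y + z = 13"
    by (simp add: xy field_simps)
  have p: "x * y = (340 * (C * C) - 26 * w * C - 86) / 9"
  proof -
    have "3 * x = 13 - w * C - r * w * S" "3 * y = 13 - w * C + r * w * S"
      by (simp_all add: xy)
    hence "(3 * x) * (3 * y) = (13 - w * C - r * w * S) * (13 - w * C + r * w * S)"
      by (simp only:)
    hence "9 * (x * y) = (13 - w * C) * (13 - w * C) - (r * r) * (w * w) * (S * S)"
      by (simp add: algebra_simps)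
    also have "\<dots> = 169 - 26 * w * C + (w * w) * (C * C) - (r * r) * (w * w) * (S * S)"
      by (simp add: algebra_simps)
    finally show ?thesis
      unfolding sq by (simp add: algebra_simps)
  qed
  have e2: "x * y + z * (x + y) = 28"
  proof -
    have "9 * (z * (x + y)) = 338 + 26 * w * C - 4 * (w * w) * (C * C)"
      by (simp add: xy field_simps)
    thus ?thesis
      unfolding p sq by (simp add: field_simps)
  qed
  have e3: "x * y * z = 6"
  proof -
    have "27 * (x * y * z) = (340 * (C * C) - 26 * w * C - 86) * (2 * w * C + 13)"
      unfolding p by (simp add: xy(3))
    also have "\<dots> = 680 * w * C ^ 3 - 52 * (w * w) * (C * C) + 4420 * (C * C) - 510 * w * C - 1118"
      by (simp add: algebra_simps power3_eq_cube)
    also have "\<dots> = 10 * (17 * w * (4 * C ^ 3 - 3 * C)) - 1118"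
      unfolding sq by (simp add: algebra_simps)
    finally show ?thesis
      unfolding c3 by simp
  qed
  have "(t - x) * (t - y) * (t - z) = t ^ 3 - (x + y + z) * t ^ 2 + (x * y + z * (x + y)) * t - x * y * z"
    by (simp add: algebra_simps power2_eq_square power3_eq_cube)
  thus "t ^ 3 - 13 * t ^ 2 + 28 * t - 6 = (t - x) * (t - y) * (t - z)"
    unfolding e1 e2 e3 by simp
qed

text \<open>Each interval contains a sign change of the cubic. Nine decimals are used because the
  largest root lies within 10^-8 of 10.3509295, the border of rounding to 10.350930.\<close>

lemma cubic_root_location:
  fixes x y z :: real
  assumes "x < y" "y < z" and roots: "\<And>t. t ^ 3 - 13 * t ^ 2 + 28 * t - 6 = (t - x) * (t - y) * (t - z)"
  shows "x \<in> {0.240683074..0.240683075}" "y \<in> {2.408387416..2.408387417}" "z \<in> {10.350929509..10.350929510}"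
proof -
  define p where "p t = t ^ 3 - 13 * t ^ 2 + 28 * t - 6" for t :: real
  have cont: "isCont p t" for t
    unfolding p_def by (intro continuous_intros)
  have "\<exists>t\<ge>0.240683074. t \<le> 0.240683075 \<and> p t = 0"
    using cont by (intro IVT) (auto simp: p_def power2_eq_square power3_eq_cube)
  moreover have "\<exists>t\<ge>2.408387416. t \<le> 2.408387417 \<and> p t = 0"
    using cont by (intro IVT2) (auto simp: p_def power2_eq_square power3_eq_cube)
  moreover have "\<exists>t\<ge>10.350929509. t \<le> 10.350929510 \<and> p t = 0"
    using cont by (intro IVT) (auto simp: p_def power2_eq_square power3_eq_cube)
  moreover have "p t = 0 \<longleftrightarrow> t = x \<or> t = y \<or> t = z" for t
    unfolding p_def roots by auto
  ultimately show "x \<in> {0.240683074..0.240683075}" "y \<in> {2.408387416..2.408387417}" "z \<in> {10.350929509..10.350929510}"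
    using assms(1,2) by force+
qed

text \<open>Each denominator is u * p'(u) for the cubic p and its root u. Modulo p it reduces to 13
  * u^2 - 56 * u + 18, which involves one root only and can be bounded on its interval.\<close>

lemma cubic_coefficients:
  fixes x y z :: real
  assumes "x < y" "y < z" and roots: "\<And>t. t ^ 3 - 13 * t ^ 2 + 28 * t - 6 = (t - x) * (t - y) * (t - z)"
  shows "\<bar>6 / (x * ((x - y) * (x - z))) - 1.137480\<bar> < 5 / 10 ^ 7"
    "\<bar>6 / (y * ((y - x) * (y - z))) - (- 0.144699)\<bar> < 5 / 10 ^ 7"
    "\<bar>6 / (z * ((z - x) * (z - y))) - 0.007219\<bar> < 5 / 10 ^ 7"
proof -
  note loc = cubic_root_location[OF assms]
  have e3: "x * y * z = 6"
    using roots[of 0] by simp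
  \<comment> \<open>Evaluation at 1 and -1, together with 0, recovers Vieta's relations from the
    factorisation.\<close>
  have e12: "1 - 13 + 28 - 6 = (1 - x) * (1 - y) * (1 - z)" "- 1 - 13 - 28 - 6 = (- 1 - x) * (- 1 - y) * (- 1 - z)"
    using roots[of 1] roots[of "-1"] by simp_all
  have e1: "x + y + z = 13" and e2: "x * y + y * z + x * z = 28"
    using e12 e3 by (simp_all add: algebra_simps)
  have D: "u * ((u - v) * (u - w)) = 13 * (u * u) - 56 * u + 18"
    if "u + v + w = 13" "u * v + v * w + u * w = 28" "u * v * w = 6" for u v w :: real
  proof -
    have "u * ((u - v) * (u - w)) = u * (u * u) - u * u * (v + w) + u * v * w"
      by (simp add: algebra_simps)
    also have "v + w = 13 - u"
      using that(1) by simp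
    also have "u * (u * u) - u * u * (13 - u) + u * v * w = 2 * (u * (u * u)) - 13 * (u * u) + 6"
      using that(3) by (simp add: algebra_simps)
    also have "u * (u * u) = 13 * (u * u) - 28 * u + 6"
    proof -
      have "u * (u * u) = u * u * (u + v + w) - u * (u * v + v * w + u * w) + u * v * w"
        by (simp add: algebra_simps)
      thus ?thesis
        unfolding that by simp
    qed
    finally show ?thesis by simp
  qed
  have sq: "l * l \<le> u * u \<and> u * u \<le> h * h" if "u \<in> {l..h}" "0 \<le> l" for l u h :: real
    using that by (auto intro: mult_mono)
  have Dx: "x * ((x - y) * (x - z)) = 13 * (x * x) - 56 * x + 18"
    using e1 e2 e3 by (intro D) (simp_all add: algebra_simps)
  have Dy: "y * ((y - x) * (y - z)) = 13 * (y * y) - 56 * y + 18"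
    using e1 e2 e3 by (intro D) (simp_all add: algebra_simps)
  have Dz: "z * ((z - x) * (z - y)) = 13 * (z * z) - 56 * z + 18"
    using e1 e2 e3 by (intro D) (simp_all add: algebra_simps)
  have pos: "13 * (x * x) - 56 * x + 18 > 0" "13 * (y * y) - 56 * y + 18 < 0" "13 * (z * z) - 56 * z + 18 > 0"
    using sq[OF loc(1)] sq[OF loc(2)] sq[OF loc(3)] loc by auto
  show "\<bar>6 / (x * ((x - y) * (x - z))) - 1.137480\<bar> < 5 / 10 ^ 7"
    unfolding Dx abs_less_iff using pos(1) sq[OF loc(1)] loc(1) by (auto simp: field_simps)
  show "\<bar>6 / (y * ((y - x) * (y - z))) - (- 0.144699)\<bar> < 5 / 10 ^ 7"
    unfolding Dy abs_less_iff using pos(2) sq[OF loc(2)] loc(2) by (auto simp: field_simps)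
  show "\<bar>6 / (z * ((z - x) * (z - y))) - 0.007219\<bar> < 5 / 10 ^ 7"
    unfolding Dz abs_less_iff using pos(3) sq[OF loc(3)] loc(3) by (auto simp: field_simps)
qed

theorem theorem5:
  fixes Q\<^sub>0 :: "((real^3) \<times> real) set" and V\<^sub>0 :: "(real^3) \<times> real"
    and a b c d e s :: "nat \<Rightarrow> real"
    and \<phi> \<alpha>\<^sub>4 \<alpha>\<^sub>5 \<alpha>\<^sub>6 :: real
  assumes cube: "Q\<^sub>0 \<in> cubes" and vertex: "V\<^sub>0 \<in> Q\<^sub>0"
    and a: "a = (\<lambda>n. label_sum Q\<^sub>0 V\<^sub>0 (type_A Q\<^sub>0 V\<^sub>0 n))"
    and b: "b = (\<lambda>n. label_sum Q\<^sub>0 V\<^sub>0 (type_B Q\<^sub>0 V\<^sub>0 n))"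
    and c: "c = (\<lambda>n. label_sum Q\<^sub>0 V\<^sub>0 (type_C Q\<^sub>0 V\<^sub>0 n))"
    and d: "d = (\<lambda>n. label_sum Q\<^sub>0 V\<^sub>0 (type_D Q\<^sub>0 V\<^sub>0 n))"
    and e: "e = (\<lambda>n. label_sum Q\<^sub>0 V\<^sub>0 (type_E Q\<^sub>0 V\<^sub>0 n))"
    and s: "s = (\<lambda>n. label_sum Q\<^sub>0 V\<^sub>0 (level Q\<^sub>0 V\<^sub>0 n))"
    and \<phi>: "\<phi> = 1 / 3 * arctan (9 * sqrt 101 / 128)"
    and \<alpha>\<^sub>4: "\<alpha>\<^sub>4 = (- sqrt 85 * cos \<phi> - sqrt 3 * sqrt 85 * sin \<phi> + 13) / 3"
    and \<alpha>\<^sub>5: "\<alpha>\<^sub>5 = (- sqrt 85 * cos \<phi> + sqrt 3 * sqrt 85 * sin \<phi> + 13) / 3"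
    and \<alpha>\<^sub>6: "\<alpha>\<^sub>6 = (2 * sqrt 85 * cos \<phi> + 13) / 3"
  shows "(\<forall>n\<in>{0, 1}. a n = 0 \<and> b n = 0 \<and> c n = 0 \<and> d n = 0 \<and> e n = 0) \<and>
    s 0 = 1 \<and>
    (\<forall>n\<ge>1. finite (level Q\<^sub>0 V\<^sub>0 n) \<and> s n = a n + b n + c n + d n + e n + 3) \<and>
    (\<forall>x\<in>{a, b, c, d, e, s}. \<forall>n\<ge>7.
       x n = 18 * x (n - 1) - 99 * x (n - 2) + 226 * x (n - 3)
             - 224 * x (n - 4) + 92 * x (n - 5) - 12 * x (n - 6)) \<and>
    (\<forall>x\<in>{a, b}. \<forall>n\<ge>4. x n = 5 * x (n - 1) - 6 * x (n - 2) + 2 * x (n - 3)) \<and>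
    (\<forall>n\<ge>1. a n = (9 / 2 * sqrt 2 - 6) * (2 + sqrt 2) ^ n
                   + (- (9 / 2) * sqrt 2 - 6) * (2 - sqrt 2) ^ n + 6) \<and>
    (\<forall>n\<ge>1. b n = (9 / 2 - 3 * sqrt 2) * (2 + sqrt 2) ^ n
                   + (9 / 2 + 3 * sqrt 2) * (2 - sqrt 2) ^ n - 6) \<and>
    \<bar>\<alpha>\<^sub>4 - 0.240683\<bar> < 5 / 10 ^ 7 \<and> \<bar>\<alpha>\<^sub>5 - 2.408387\<bar> < 5 / 10 ^ 7 \<and> \<bar>\<alpha>\<^sub>6 - 10.350930\<bar> < 5 / 10 ^ 7 \<and>
    {x::real. x ^ 3 - 13 * x ^ 2 + 28 * x - 6 = 0} = {\<alpha>\<^sub>4, \<alpha>\<^sub>5, \<alpha>\<^sub>6} \<and>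
    (\<exists>\<delta>\<^sub>4 \<delta>\<^sub>5 \<delta>\<^sub>6 :: real.
       \<bar>\<delta>\<^sub>4 - 1.137480\<bar> < 5 / 10 ^ 7 \<and> \<bar>\<delta>\<^sub>5 - (- 0.144699)\<bar> < 5 / 10 ^ 7 \<and> \<bar>\<delta>\<^sub>6 - 0.007219\<bar> < 5 / 10 ^ 7 \<and>
       (\<forall>n\<ge>1. s n = 3 + 3 / 2 * (sqrt 2 - 1) * (2 + sqrt 2) ^ n
                      - 3 / 2 * (sqrt 2 + 1) * (2 - sqrt 2) ^ n
                      + \<delta>\<^sub>4 * \<alpha>\<^sub>4 ^ n + \<delta>\<^sub>5 * \<alpha>\<^sub>5 ^ n + \<delta>\<^sub>6 * \<alpha>\<^sub>6 ^ n))"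
proof -
  obtain h where h: "frame h" "Q\<^sub>0 = h ` cell base_triple" "V\<^sub>0 = h apex"
    using frame_exists[OF cube vertex] by blast
  interpret apex_frame h Q\<^sub>0 V\<^sub>0
    using h by unfold_locales
  have word_count: "a n = real (word_count 1 2 n)" "b n = real (word_count 1 1 n)" "c n = real (word_count 0 3 n)"
    "d n = real (word_count 0 2 n)" "e n = real (word_count 0 1 n)" "s n = real (card (words n))" for n
    unfolding a b c d e s by (rule label_sum_types label_sum_level)+
  have init: "a 1 = 0" "b 1 = 0" "c 1 = 0" "d 1 = 0" "e 1 = 0"
    using word_count_1 unfolding word_count by (simp_all add: types_def)
  interpret label_rec a b c d e s
  proof
    fix n :: nat
    assume n: "n \<ge> 1"
    show "a (Suc n) = 2 * a n + 2 * b n + 6" "b (Suc n) = a n + 2 * b n"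
      "c (Suc n) = a n + 3 * c n + 2 * d n" "d (Suc n) = b n + 3 * c n + 4 * d n + 5 * e n"
      "e (Suc n) = 3 * c n + 4 * d n + 6 * e n" "s n = a n + b n + c n + d n + e n + 3"
      unfolding word_count word_count_rec[OF n] word_count_One[OF n] by simp_all
  qed (fact init)+
  note roots = cubic_roots[OF \<phi> \<alpha>\<^sub>4 \<alpha>\<^sub>5 \<alpha>\<^sub>6]
  note location = cubic_root_location[OF roots]
  define \<delta>\<^sub>4 \<delta>\<^sub>5 \<delta>\<^sub>6 where
    "\<delta>\<^sub>4 = 6 / (\<alpha>\<^sub>4 * ((\<alpha>\<^sub>4 - \<alpha>\<^sub>5) * (\<alpha>\<^sub>4 - \<alpha>\<^sub>6)))" and
    "\<delta>\<^sub>5 = 6 / (\<alpha>\<^sub>5 * ((\<alpha>\<^sub>5 - \<alpha>\<^sub>4) * (\<alpha>\<^sub>5 - \<alpha>\<^sub>6)))" and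
    "\<delta>\<^sub>6 = 6 / (\<alpha>\<^sub>6 * ((\<alpha>\<^sub>6 - \<alpha>\<^sub>4) * (\<alpha>\<^sub>6 - \<alpha>\<^sub>5)))"
  have zero: "\<forall>n\<in>{0, 1}. a n = 0 \<and> b n = 0 \<and> c n = 0 \<and> d n = 0 \<and> e n = 0"
    using init by (simp add: word_count word_count_0)
  have s0: "s 0 = 1"
    by (simp add: word_count words_0)
  have sum: "\<forall>n\<ge>1. finite (level Q\<^sub>0 V\<^sub>0 n) \<and> s n = a n + b n + c n + d n + e n + 3"
    using finite_level total by blast
  have near: "\<bar>\<alpha>\<^sub>4 - 0.240683\<bar> < 5 / 10 ^ 7" "\<bar>\<alpha>\<^sub>5 - 2.408387\<bar> < 5 / 10 ^ 7"
      "\<bar>\<alpha>\<^sub>6 - 10.350930\<bar> < 5 / 10 ^ 7"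
    using location by (auto simp: abs_less_iff)
  have root_set: "{x::real. x ^ 3 - 13 * x ^ 2 + 28 * x - 6 = 0} = {\<alpha>\<^sub>4, \<alpha>\<^sub>5, \<alpha>\<^sub>6}"
    unfolding roots(3) by auto
  have s_closed: "s n = 3 + 3 / 2 * (sqrt 2 - 1) * (2 + sqrt 2) ^ n
      - 3 / 2 * (sqrt 2 + 1) * (2 - sqrt 2) ^ n
      + \<delta>\<^sub>4 * \<alpha>\<^sub>4 ^ n + \<delta>\<^sub>5 * \<alpha>\<^sub>5 ^ n + \<delta>\<^sub>6 * \<alpha>\<^sub>6 ^ n" if "n \<ge> 1" for n
  proof -
    have "cubic_part n = \<delta>\<^sub>4 * \<alpha>\<^sub>4 ^ n + \<delta>\<^sub>5 * \<alpha>\<^sub>5 ^ n + \<delta>\<^sub>6 * \<alpha>\<^sub>6 ^ n"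
      unfolding \<delta>\<^sub>4_def \<delta>\<^sub>5_def \<delta>\<^sub>6_def using roots(1,2) that
      by (intro cubic_recurrence_solution roots(3) cubic_part_init cubic_part_rec) auto
    thus ?thesis
      by (simp add: cubic_part_def)
  qed
  note bounds = cubic_coefficients[OF roots, folded \<delta>\<^sub>4_def \<delta>\<^sub>5_def \<delta>\<^sub>6_def]
  have six: "\<forall>x\<in>{a, b, c, d, e, s}. \<forall>n\<ge>7. x n = 18 * x (n - 1) - 99 * x (n - 2)
      + 226 * x (n - 3) - 224 * x (n - 4) + 92 * x (n - 5) - 12 * x (n - 6)"
    by (intro ballI allI impI rec6)
  have three: "\<forall>x\<in>{a, b}. \<forall>n\<ge>4. x n = 5 * x (n - 1) - 6 * x (n - 2) + 2 * x (n - 3)"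
    by (intro ballI allI impI rec3)
  show ?thesis
    by (intro conjI zero s0 sum six three near root_set exI[of _ \<delta>\<^sub>4] exI[of _ \<delta>\<^sub>5]
        exI[of _ \<delta>\<^sub>6] bounds allI impI closed_ab s_closed)
qed

end
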